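(* Let $\mathbb{X},\mathbb{Y}$ be Polish spaces, let $X=(X(t))_{t\in\mathbb{R}}$ be a continuous $\mathbb{X}$-valued stochastic process on a probability space $(\Omega,\mathcal{F},\mathrm{P})$, and let $f:\mathbb{R}\times\mathbb{X}\to\mathbb{Y}$ be a continuous mapping. 1. If $X$ is almost periodic in distribution and $f$ is almost periodic with respect to the first variable, uniformly with respect to the second variable in compact subsets of $\mathbb{X}$, then $f(\cdot,X(\cdot))$ is almost periodic in distribution. 2. If $X$ is almost automorphic in distribution and $f$ is compact almost automorphic with respect to the first variable, uniformly with respect to the second variable in compact subsets of $\mathbb{X}$ (i.e. $f\in \mathrm{AA}_c\mathrm{U}_c(\mathbb{R}\times\mathbb{X},\mathbb{Y})$), then $f(\cdot,X(\cdot))$ is almost automorphic in distribution. 3. Suppose in addition that $\mathbb{X}$ and $\mathbb{Y}$ are (separable) Banach spaces. Let $\mu$ be a Borel measure on $\mathbb{R}$ with $\mu(\mathbb{R})=\infty$ and $\mu(I)<\infty$ for every bounded interval $I$, and let $p\ge 0$. Assume that $f=g+h$ with $g\in\mathrm{AA}_c\mathrm{U}_c(\mathbb{R}\times\mathbb{X},\mathbb{Y})$ and $h\in\mathcal{E}\mathrm{U}_c(\mathbb{R}\times\mathbb{X},\mathbb{Y},\mu)$, and that $g$ is continuous with respect to the second variable. Assume furthermore that for every $\varepsilon>0$ and every compact $K\subset\mathbb{X}$ there exists $\eta>0$ such that for all $x,y\in K$, $$\|x-y\|\le\eta\ \Rightarrow\ \sup_{t\in\mathbb{R}}\|f(t,x)-f(t,y)\|\le\varepsilon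 .$$ If $p>0$, assume also that there is a constant $C$ with $\|f(t,x)\|+\|g(t,x)\|\le C(1+\|x\|)$ for all $(t,x)\in\mathbb{R}\times\mathbb{X}$, and that $f$ is Lipschitz with respect to the second variable, uniformly with respect to the first one. If $X$ is $\mu$-pseudo almost automorphic in $p$-distribution, then $f(\cdot,X(\cdot))$ is $\mu$-pseudo almost automorphic in $p$-distribution.
   Context: Functions of a real variable. Let $E$ be a Polish space. A continuous $\varphi:\mathbb{R}\to E$ is almost automorphic if every real sequence $(t'_n)$ has a subsequence $(t_n)$ such that for every $t$ the limit $\psi(t)=\lim_n\varphi(t+t_n)$ exists and $\lim_n\psi(t-t_n)=\varphi(t)$. A continuous $\varphi:\mathbb{R}\to E$ is almost periodic if, for a complete distance $d$ generating the topology of $E$, for every $\varepsilon>0$ there is $l>0$ such that every interval of length $l$ contains $\tau$ with $\sup_{t\in\mathbb{R}}d(\varphi(t+\tau),\varphi(t))\le\varepsilon$ (this does not depend on the choice of the complete distance). Functions with parameter. $f:\mathbb{R}\times\mathbb{X}\to\mathbb{Y}$ is almost periodic with respect to the first variable, uniformly with respect to the second in compact subsets, if (for a complete distance $d$ on $\mathbb{Y}$) for every compact $K\subset\mathbb{X}$ and $\varepsilon>0$ there is $l>0$ such that every interval of length $l$ contains $\tau$ with $\sup_{t\in\mathbb{R},x\in K}d(f(t+\tau,x),f(t,x))\le\varepsilon$. $\mathrm{AA}_c\mathrm{U}_c(\mathbb{R}\times\mathbb{X},\mathbb{Y})$ is the set of $f:\mathbb{R}\times\mathbb{X}\to\mathbb{Y}$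 with $f(\cdot,x)$ continuous for each $x$, such that every real sequence $(t'_n)$ has a subsequence $(t_n)$ for which, for all $t,x$, the limit $\hat f(t,x)=\lim_n f(t+t_n,x)$ exists and $\lim_n\hat f(t-t_n,x)=f(t,x)$, for each $t$ both convergences are uniform in $x$ on compact subsets of $\mathbb{X}$, and such that all limit functions $\hat f$ arising in this way satisfy: $\hat f(\cdot,x)$ is continuous for each $x$. (Equivalently, both convergences are uniform on $I\times K$ for all compact intervals $I$ and compact $K\subset\mathbb{X}$.) $\mathcal{E}\mathrm{U}_c(\mathbb{R}\times\mathbb{X},\mathbb{Y},\mu)$ is the set of continuous $h:\mathbb{R}\times\mathbb{X}\to\mathbb{Y}$ such that for each $x$, $h(\cdot,x)$ is bounded and $\frac{1}{\mu([-r,r])}\int_{[-r,r]}\|h(t,x)\|d\mu(t)\to 0$ as $r\to\infty$, the convergence being uniform for $x$ in compact subsets of $\mathbb{X}$. Processes. A continuous process has continuous trajectories. $C_k(\mathbb{R},\mathbb{X})$ is the space of continuous functions $\mathbb{R}\to\mathbb{X}$ with the topology of uniform convergence on compact sets; $\tilde X(t)=X(t+\cdot)$ is viewed as a random variable in $C_k(\mathbb{R},\mathbb{X})$. $X$ is almost periodic (resp. almost automorphic) in distribution if $t\mapsto\operatorname{law}(\tilde X(t))$ is almost periodic (resp. almost automorphic) with values in the Borel probability measures on $C_k(\mathbb{R},\mathbb{X})$ with the narrow (weak) topology. For $p\ge0$, $X$ is almost automorphic in $p$-distribution if it is almost automorphic in distribution and, if $p>0$, $(\|X(t)\|^p)_{t\in\mathbb{R}}$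 is uniformly integrable. $X$ is $\mu$-pseudo almost automorphic in $p$-distribution if $X=Y+Z$ with $Y$ a continuous process almost automorphic in $p$-distribution and $Z\in\mathcal{E}(\mathbb{R},L^p(\Omega,\mathrm{P},\mathbb{X}),\mu)$, where: for $p>0$ this means that $t\mapsto Z(t)$ is continuous and bounded from $\mathbb{R}$ to $L^p$ and $\frac{1}{\mu([-r,r])}\int_{[-r,r]}(\mathrm{E}\|Z(t)\|^p)^{1/p}d\mu(t)\to0$ as $r\to\infty$; for $p=0$ it means that $\frac{1}{\mu([-r,r])}\int_{[-r,r]}\mathrm{E}(\|Z(t)\|\wedge1)\,d\mu(t)\to0$ as $r\to\infty$. *)

theory Defs
  imports "HOL-Probability.Probability"
begin

section \<open>Almost periodic and almost automorphic functions of a real variable\<close>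

definition complete_distance :: "'e topology \<Rightarrow> ('e \<Rightarrow> 'e \<Rightarrow> real) \<Rightarrow> bool" where
  "complete_distance T d \<longleftrightarrow>
     Metric_space (topspace T) d \<and> Metric_space.mtopology (topspace T) d = T \<and>
     Metric_space.mcomplete (topspace T) d"

text \<open>Values are taken in an abstract topology (in the application: a space of probability measures
  with the narrow topology). The notion does not depend on the choice of the complete distance.\<close>

definition almost_periodic :: "'e topology \<Rightarrow> (real \<Rightarrow> 'e) \<Rightarrow> bool" where
  "almost_periodic T \<phi> \<longleftrightarrow>
     continuous_map euclidean T \<phi> \<and>
     (\<exists>d. complete_distance T d \<and>
        (\<forall>\<epsilon>>0. \<exists>l>0. \<forall>a. \<exists>\<tau>\<in>{a..a + l}. \<forall>t. d (\<phi> (t + \<tau>)) (\<phi> t) \<le> \<epsilon>))"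

definition almost_automorphic :: "'e topology \<Rightarrow> (real \<Rightarrow> 'e) \<Rightarrow> bool" where
  "almost_automorphic T \<phi> \<longleftrightarrow>
     continuous_map euclidean T \<phi> \<and>
     (\<forall>s :: nat \<Rightarrow> real. \<exists>k. strict_mono k \<and> (\<exists>\<psi>. \<forall>t.
        limitin T (\<lambda>n. \<phi> (t + s (k n))) (\<psi> t) sequentially \<and>
        limitin T (\<lambda>n. \<psi> (t - s (k n))) (\<phi> t) sequentially))"

section \<open>Functions with parameter\<close>

definition almost_periodic_unif_compact ::
    "(real \<Rightarrow> 'x::topological_space \<Rightarrow> 'y::topological_space) \<Rightarrow> bool" where
  "almost_periodic_unif_compact f \<longleftrightarrow>
     (\<exists>d. complete_distance euclidean d \<and>
        (\<forall>K. compact K \<longrightarrow> (\<forall>\<epsilon>>0. \<exists>l>0. \<forall>a. \<exists>\<tau>\<in>{a..a + l}.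
           \<forall>t. \<forall>x\<in>K. d (f (t + \<tau>) x) (f t x) \<le> \<epsilon>)))"

text \<open>\<open>AA_limit f s g\<close>: along the sequence \<open>s\<close>, the translates of \<open>f\<close> converge to \<open>g\<close> and the
  backward translates of \<open>g\<close> converge to \<open>f\<close>, pointwise and, for each fixed time,
  uniformly on compact sets of parameters.\<close>

definition AA_limit ::
    "(real \<Rightarrow> 'x::topological_space \<Rightarrow> 'y::metric_space) \<Rightarrow> (nat \<Rightarrow> real) \<Rightarrow> (real \<Rightarrow> 'x \<Rightarrow> 'y) \<Rightarrow> bool"
where
  "AA_limit f s g \<longleftrightarrow>
     (\<forall>t x. (\<lambda>n. f (t + s n) x) \<longlonglongrightarrow> g t x \<and> (\<lambda>n. g (t - s n) x) \<longlonglongrightarrow> f t x) \<and>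
     (\<forall>t K. compact K \<longrightarrow>
        uniform_limit K (\<lambda>n x. f (t + s n) x) (\<lambda>x. g t x) sequentially \<and>
        uniform_limit K (\<lambda>n x. g (t - s n) x) (\<lambda>x. f t x) sequentially)"

definition AAcUc :: "(real \<Rightarrow> 'x::topological_space \<Rightarrow> 'y::metric_space) set" where
  "AAcUc = {f.
     (\<forall>x. continuous_on UNIV (\<lambda>t. f t x)) \<and>
     (\<forall>s :: nat \<Rightarrow> real. \<exists>k. strict_mono k \<and> (\<exists>g. AA_limit f (s \<circ> k) g)) \<and>
     (\<forall>s g. AA_limit f s g \<longrightarrow> (\<forall>x. continuous_on UNIV (\<lambda>t. g t x)))}"

definition sym_mean :: "real measure \<Rightarrow> (real \<Rightarrow> real) \<Rightarrow> real \<Rightarrow> real" where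
  "sym_mean \<mu> u r = 1 / measure \<mu> {-r..r} * (LINT t:{-r..r}|\<mu>. u t)"

definition EUc ::
    "real measure \<Rightarrow> (real \<Rightarrow> 'x::topological_space \<Rightarrow> 'y::real_normed_vector) set" where
  "EUc \<mu> = {h.
     continuous_on UNIV (\<lambda>(t, x). h t x) \<and>
     (\<forall>x. bounded (range (\<lambda>t. h t x))) \<and>
     (\<forall>K. compact K \<longrightarrow>
        uniform_limit K (\<lambda>r x. sym_mean \<mu> (\<lambda>t. norm (h t x)) r) (\<lambda>_. 0) at_top)}"

section \<open>The space of continuous functions with uniform convergence on compact sets\<close>

typedef (overloaded) 'a Ck = "{u :: real \<Rightarrow> 'a::topological_space. continuous_on UNIV u}"
  by (rule exI[of _ "\<lambda>_. undefined"]) simp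

instantiation Ck :: (metric_space) topological_space
begin

definition open_Ck :: "'a Ck set \<Rightarrow> bool" where
  "open_Ck U \<longleftrightarrow> (\<forall>u\<in>U. \<exists>K e. compact K \<and> 0 < e \<and>
     {v. \<forall>t\<in>K. dist (Rep_Ck v t) (Rep_Ck u t) < e} \<subseteq> U)"

instance
proof
  show "open (UNIV :: 'a Ck set)"
    unfolding open_Ck_def by (auto intro!: exI[of _ "{}"] exI[of _ "1::real"])
next
  fix S T :: "'a Ck set"
  assume S: "open S" and T: "open T"
  show "open (S \<inter> T)"
    unfolding open_Ck_def
  proof
    fix u assume "u \<in> S \<inter> T"
    with S T obtain K e L d where
      "compact K" "0 < e" "{v. \<forall>t\<in>K. dist (Rep_Ck v t) (Rep_Ck u t) < e} \<subseteq> S"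
      "compact L" "0 < d" "{v. \<forall>t\<in>L. dist (Rep_Ck v t) (Rep_Ck u t) < d} \<subseteq> T"
      unfolding open_Ck_def by (meson IntD1 IntD2)
    then show "\<exists>K e. compact K \<and> 0 < e \<and>
        {v. \<forall>t\<in>K. dist (Rep_Ck v t) (Rep_Ck u t) < e} \<subseteq> S \<inter> T"
      by (intro exI[of _ "K \<union> L"] exI[of _ "min e d"]) (auto intro: compact_Un)
  qed
next
  fix \<S> :: "'a Ck set set"
  assume "\<forall>S\<in>\<S>. open S"
  then show "open (\<Union>\<S>)"
    unfolding open_Ck_def by (meson Union_iff Union_upper subset_trans)
qed

end

section \<open>Narrow topology on the Borel probability measures\<close>

definition borel_prob_measures :: "'e::topological_space measure set" where
  "borel_prob_measures = {N. prob_space N \<and> sets N = sets borel}"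

text \<open>The coarsest topology making \<open>N \<mapsto> \<integral> \<phi> dN\<close> continuous for all bounded continuous \<open>\<phi>\<close>.\<close>

definition narrow_topology :: "'e::topological_space measure topology" where
  "narrow_topology = topology_generated_by
     {{N \<in> borel_prob_measures. (\<integral>u. \<phi> u \<partial>N) \<in> U} |(\<phi> :: 'e \<Rightarrow> real) U.
        continuous_on UNIV \<phi> \<and> bounded (range \<phi>) \<and> open U}"

lemma topspace_narrow_topology: "topspace narrow_topology = borel_prob_measures"
proof -
  have "\<exists>(\<phi> :: 'a \<Rightarrow> real) U. borel_prob_measures = {N \<in> borel_prob_measures. (\<integral>u. \<phi> u \<partial>N) \<in> U} \<and>
      continuous_on UNIV \<phi> \<and> bounded (range \<phi>) \<and> open U"
    by (rule exI[of _ "\<lambda>_. 0"], rule exI[of _ UNIV]) auto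
  then show ?thesis
    unfolding narrow_topology_def topology_generated_by_topspace by blast
qed

section \<open>Processes\<close>

definition continuous_process :: "'w measure \<Rightarrow> (real \<Rightarrow> 'w \<Rightarrow> 'x::topological_space) \<Rightarrow> bool" where
  "continuous_process M X \<longleftrightarrow>
     (\<forall>t. X t \<in> borel_measurable M) \<and> (\<forall>\<omega>\<in>space M. continuous_on UNIV (\<lambda>t. X t \<omega>))"

definition shifted_path :: "(real \<Rightarrow> 'w \<Rightarrow> 'x::topological_space) \<Rightarrow> real \<Rightarrow> 'w \<Rightarrow> 'x Ck" where
  "shifted_path X t \<omega> = Abs_Ck (\<lambda>s. X (t + s) \<omega>)"

definition path_law ::
    "'w measure \<Rightarrow> (real \<Rightarrow> 'w \<Rightarrow> 'x::metric_space) \<Rightarrow> real \<Rightarrow> 'x Ck measure" where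
  "path_law M X t = distr M borel (shifted_path X t)"

definition almost_periodic_in_distr ::
    "'w measure \<Rightarrow> (real \<Rightarrow> 'w \<Rightarrow> 'x::metric_space) \<Rightarrow> bool" where
  "almost_periodic_in_distr M X \<longleftrightarrow> almost_periodic narrow_topology (path_law M X)"

definition almost_automorphic_in_distr ::
    "'w measure \<Rightarrow> (real \<Rightarrow> 'w \<Rightarrow> 'x::metric_space) \<Rightarrow> bool" where
  "almost_automorphic_in_distr M X \<longleftrightarrow> almost_automorphic narrow_topology (path_law M X)"

definition uniformly_integrable :: "'w measure \<Rightarrow> ('i \<Rightarrow> 'w \<Rightarrow> real) \<Rightarrow> bool" where
  "uniformly_integrable M F \<longleftrightarrow>
     (\<forall>i. integrable M (F i)) \<and>
     (\<forall>\<epsilon>>0. \<exists>c. \<forall>i. (\<integral>\<omega>. \<bar>F i \<omega>\<bar> * indicator {\<omega>. \<bar>F i \<omega>\<bar> > c} \<omega> \<partial>M) \<le> \<epsilon>)"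

definition almost_automorphic_in_p_distr ::
    "real \<Rightarrow> 'w measure \<Rightarrow> (real \<Rightarrow> 'w \<Rightarrow> 'x::real_normed_vector) \<Rightarrow> bool" where
  "almost_automorphic_in_p_distr p M X \<longleftrightarrow>
     almost_automorphic_in_distr M X \<and>
     (p > 0 \<longrightarrow> uniformly_integrable M (\<lambda>t \<omega>. norm (X t \<omega>) powr p))"

definition Lp :: "real \<Rightarrow> 'w measure \<Rightarrow> ('w \<Rightarrow> 'x::real_normed_vector) set" where
  "Lp p M = {u \<in> borel_measurable M. integrable M (\<lambda>\<omega>. norm (u \<omega>) powr p)}"

definition Lp_norm :: "real \<Rightarrow> 'w measure \<Rightarrow> ('w \<Rightarrow> 'x::real_normed_vector) \<Rightarrow> real" where
  "Lp_norm p M u = (\<integral>\<omega>. norm (u \<omega>) powr p \<partial>M) powr (1 / p)"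

text \<open>For \<open>0 < p < 1\<close> the functional \<open>Lp_norm p M\<close> is only a quasi-norm, but it defines the same
  convergence and the same bounded sets as the usual distance \<open>E \<parallel>u - v\<parallel>\<^sup>p\<close>. For \<open>p = 0\<close> the
  measurability condition only expresses that the mean is meaningful.\<close>

definition ergodic_Lp ::
    "real \<Rightarrow> 'w measure \<Rightarrow> real measure \<Rightarrow> (real \<Rightarrow> 'w \<Rightarrow> 'x::real_normed_vector) set" where
  "ergodic_Lp p M \<mu> = {Z.
     if p > 0 then
       (\<forall>t. Z t \<in> Lp p M) \<and>
       (\<forall>t. ((\<lambda>s. Lp_norm p M (\<lambda>\<omega>. Z s \<omega> - Z t \<omega>)) \<longlongrightarrow> 0) (at t)) \<and>
       (\<exists>C. \<forall>t. Lp_norm p M (Z t) \<le> C) \<and>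
       (sym_mean \<mu> (\<lambda>t. Lp_norm p M (Z t)) \<longlongrightarrow> 0) at_top
     else
       (\<forall>t. Z t \<in> borel_measurable M) \<and>
       (\<lambda>t. \<integral>\<omega>. min (norm (Z t \<omega>)) 1 \<partial>M) \<in> borel_measurable \<mu> \<and>
       (sym_mean \<mu> (\<lambda>t. \<integral>\<omega>. min (norm (Z t \<omega>)) 1 \<partial>M) \<longlongrightarrow> 0) at_top}"

definition pseudo_almost_automorphic_in_p_distr ::
    "real \<Rightarrow> 'w measure \<Rightarrow> real measure \<Rightarrow> (real \<Rightarrow> 'w \<Rightarrow> 'x::real_normed_vector) \<Rightarrow> bool" where
  "pseudo_almost_automorphic_in_p_distr p M \<mu> X \<longleftrightarrow>
     (\<exists>Y Z. (\<forall>t. \<forall>\<omega>\<in>space M. X t \<omega> = Y t \<omega> + Z t \<omega>) \<and>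
        continuous_process M Y \<and> almost_automorphic_in_p_distr p M Y \<and>
        Z \<in> ergodic_Lp p M \<mu>)"

end

theory Submission
  imports Defs
begin

text \<open>Everything rests on one principle: if laws \<open>N n\<close> converge narrowly to \<open>L\<close> and maps \<open>\<Phi> n\<close> converge
  continuously to \<open>\<Psi>\<close>, then the image laws converge to the image of \<open>L\<close>. It is applied to the
  superposition maps on path space given by translates of \<open>f\<close>. For \<open>f \<in> AAcUc\<close> a Baire category
  argument shows that translates converge continuously in both variables, which gives the almost
  automorphic case. In the almost periodic case Bochner's criterion reduces the claim to
  sequences; the only deep ingredient is that the law space of paths carries some complete
  distance, for which the bounded Lipschitz distance is used, its completeness being
  Prokhorov's theorem. In the pseudo almost automorphic case, with \<open>X = Y + Z\<close>, the process splits as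
  \<open>g(Y) + [f(X) - f(Y)] + h(Y)\<close>; tightness of the laws of \<open>Y\<close> confines the last two terms to a
  compact set, where \<open>f\<close> is equicontinuous and \<open>h\<close> is controlled by finitely many of its sections.\<close>

section \<open>The space of continuous functions is Polish\<close>

text \<open>Two gaps shape the proof. First, membership in \<open>AAcUc\<close> controls translates
  of f at one fixed time after another, while image laws on path space need convergence along times
  that move with n. Absorbing the movement into the translation sequence gives a limit along a
  subsequence, but nothing in the definition says that it is the old limit. Identifying the two is
  where category enters, and it works because every limit function is continuous in time. The
  backward limits cost a second round, since a limit function is not known to lie in
  \<open>AAcUc\<close> again. Second, almost periodicity in distribution asserts the existence of a
  complete distance on laws. The distance supplied for X is arbitrary and can only be used
  abstractly, while one for the laws of f(X) has to be produced. Limits of laws are handled through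
  integrals of Lipschitz minorants, with no almost sure representation.\<close>

lemma continuous_on_Rep_Ck [continuous_intros]: "continuous_on S (Rep_Ck u)"
  using Rep_Ck[of u] continuous_on_subset by blast

lemma Rep_Abs_Ck: "continuous_on UNIV u \<Longrightarrow> Rep_Ck (Abs_Ck u) = u"
  by (simp add: Abs_Ck_inverse)

instantiation Ck :: (metric_space) metric_space
begin

text \<open>The cap \<open>1 / (1 + \<bar>t\<bar>)\<close> blinds the distance to what happens at
  time t on any coarser scale, so a ball of radius e constrains only a bounded range of times. One
  supremum thus metrizes uniform convergence on compact sets, without a series over growing
  intervals; the triangle inequality survives since the cap depends on t alone.\<close>

definition dist_Ck :: "'a Ck \<Rightarrow> 'a Ck \<Rightarrow> real" where
  "dist_Ck u v = (SUP t. min (dist (Rep_Ck u t) (Rep_Ck v t)) (1 / (1 + \<bar>t\<bar>)))"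

definition uniformity_Ck :: "('a Ck \<times> 'a Ck) filter" where
  "uniformity_Ck = (INF e\<in>{0<..}. principal {(u, v). dist u v < e})"

lemma min_dist_le_dist_Ck:
  fixes u v :: "'a Ck"
  shows "min (dist (Rep_Ck u t) (Rep_Ck v t)) (1 / (1 + \<bar>t\<bar>)) \<le> dist u v"
  unfolding dist_Ck_def
proof (rule cSUP_upper)
  show "bdd_above (range (\<lambda>t. min (dist (Rep_Ck u t) (Rep_Ck v t)) (1 / (1 + \<bar>t\<bar>))))"
    by (rule bdd_aboveI[of _ 1]) (auto simp: min_le_iff_disj)
qed simp

lemma dist_Ck_leI:
  fixes u v :: "'a Ck"
  assumes "\<And>t. min (dist (Rep_Ck u t) (Rep_Ck v t)) (1 / (1 + \<bar>t\<bar>)) \<le> c"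
  shows "dist u v \<le> c"
  unfolding dist_Ck_def by (rule cSUP_least) (use assms in auto)

lemma dist_Ck_less_imp:
  fixes u v :: "'a Ck"
  assumes "dist u v < e" "e \<le> 1 / (1 + \<bar>t\<bar>)"
  shows "dist (Rep_Ck u t) (Rep_Ck v t) < e"
  using min_dist_le_dist_Ck[of u t v] assms by linarith

lemma dist_Ck_le_of_cball:
  fixes u v :: "'a Ck"
  assumes "0 < e" "\<And>t. \<bar>t\<bar> \<le> 1 / e \<Longrightarrow> dist (Rep_Ck u t) (Rep_Ck v t) \<le> e"
  shows "dist u v \<le> e"
proof (rule dist_Ck_leI)
  fix t :: real
  show "min (dist (Rep_Ck u t) (Rep_Ck v t)) (1 / (1 + \<bar>t\<bar>)) \<le> e"
  proof (cases "\<bar>t\<bar> \<le> 1 / e")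
    case True
    then show ?thesis using assms(2) by (simp add: min_le_iff_disj)
  next
    case False
    then have "1 / (1 + \<bar>t\<bar>) \<le> e"
      using assms(1) by (simp add: field_simps)
    then show ?thesis by simp
  qed
qed

instance
proof
  fix u v :: "'a Ck"
  show "dist u v = 0 \<longleftrightarrow> u = v"
  proof
    assume 0: "dist u v = 0"
    have "Rep_Ck u t = Rep_Ck v t" for t
    proof -
      have "min (dist (Rep_Ck u t) (Rep_Ck v t)) (1 / (1 + \<bar>t\<bar>)) \<le> 0"
        using min_dist_le_dist_Ck[of u t v] 0 by simp
      moreover have "0 < 1 / (1 + \<bar>t\<bar>)" by simp
      ultimately have "dist (Rep_Ck u t) (Rep_Ck v t) \<le> 0"
        by linarith
      then show ?thesis by simp
    qed
    then show "u = v" by (metis Rep_Ck_inject ext)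
  next
    assume "u = v"
    then show "dist u v = 0" by (simp add: dist_Ck_def min_def)
  qed
next
  fix u v w :: "'a Ck"
  show "dist u v \<le> dist u w + dist v w"
  proof (rule dist_Ck_leI)
    fix t :: real
    have "0 < 1 / (1 + \<bar>t\<bar>)" by simp
    then show "min (dist (Rep_Ck u t) (Rep_Ck v t)) (1 / (1 + \<bar>t\<bar>)) \<le> dist u w + dist v w"
      using min_dist_le_dist_Ck[of u t w] min_dist_le_dist_Ck[of v t w]
        dist_triangle2[of "Rep_Ck u t" "Rep_Ck v t" "Rep_Ck w t"]
        zero_le_dist[of "Rep_Ck u t" "Rep_Ck w t"] zero_le_dist[of "Rep_Ck v t" "Rep_Ck w t"]
      by linarith
  qed
next
  show "uniformity = (INF e\<in>{0<..}. principal {(u :: 'a Ck, v). dist u v < e})"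
    by (rule uniformity_Ck_def)
next
  fix U :: "'a Ck set"
  have ev: "(\<forall>\<^sub>F (x', y) in uniformity. x' = u \<longrightarrow> y \<in> U) \<longleftrightarrow> (\<exists>e>0. \<forall>v. dist u v < e \<longrightarrow> v \<in> U)" for u
    unfolding uniformity_Ck_def
    by (subst eventually_INF_base)
       (auto simp: eventually_principal subset_eq intro: bexI[of _ "min _ _"])
  have "(\<exists>K e. compact K \<and> 0 < e \<and> {v. \<forall>t\<in>K. dist (Rep_Ck v t) (Rep_Ck u t) < e} \<subseteq> U) \<longleftrightarrow>
      (\<exists>e>0. \<forall>v. dist u v < e \<longrightarrow> v \<in> U)" for u
  proof safe
    fix K :: "real set" and e :: real
    assume K: "compact K" and e: "0 < e"
      and sub: "{v. \<forall>t\<in>K. dist (Rep_Ck v t) (Rep_Ck u t) < e} \<subseteq> U"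
    obtain R where R: "R > 0" "\<And>t. t \<in> K \<Longrightarrow> \<bar>t\<bar> \<le> R"
      using compact_imp_bounded[OF K] unfolding bounded_pos by auto
    have "v \<in> U" if d: "dist u v < min e (1 / (1 + R))" for v
    proof -
      have "dist (Rep_Ck v t) (Rep_Ck u t) < e" if "t \<in> K" for t
      proof -
        have "1 / (1 + R) \<le> 1 / (1 + \<bar>t\<bar>)"
          using R(2)[OF that] R(1) by (simp add: frac_le)
        then have "dist (Rep_Ck u t) (Rep_Ck v t) < min e (1 / (1 + R))"
          using d by (intro dist_Ck_less_imp) auto
        then show ?thesis by (simp add: dist_commute)
      qed
      then show ?thesis using sub by auto
    qed
    then show "\<exists>e>0. \<forall>v. dist u v < e \<longrightarrow> v \<in> U"
      using e R(1) by (intro exI[of _ "min e (1 / (1 + R))"]) auto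
  next
    fix e :: real
    assume e: "0 < e" and U: "\<forall>v. dist u v < e \<longrightarrow> v \<in> U"
    \<comment> \<open>\<open>dist_Ck_le_of_cball\<close> at scale e / 2 looks at times up to 2 / e
      and leaves a strict bound below e.\<close>
    have "v \<in> U" if v: "\<forall>t\<in>{-(2/e)..2/e}. dist (Rep_Ck v t) (Rep_Ck u t) < e / 2" for v
    proof -
      have "dist u v \<le> e / 2"
        using e v by (intro dist_Ck_le_of_cball) (auto simp: dist_commute abs_le_iff intro!: less_imp_le)
      then show ?thesis using U e by auto
    qed
    then show "\<exists>K e. compact K \<and> 0 < e \<and> {v. \<forall>t\<in>K. dist (Rep_Ck v t) (Rep_Ck u t) < e} \<subseteq> U"
      using e by (intro exI[of _ "{-(2/e)..2/e}"] exI[of _ "e/2"]) auto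
  qed
  then show "open U \<longleftrightarrow> (\<forall>u\<in>U. \<forall>\<^sub>F (x', y) in uniformity. x' = u \<longrightarrow> y \<in> U)"
    unfolding open_Ck_def ev by simp
qed

end

lemma tendsto_Ck_iff:
  fixes u :: "'i \<Rightarrow> 'a::metric_space Ck"
  shows "(u \<longlongrightarrow> l) F \<longleftrightarrow>
    (\<forall>K. compact K \<longrightarrow> uniform_limit K (\<lambda>i. Rep_Ck (u i)) (Rep_Ck l) F)"
proof (intro iffI allI impI)
  fix K :: "real set"
  assume lim: "(u \<longlongrightarrow> l) F" and K: "compact K"
  obtain R where R: "R > 0" "\<And>t. t \<in> K \<Longrightarrow> \<bar>t\<bar> \<le> R"
    using compact_imp_bounded[OF K] unfolding bounded_pos by auto
  show "uniform_limit K (\<lambda>i. Rep_Ck (u i)) (Rep_Ck l) F"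
  proof (rule uniform_limitI)
    fix e :: real assume "0 < e"
    then have "\<forall>\<^sub>F i in F. dist (u i) l < min e (1 / (1 + R))"
      using R(1) by (intro tendstoD[OF lim]) auto
    then show "\<forall>\<^sub>F i in F. \<forall>t\<in>K. dist (Rep_Ck (u i) t) (Rep_Ck l t) < e"
    proof (rule eventually_mono, intro ballI)
      fix i t assume d: "dist (u i) l < min e (1 / (1 + R))" and "t \<in> K"
      have "1 / (1 + R) \<le> 1 / (1 + \<bar>t\<bar>)"
        using R(2)[OF \<open>t \<in> K\<close>] R(1) by (simp add: frac_le)
      then have "dist (Rep_Ck (u i) t) (Rep_Ck l t) < min e (1 / (1 + R))"
        using d by (intro dist_Ck_less_imp) auto
      then show "dist (Rep_Ck (u i) t) (Rep_Ck l t) < e" by simp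
    qed
  qed
next
  assume unif: "\<forall>K. compact K \<longrightarrow> uniform_limit K (\<lambda>i. Rep_Ck (u i)) (Rep_Ck l) F"
  show "(u \<longlongrightarrow> l) F"
  proof (rule tendstoI)
    fix e :: real assume e: "0 < e"
    have "\<forall>\<^sub>F i in F. \<forall>t\<in>{-(2/e)..2/e}. dist (Rep_Ck (u i) t) (Rep_Ck l t) < e / 2"
      using e by (intro uniform_limitD unif[rule_format]) auto
    then show "\<forall>\<^sub>F i in F. dist (u i) l < e"
    proof (rule eventually_mono)
      fix i assume "\<forall>t\<in>{-(2/e)..2/e}. dist (Rep_Ck (u i) t) (Rep_Ck l t) < e / 2"
      then have "dist (u i) l \<le> e / 2"
        using e by (intro dist_Ck_le_of_cball) (auto simp: abs_le_iff intro!: less_imp_le)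
      then show "dist (u i) l < e" using e by simp
    qed
  qed
qed

text \<open>Path and time may move together: the times and their limit form a compact set, on which
  the paths converge uniformly.\<close>

lemma tendsto_Rep_Ck:
  fixes u :: "nat \<Rightarrow> 'a::metric_space Ck"
  assumes "u \<longlonglongrightarrow> l" "r \<longlonglongrightarrow> t"
  shows "(\<lambda>n. Rep_Ck (u n) (r n)) \<longlonglongrightarrow> Rep_Ck l t"
proof -
  have K: "compact (insert t (range r))"
    using compact_sequence_with_limit[OF assms(2)] .
  have 1: "uniform_limit (insert t (range r)) (\<lambda>i. Rep_Ck (u i)) (Rep_Ck l) sequentially"
    using assms(1) K unfolding tendsto_Ck_iff by blast
  have 2: "(\<lambda>n. Rep_Ck l (r n)) \<longlonglongrightarrow> Rep_Ck l t"
    using assms(2) continuous_on_Rep_Ck[of UNIV l]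
    by (auto intro: continuous_on_tendsto_compose[of UNIV])
  show ?thesis
  proof (rule tendstoI)
    fix e :: real assume "0 < e"
    then have "e / 2 > 0" by simp
    from uniform_limitD[OF 1 this] tendstoD[OF 2 this]
    show "\<forall>\<^sub>F n in sequentially. dist (Rep_Ck (u n) (r n)) (Rep_Ck l t) < e"
    proof eventually_elim
      case (elim n)
      then have "dist (Rep_Ck (u n) (r n)) (Rep_Ck l (r n)) < e / 2" by simp
      with elim(2) show ?case by (metis dist_commute dist_triangle_half_r)
    qed
  qed
qed

lemma continuous_on_eval_Ck: "continuous_on S (\<lambda>u :: 'a::metric_space Ck. Rep_Ck u t)"
  by (rule continuous_on_sequentiallyI) (auto intro: tendsto_Rep_Ck)

instance Ck :: (complete_space) complete_space
proof
  fix u :: "nat \<Rightarrow> 'a Ck"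
  assume C: "Cauchy u"
  have unif: "uniformly_Cauchy_on K (\<lambda>n. Rep_Ck (u n))" if K: "compact K" for K
  proof (rule uniformly_Cauchy_onI)
    obtain R where R: "R > 0" "\<And>t. t \<in> K \<Longrightarrow> \<bar>t\<bar> \<le> R"
      using compact_imp_bounded[OF K] unfolding bounded_pos by auto
    fix e :: real assume "e > 0"
    then have "0 < min e (1 / (1 + R))" using R(1) by simp
    then obtain N where N: "\<And>m n. m \<ge> N \<Longrightarrow> n \<ge> N \<Longrightarrow> dist (u m) (u n) < min e (1 / (1 + R))"
      using C unfolding Cauchy_def by blast
    have "dist (Rep_Ck (u m) t) (Rep_Ck (u n) t) < e" if "t \<in> K" "m \<ge> N" "n \<ge> N" for t m n
    proof -
      have "1 / (1 + R) \<le> 1 / (1 + \<bar>t\<bar>)"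
        using R(2)[OF \<open>t \<in> K\<close>] R(1) by (simp add: frac_le)
      then have "dist (Rep_Ck (u m) t) (Rep_Ck (u n) t) < min e (1 / (1 + R))"
        using N[OF that(2,3)] by (intro dist_Ck_less_imp) auto
      then show ?thesis by simp
    qed
    then show "\<exists>M. \<forall>x\<in>K. \<forall>m\<ge>M. \<forall>n\<ge>M. dist (Rep_Ck (u m) x) (Rep_Ck (u n) x) < e"
      by blast
  qed
  define l where "l t = lim (\<lambda>n. Rep_Ck (u n) t)" for t
  have lim: "uniform_limit K (\<lambda>n. Rep_Ck (u n)) l sequentially" if K: "compact K" for K
    using Cauchy_uniformly_convergent[OF unif[OF K]] unfolding uniformly_convergent_uniform_limit_iff l_def .
  \<comment> \<open>The uniform limit is continuous on compact intervals; their interiors form an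
    open cover of the line, over which continuity can be glued.\<close>
  have "continuous_on {-R<..<R} l" for R :: real
  proof -
    have "continuous_on {-R..R} l"
      by (rule uniform_limit_theorem[OF _ lim]) (auto intro: continuous_on_Rep_Ck always_eventually)
    then show ?thesis by (rule continuous_on_subset) auto
  qed
  then have "continuous_on (\<Union>R. {-R<..<R::real}) l"
    by (intro continuous_on_open_UN) auto
  moreover have "(\<Union>R. {-R<..<R::real}) = UNIV"
  proof safe
    fix x :: real
    have "- (\<bar>x\<bar> + 1) < x" "x < \<bar>x\<bar> + 1" by linarith+
    then show "x \<in> (\<Union>R. {-R<..<R})" by (intro UN_I[of "\<bar>x\<bar> + 1"]) auto
  qed simp
  ultimately have "continuous_on UNIV l" by simp
  then have "u \<longlonglongrightarrow> Abs_Ck l"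
    using lim by (simp add: tendsto_Ck_iff Rep_Abs_Ck)
  then show "convergent u" by (auto simp: convergent_def)
qed

text \<open>These are the subbasic sets of the compact-open topology. The compact image of K has a
  uniform neighbourhood inside U, which leaves room for a uniform perturbation of the path.\<close>

lemma open_Ck_into:
  fixes U :: "'a::metric_space set"
  assumes "open U" "compact K"
  shows "open {u. Rep_Ck u ` K \<subseteq> U}"
proof (cases "U = UNIV")
  case False
  show ?thesis
    unfolding open_Ck_def
  proof
    fix u assume "u \<in> {u. Rep_Ck u ` K \<subseteq> U}"
    then have u: "Rep_Ck u ` K \<subseteq> U" by simp
    have "compact (Rep_Ck u ` K)" by (intro compact_continuous_image continuous_on_Rep_Ck assms)
    then obtain e where e: "e > 0" "(\<Union>x\<in>Rep_Ck u ` K. ball x e) \<subseteq> U"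
      using compact_subset_open_imp_ball_epsilon_subset[OF _ assms(1) u] by blast
    then show "\<exists>K' e. compact K' \<and> 0 < e \<and>
        {v. \<forall>t\<in>K'. dist (Rep_Ck v t) (Rep_Ck u t) < e} \<subseteq> {u. Rep_Ck u ` K \<subseteq> U}"
      using assms(2) by (intro exI[of _ K] exI[of _ e]) (force simp: dist_commute)
  qed
qed simp

text \<open>Countable subbasis: paths sending an interval with rational endpoints into a member of a
  countable basis. Around a given u, finitely many such intervals cover K; over each of them u and v
  stay in one ball of radius e / 2, hence they are within e on K.\<close>

instance Ck :: ("{metric_space, second_countable_topology}") second_countable_topology
proof
  obtain B :: "'a set set" where B: "countable B" "topological_basis B"
    using ex_countable_basis by blast
  define S where "S = (\<lambda>(U, a, b). {u :: 'a Ck. Rep_Ck u ` {a..b} \<subseteq> U})"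
  define C where "C = S ` (B \<times> \<rat> \<times> \<rat>)"
  have "countable C"
    unfolding C_def using B(1) countable_rat by auto
  have openC: "open X" if "X \<in> C" for X
    using that topological_basis_open[OF B(2)] unfolding C_def S_def by (auto intro!: open_Ck_into)
  have "open X \<longleftrightarrow> generate_topology C X" for X
  proof
    assume X: "open X"
    have "\<exists>V. generate_topology C V \<and> u \<in> V \<and> V \<subseteq> X" if "u \<in> X" for u
    proof -
      obtain K e where K: "compact K" and e: "0 < e"
        and sub: "{v. \<forall>t\<in>K. dist (Rep_Ck v t) (Rep_Ck u t) < e} \<subseteq> X"
        using X \<open>u \<in> X\<close> unfolding open_Ck_def by meson
      have "\<exists>U a b. U \<in> B \<and> a \<in> \<rat> \<and> b \<in> \<rat> \<and> t \<in> {a<..<b} \<and>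
          Rep_Ck u ` {a..b} \<subseteq> U \<and> U \<subseteq> ball (Rep_Ck u t) (e/2)" for t
      proof -
        obtain U where U: "U \<in> B" "Rep_Ck u t \<in> U" "U \<subseteq> ball (Rep_Ck u t) (e/2)"
          using topological_basisE[OF B(2) open_ball, of "Rep_Ck u t" "Rep_Ck u t" "e/2"] e by auto
        have "open (Rep_Ck u -` U)"
          by (rule open_vimage[OF topological_basis_open[OF B(2) U(1)] continuous_on_Rep_Ck])
        then obtain d where d: "d > 0" "cball t d \<subseteq> Rep_Ck u -` U"
          using U(2) open_contains_cball by (metis vimageI)
        obtain a where a: "a \<in> \<rat>" "t - d < a" "a < t"
          using Rats_dense_in_real[of "t - d" t] d(1) by auto
        obtain b where b: "b \<in> \<rat>" "t < b" "b < t + d"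
          using Rats_dense_in_real[of t "t + d"] d(1) by auto
        have "{a..b} \<subseteq> cball t d"
          using a b by (auto simp: dist_real_def)
        then show ?thesis
          using a b U d(2) by (intro exI[of _ U] exI[of _ a] exI[of _ b]) auto
      qed
      then obtain U a b where Uab: "\<And>t. U t \<in> B \<and> a t \<in> \<rat> \<and> b t \<in> \<rat> \<and> t \<in> {a t<..<b t} \<and>
          Rep_Ck u ` {a t..b t} \<subseteq> U t \<and> U t \<subseteq> ball (Rep_Ck u t) (e/2)" by metis
      have "K \<subseteq> (\<Union>t\<in>K. {a t<..<b t})" using Uab by blast
      then obtain D where D: "D \<subseteq> K" "finite D" "K \<subseteq> (\<Union>t\<in>D. {a t<..<b t})"
        using compactE_image[OF K, of K "\<lambda>t. {a t<..<b t}"] by auto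
      define V where "V = (\<Inter>t\<in>D. S (U t, a t, b t))"
      have "generate_topology C V"
        using D(2) unfolding V_def
      proof (induction D)
        case empty
        then show ?case by (simp add: generate_topology.UNIV)
      next
        case (insert t D)
        have "S (U t, a t, b t) \<in> C" using Uab[of t] unfolding C_def by auto
        then show ?case using insert.IH by (simp add: generate_topology.Basis generate_topology.Int)
      qed
      moreover have "u \<in> V" using Uab unfolding V_def S_def by auto
      moreover have "V \<subseteq> X"
      proof
        fix v assume v: "v \<in> V"
        have "dist (Rep_Ck v s) (Rep_Ck u s) < e" if "s \<in> K" for s
        proof -
          obtain t where t: "t \<in> D" "s \<in> {a t<..<b t}" using D(3) \<open>s \<in> K\<close> by blast
          then have "s \<in> {a t..b t}" by auto
          moreover have "Rep_Ck v ` {a t..b t} \<subseteq> U t" using v t(1) unfolding V_def S_def by auto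
          ultimately have "Rep_Ck v s \<in> ball (Rep_Ck u t) (e/2)" "Rep_Ck u s \<in> ball (Rep_Ck u t) (e/2)"
            using Uab[of t] by blast+
          then show ?thesis by (auto intro: dist_triangle_half_r)
        qed
        then show "v \<in> X" using sub by auto
      qed
      ultimately show ?thesis by blast
    qed
    then have "X = \<Union>{V. generate_topology C V \<and> V \<subseteq> X}" by blast
    moreover have "generate_topology C (\<Union>{V. generate_topology C V \<and> V \<subseteq> X})"
      by (rule generate_topology.UN) auto
    ultimately show "generate_topology C X" by simp
  next
    assume "generate_topology C X"
    then show "open X" by induction (auto intro: openC)
  qed
  then show "\<exists>B :: 'a Ck set set. countable B \<and> open = generate_topology B"
    using \<open>countable C\<close> by (intro exI[of _ C]) auto
qed

text \<open>Continuity of paths reduces the supremum to countably many times, so that the distance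
  to a fixed path is measurable as soon as the evaluations are.\<close>

lemma dist_Ck_eq_Sup_rat:
  fixes u v :: "'a::metric_space Ck"
  shows "dist u v = (SUP t\<in>\<rat>. min (dist (Rep_Ck u t) (Rep_Ck v t)) (1 / (1 + \<bar>t\<bar>)))"
proof (rule antisym)
  let ?m = "\<lambda>t. min (dist (Rep_Ck u t) (Rep_Ck v t)) (1 / (1 + \<bar>t\<bar>))"
  have bdd: "bdd_above (?m ` \<rat>)"
    by (rule bdd_aboveI[of _ 1]) (auto simp: min_le_iff_disj)
  show "dist u v \<le> (SUP t\<in>\<rat>. ?m t)"
  proof (rule dist_Ck_leI)
    fix t :: real
    have "t \<in> closure \<rat>" using Rats_closure_real by simp
    then obtain q where q: "\<And>n. q n \<in> \<rat>" "q \<longlonglongrightarrow> t" unfolding closure_sequential by blast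
    have "(\<lambda>n. Rep_Ck u (q n)) \<longlonglongrightarrow> Rep_Ck u t" "(\<lambda>n. Rep_Ck v (q n)) \<longlonglongrightarrow> Rep_Ck v t"
      using q(2) by (auto intro: tendsto_Rep_Ck)
    then have "(\<lambda>n. ?m (q n)) \<longlonglongrightarrow> ?m t"
      using q(2) by (intro tendsto_intros) auto
    moreover have "?m (q n) \<le> (SUP t\<in>\<rat>. ?m t)" for n
      using q(1) bdd by (intro cSUP_upper)
    ultimately show "?m t \<le> (SUP t\<in>\<rat>. ?m t)"
      by (intro LIMSEQ_le_const2) auto
  qed
  show "(SUP t\<in>\<rat>. ?m t) \<le> dist u v"
    by (rule cSUP_least) (auto intro: min_dist_le_dist_Ck)
qed

text \<open>The evaluations generate the Borel sets of path space: a ball is determined by rational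
  times, and by separability an open set is a countable union of balls.\<close>

lemma borel_measurable_Ck_iff:
  fixes V :: "'w \<Rightarrow> 'a::{metric_space, second_countable_topology} Ck"
  shows "V \<in> borel_measurable M \<longleftrightarrow> (\<forall>t. (\<lambda>\<omega>. Rep_Ck (V \<omega>) t) \<in> borel_measurable M)"
proof (intro iffI allI)
  fix t assume "V \<in> borel_measurable M"
  then show "(\<lambda>\<omega>. Rep_Ck (V \<omega>) t) \<in> borel_measurable M"
    using measurable_compose borel_measurable_continuous_onI[OF continuous_on_eval_Ck[of UNIV t]] by blast
next
  assume meas: "\<forall>t. (\<lambda>\<omega>. Rep_Ck (V \<omega>) t) \<in> borel_measurable M"
  have dist_meas: "(\<lambda>\<omega>. dist (V \<omega>) u) \<in> borel_measurable M" for u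
    unfolding dist_Ck_eq_Sup_rat
  proof (rule borel_measurable_cSUP)
    show "countable (\<rat> :: real set)" by (rule countable_rat)
    show "bdd_above ((\<lambda>t. min (dist (Rep_Ck (V \<omega>) t) (Rep_Ck u t)) (1 / (1 + \<bar>t\<bar>))) ` \<rat>)" for \<omega>
      by (rule bdd_aboveI[of _ 1]) (auto simp: min_le_iff_disj)
    show "(\<lambda>\<omega>. min (dist (Rep_Ck (V \<omega>) t) (Rep_Ck u t)) (1 / (1 + \<bar>t\<bar>))) \<in> borel_measurable M" for t
      using meas by (intro borel_measurable_min borel_measurable_dist) auto
  qed
  obtain D :: "'a Ck set" where D: "countable D" "\<And>X. open X \<Longrightarrow> X \<noteq> {} \<Longrightarrow> \<exists>d\<in>D. d \<in> X"
    using countable_dense_setE by (metis)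
  show "V \<in> borel_measurable M"
  proof (rule borel_measurableI)
    fix X :: "'a Ck set" assume X: "open X"
    define I where "I = {(d, q). d \<in> D \<and> q \<in> \<rat> \<and> ball d q \<subseteq> X}"
    have "countable I"
      by (rule countable_subset[of _ "D \<times> \<rat>"]) (auto simp: I_def intro!: countable_SIGMA D(1) countable_rat)
    have "X = (\<Union>(d, q)\<in>I. ball d q)"
    proof (intro equalityI subsetI)
      fix x assume "x \<in> X"
      then obtain e where e: "e > 0" "ball x e \<subseteq> X" using X open_contains_ball by blast
      obtain d where d: "d \<in> D" "d \<in> ball x (e/2)" using D(2)[of "ball x (e/2)"] e(1) by auto
      obtain q where q: "q \<in> \<rat>" "dist x d < q" "q < e / 2"
        using Rats_dense_in_real[of "dist x d" "e/2"] d(2) by auto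
      have "ball d q \<subseteq> ball x e"
      proof
        fix y assume "y \<in> ball d q"
        then show "y \<in> ball x e" using q d(2) dist_triangle[of x y d] by auto
      qed
      then have "(d, q) \<in> I" using d q e unfolding I_def by auto
      moreover have "x \<in> ball d q" using q by (simp add: dist_commute)
      ultimately show "x \<in> (\<Union>(d, q)\<in>I. ball d q)" by blast
    qed (auto simp: I_def)
    then have "V -` X \<inter> space M = (\<Union>(d, q)\<in>I. {\<omega>\<in>space M. dist (V \<omega>) d < q})"
      by (simp add: vimage_Union vimage_UN Int_UN_distrib2) (fastforce simp: dist_commute)
    also have "\<dots> \<in> sets M"
      using \<open>countable I\<close> dist_meas by (intro sets.countable_UN') auto
    finally show "V -` X \<inter> space M \<in> sets M" .
  qed
qed

section \<open>Narrow convergence\<close>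

lemma borel_prob_measuresD:
  assumes "N \<in> borel_prob_measures"
  shows "prob_space N" "sets N = sets borel" "space N = UNIV"
  using assms sets_eq_imp_space_eq[of N borel] by (auto simp: borel_prob_measures_def)

lemma measurable_borel_prob_measures:
  assumes "N \<in> borel_prob_measures" "f \<in> borel_measurable borel"
  shows "f \<in> borel_measurable N"
  using assms borel_prob_measuresD(2) measurable_cong_sets by blast

lemma integrable_borel_prob_measures:
  fixes f :: "'e::topological_space \<Rightarrow> real"
  assumes "N \<in> borel_prob_measures" "f \<in> borel_measurable borel" "\<And>x. \<bar>f x\<bar> \<le> B"
  shows "integrable N f"
proof -
  interpret prob_space N using borel_prob_measuresD(1)[OF assms(1)] .
  show ?thesis
    using measurable_borel_prob_measures[OF assms(1,2)] assms(3)
    by (intro integrable_const_bound[where B=B]) auto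
qed

lemma distr_borel_prob_measures:
  assumes "prob_space M" "f \<in> borel_measurable M"
  shows "distr M borel f \<in> borel_prob_measures"
  using prob_space.prob_space_distr[OF assms] by (simp add: borel_prob_measures_def)

lemma limitin_narrow_iff:
  fixes N :: "'i \<Rightarrow> 'e::topological_space measure"
  shows "limitin narrow_topology N L F \<longleftrightarrow>
    L \<in> borel_prob_measures \<and> (\<forall>\<^sub>F i in F. N i \<in> borel_prob_measures) \<and>
    (\<forall>\<phi> :: 'e \<Rightarrow> real. continuous_on UNIV \<phi> \<longrightarrow> bounded (range \<phi>) \<longrightarrow>
      ((\<lambda>i. \<integral>u. \<phi> u \<partial>N i) \<longlongrightarrow> (\<integral>u. \<phi> u \<partial>L)) F)" (is "?l \<longleftrightarrow> ?r")
proof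
  assume l: ?l
  then have L: "L \<in> borel_prob_measures"
    by (metis limitin_topspace topspace_narrow_topology)
  have ev: "\<forall>\<^sub>F i in F. N i \<in> U" if "openin narrow_topology U" "L \<in> U" for U
    using l that unfolding limitin_def by blast
  have "\<forall>\<^sub>F i in F. N i \<in> borel_prob_measures"
    by (rule ev) (use L topspace_narrow_topology openin_topspace in metis)+
  moreover have "((\<lambda>i. \<integral>u. \<phi> u \<partial>N i) \<longlongrightarrow> (\<integral>u. \<phi> u \<partial>L)) F"
    if "continuous_on UNIV \<phi>" "bounded (range \<phi>)" for \<phi> :: "'e \<Rightarrow> real"
  proof (rule topological_tendstoI)
    fix U assume U: "open U" "(\<integral>u. \<phi> u \<partial>L) \<in> U"
    have "openin narrow_topology {N \<in> borel_prob_measures. (\<integral>u. \<phi> u \<partial>N) \<in> U}"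
      unfolding narrow_topology_def
      by (rule topology_generated_by_Basis) (use that U in blast)
    from ev[OF this] show "\<forall>\<^sub>F i in F. (\<integral>u. \<phi> u \<partial>N i) \<in> U"
      using L U by (auto elim: eventually_mono)
  qed
  ultimately show ?r using L by blast
next
  assume r: ?r
  have "\<forall>\<^sub>F i in F. N i \<in> U"
    if "generate_topology_on {{N \<in> borel_prob_measures. (\<integral>u. \<phi> u \<partial>N) \<in> U} |(\<phi> :: 'e \<Rightarrow> real) U.
        continuous_on UNIV \<phi> \<and> bounded (range \<phi>) \<and> open U} U" "L \<in> U" for U
    using that
  proof induction
    case (UN K)
    then obtain k where k: "k \<in> K" "L \<in> k" by blast
    from UN(2)[OF k] show ?case by (rule eventually_mono) (use k in blast)
  next
    case (Basis s)
    then obtain \<phi> :: "'e \<Rightarrow> real" and U where s: "s = {N \<in> borel_prob_measures. (\<integral>u. \<phi> u \<partial>N) \<in> U}"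
      "continuous_on UNIV \<phi>" "bounded (range \<phi>)" "open U" by blast
    have "\<forall>\<^sub>F i in F. (\<integral>u. \<phi> u \<partial>N i) \<in> U"
      using r s Basis(2) by (auto intro: topological_tendstoD)
    moreover have "\<forall>\<^sub>F i in F. N i \<in> borel_prob_measures" using r by blast
    ultimately show ?case unfolding s(1) by eventually_elim simp
  qed (auto intro: eventually_conj)
  then show ?l
    using r unfolding limitin_def topspace_narrow_topology
    by (auto simp: narrow_topology_def openin_topology_generated_by_iff)
qed

lemma continuous_map_narrowI:
  fixes \<nu> :: "'i::topological_space \<Rightarrow> 'e::topological_space measure"
  assumes "\<And>t. \<nu> t \<in> borel_prob_measures"
    and "\<And>\<phi> :: 'e \<Rightarrow> real. continuous_on UNIV \<phi> \<Longrightarrow> bounded (range \<phi>) \<Longrightarrow>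
      continuous_on UNIV (\<lambda>t. \<integral>u. \<phi> u \<partial>\<nu> t)"
  shows "continuous_map euclidean narrow_topology \<nu>"
  unfolding narrow_topology_def
proof (rule continuous_on_generated_topo)
  fix S :: "'e measure set"
  assume "S \<in> {{N \<in> borel_prob_measures. (\<integral>u. \<phi> u \<partial>N) \<in> U} |(\<phi> :: 'e \<Rightarrow> real) U.
        continuous_on UNIV \<phi> \<and> bounded (range \<phi>) \<and> open U}"
  then obtain \<phi> :: "'e \<Rightarrow> real" and U where S: "S = {N \<in> borel_prob_measures. (\<integral>u. \<phi> u \<partial>N) \<in> U}"
    "continuous_on UNIV \<phi>" "bounded (range \<phi>)" "open U" by blast
  have "\<nu> -` S \<inter> topspace euclidean = (\<lambda>t. \<integral>u. \<phi> u \<partial>\<nu> t) -` U"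
    using assms(1) by (auto simp: S(1))
  also have "open \<dots>" using S assms(2) by (intro open_vimage)
  finally show "openin euclidean (\<nu> -` S \<inter> topspace euclidean)" by simp
next
  show "\<nu> ` topspace euclidean \<subseteq> \<Union>{{N \<in> borel_prob_measures. (\<integral>u. \<phi> u \<partial>N) \<in> U} |(\<phi> :: 'e \<Rightarrow> real) U.
        continuous_on UNIV \<phi> \<and> bounded (range \<phi>) \<and> open U}"
    using assms(1) topspace_narrow_topology[where ?'a='e]
    unfolding narrow_topology_def topology_generated_by_topspace by blast
qed

section \<open>Continuous convergence\<close>

text \<open>\<open>F n\<close> converges continuously to \<open>G\<close> at \<open>u\<close> when \<open>F n v\<close> tends to \<open>G u\<close> as \<open>n\<close> grows and
  \<open>v\<close> approaches \<open>u\<close> independently of each other.\<close>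

lemma continuous_convergenceI:
  fixes u :: "'a::metric_space"
  assumes "\<And>n v. filterlim n at_top sequentially \<Longrightarrow> v \<longlonglongrightarrow> u \<Longrightarrow>
    \<exists>r :: nat \<Rightarrow> nat. strict_mono r \<and> (\<lambda>j. F (n (r j)) (v (r j))) \<longlonglongrightarrow> L"
  shows "((\<lambda>(n, v). F n v) \<longlongrightarrow> L) (sequentially \<times>\<^sub>F nhds u)"
proof (rule topological_tendstoI, rule ccontr)
  fix U assume U: "open U" "L \<in> U"
    and "\<not> (\<forall>\<^sub>F x in sequentially \<times>\<^sub>F nhds u. (case x of (n, v) \<Rightarrow> F n v) \<in> U)"
  then have n: "\<not> (\<forall>m y. eventually Pf sequentially \<longrightarrow> eventually Pg (nhds u) \<longrightarrow> Pf m \<longrightarrow> Pg y \<longrightarrow> F m y \<in> U)"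
    if "eventually Pf sequentially" "eventually Pg (nhds u)" for Pf Pg
    using that unfolding eventually_prod_filter by auto
  have "\<exists>m v. m \<ge> j \<and> dist v u < inverse (real (Suc j)) \<and> F m v \<notin> U" for j
  proof -
    have "\<forall>\<^sub>F v in nhds u. dist v u < inverse (real (Suc j))"
      unfolding eventually_nhds_metric by (intro exI[of _ "inverse (real (Suc j))"]) auto
    with n[of "\<lambda>m. m \<ge> j" "\<lambda>v. dist v u < inverse (real (Suc j))"] show ?thesis
      using eventually_ge_at_top[of j] by blast
  qed
  then obtain m v where mv: "\<And>j. m j \<ge> j" "\<And>j. dist (v j) u < inverse (real (Suc j))" "\<And>j. F (m j) (v j) \<notin> U"
    by metis
  have "filterlim m at_top sequentially"
    by (rule filterlim_at_top_mono[OF filterlim_ident]) (use mv(1) in auto)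
  moreover have "v \<longlonglongrightarrow> u"
  proof (rule tendsto_dist_iff[THEN iffD2], rule tendsto_sandwich[OF _ _ tendsto_const LIMSEQ_inverse_real_of_nat])
    show "\<forall>\<^sub>F j in sequentially. dist (v j) u \<le> inverse (real (Suc j))"
      by (intro always_eventually allI less_imp_le mv(2))
  qed auto
  ultimately obtain r where r: "strict_mono (r :: nat \<Rightarrow> nat)" "(\<lambda>j. F (m (r j)) (v (r j))) \<longlonglongrightarrow> L"
    using assms by blast
  from topological_tendstoD[OF r(2) U] show False using mv(3) by simp
qed

lemma continuous_convergenceD:
  assumes "((\<lambda>(n, v). F n v) \<longlongrightarrow> L) (sequentially \<times>\<^sub>F nhds u)"
    and "filterlim n sequentially \<F>" "(v \<longlongrightarrow> u) \<F>"
  shows "((\<lambda>j. F (n j) (v j)) \<longlongrightarrow> L) \<F>"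
  using filterlim_compose[OF assms(1) filterlim_Pair[OF assms(2,3)]] by simp

lemma continuous_convergence_pointwise:
  assumes "((\<lambda>(n, v). F n v) \<longlongrightarrow> L) (sequentially \<times>\<^sub>F nhds u)"
  shows "(\<lambda>n. F n u) \<longlonglongrightarrow> L"
  using continuous_convergenceD[OF assms, of "\<lambda>n. n" sequentially "\<lambda>_. u"] by (simp add: filterlim_ident)

lemma continuous_on_UNIV_iff_nhds: "continuous_on UNIV f \<longleftrightarrow> (\<forall>x. (f \<longlongrightarrow> f x) (nhds x))"
  by (simp add: continuous_on_def tendsto_at_iff_tendsto_nhds)

text \<open>Fix v near u and let n tend to infinity in the joint estimate; the bound e / 2 survives
  as a weak inequality.\<close>

lemma continuous_convergence_imp_continuous:
  fixes F :: "nat \<Rightarrow> 'a::topological_space \<Rightarrow> 'b::metric_space"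
  assumes "\<And>u. ((\<lambda>(n, v). F n v) \<longlongrightarrow> G u) (sequentially \<times>\<^sub>F nhds u)"
  shows "continuous_on UNIV G"
proof -
  have "(G \<longlongrightarrow> G u) (nhds u)" for u
  proof (rule tendstoI)
    fix e :: real assume "e > 0"
    then have "\<forall>\<^sub>F (n, v) in sequentially \<times>\<^sub>F nhds u. dist (F n v) (G u) < e / 2"
      using tendstoD[OF assms[of u], of "e/2"] by (simp add: case_prod_unfold)
    then obtain Pf Pg where P: "eventually Pf sequentially" "eventually Pg (nhds u)"
      "\<And>n v. Pf n \<Longrightarrow> Pg v \<Longrightarrow> dist (F n v) (G u) < e / 2"
      unfolding eventually_prod_filter by auto
    show "\<forall>\<^sub>F v in nhds u. dist (G v) (G u) < e"
      using P(2)
    proof eventually_elim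
      case (elim v)
      have "(\<lambda>n. dist (F n v) (G u)) \<longlonglongrightarrow> dist (G v) (G u)"
        by (intro tendsto_intros continuous_convergence_pointwise assms)
      moreover have "\<forall>\<^sub>F n in sequentially. dist (F n v) (G u) \<le> e / 2"
        using P(1) by eventually_elim (use P(3) elim in force)
      ultimately have "dist (G v) (G u) \<le> e / 2"
        by (intro tendsto_upperbound) auto
      then show ?case using \<open>e > 0\<close> by simp
    qed
  qed
  then show ?thesis by (simp add: continuous_on_UNIV_iff_nhds)
qed

text \<open>One half of a continuous mapping theorem with varying maps. Integrals of a fixed
  Lipschitz minorant \<open>b m\<close> converge along N, they lie below those of
  \<open>\<alpha> n\<close> once n is at least m, and continuous convergence is exactly what makes
  \<open>b m\<close> tend to \<open>a\<close> pointwise, so that dominated convergence under L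
  recovers the integral of \<open>a\<close>. The other half follows by applying this to the
  negatives.\<close>

lemma tendsto_integral_lower:
  fixes N :: "nat \<Rightarrow> 'e::metric_space measure" and \<alpha> :: "nat \<Rightarrow> 'e \<Rightarrow> real"
  assumes N: "\<And>n. N n \<in> borel_prob_measures" "L \<in> borel_prob_measures"
    and lip: "\<And>(\<phi> :: 'e \<Rightarrow> real) C. C-lipschitz_on UNIV \<phi> \<Longrightarrow> bounded (range \<phi>) \<Longrightarrow>
      (\<lambda>n. \<integral>u. \<phi> u \<partial>N n) \<longlonglongrightarrow> (\<integral>u. \<phi> u \<partial>L)"
    and meas: "\<And>n. \<alpha> n \<in> borel_measurable borel" and bound: "\<And>n u. \<bar>\<alpha> n u\<bar> \<le> B"
    and conv: "\<And>u. ((\<lambda>(n, v). \<alpha> n v) \<longlongrightarrow> a u) (sequentially \<times>\<^sub>F nhds u)"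
    and e: "0 < e"
  shows "\<forall>\<^sub>F n in sequentially. (\<integral>u. a u \<partial>L) - e < (\<integral>u. \<alpha> n u \<partial>N n)"
proof -
  \<comment> \<open>\<open>b m\<close> is the largest \<open>m\<close>-Lipschitz function below all \<open>\<alpha> n\<close> with \<open>n \<ge> m\<close>.\<close>
  define b where "b m u = (INF (n, v)\<in>{m..} \<times> UNIV. \<alpha> n v + real m * dist u v)" for m u
  have lower: "- B \<le> \<alpha> n v + real m * dist u v" for n m u v
    using bound[of n v] by (intro add_increasing2) auto
  have bdd: "bdd_below ((\<lambda>(n, v). \<alpha> n v + real m * dist u v) ` ({m..} \<times> UNIV))" for m u
    using lower by (intro bdd_belowI[of _ "-B"]) auto
  have b_le: "b m u \<le> \<alpha> n v + real m * dist u v" if "m \<le> n" for m n u v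
    unfolding b_def by (rule cINF_lower2[OF bdd, of "(n, v)"]) (use that in auto)
  have le_b: "c \<le> b m u" if "\<And>n v. m \<le> n \<Longrightarrow> c \<le> \<alpha> n v + real m * dist u v" for m u c
    unfolding b_def by (rule cINF_greatest) (use that in auto)
  have b_bound: "\<bar>b m u\<bar> \<le> B" for m u
    using b_le[of m m u u] bound[of m u] le_b[of m "-B" u] lower by (auto simp: abs_le_iff)
  have "b m u \<le> b m v + real m * dist u v" for m u v
  proof -
    have "b m u - real m * dist u v \<le> b m v"
    proof (rule le_b)
      fix n w assume "m \<le> n"
      have "real m * dist u w \<le> real m * dist v w + real m * dist u v"
        using mult_left_mono[OF dist_triangle[of u w v], of "real m"] by (simp add: algebra_simps)
      then show "b m u - real m * dist u v \<le> \<alpha> n w + real m * dist v w"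
        using b_le[OF \<open>m \<le> n\<close>, of u w] by simp
    qed
    then show ?thesis by simp
  qed
  note b_step = this
  have b_lip: "(real m)-lipschitz_on UNIV (b m)" for m
  proof (rule lipschitz_onI)
    fix u v
    show "dist (b m u) (b m v) \<le> real m * dist u v"
      using b_step[of m u v] b_step[of m v u] by (simp add: dist_real_def abs_le_iff dist_commute)
  qed simp
  have b_meas: "b m \<in> borel_measurable borel" for m
    using b_lip[of m] by (intro borel_measurable_continuous_onI lipschitz_on_continuous_on)
  have b_bounded: "bounded (range (b m))" for m
    using b_bound by (auto intro!: boundedI[of _ B])
  have b_conv: "(\<lambda>m. b m u) \<longlonglongrightarrow> a u" for u
  proof (rule LIMSEQ_I)
    fix r :: real assume "r > 0"
    then have "\<forall>\<^sub>F (n, v) in sequentially \<times>\<^sub>F nhds u. dist (\<alpha> n v) (a u) < r / 2"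
      using tendstoD[OF conv[of u], of "r/2"] by (simp add: case_prod_unfold)
    then obtain Pf Pg where P: "eventually Pf sequentially" "eventually Pg (nhds u)"
      "\<And>n v. Pf n \<Longrightarrow> Pg v \<Longrightarrow> dist (\<alpha> n v) (a u) < r / 2"
      unfolding eventually_prod_filter by auto
    obtain n0 where n0: "\<And>n. n \<ge> n0 \<Longrightarrow> Pf n" using P(1) by (auto simp: eventually_sequentially)
    obtain d where d: "d > 0" "\<And>v. dist v u < d \<Longrightarrow> Pg v" using P(2) by (auto simp: eventually_nhds_metric)
    \<comment> \<open>With this m0 the penalty at distance d or more is at least
      \<open>\<bar>a u\<bar> + B\<close>, so far points cannot pull the infimum below
      \<open>a u\<close>.\<close>
    obtain m0 :: nat where m0: "(\<bar>a u\<bar> + B) / d \<le> real m0" using real_arch_simple by blast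
    have "norm (b m u - a u) < r" if m: "m \<ge> max n0 m0" for m
    proof -
      have "a u - r / 2 \<le> b m u"
      proof (rule le_b)
        fix n v assume "m \<le> n"
        show "a u - r / 2 \<le> \<alpha> n v + real m * dist u v"
        proof (cases "dist v u < d")
          case True
          then have "dist (\<alpha> n v) (a u) < r / 2" using P(3) n0 d(2) m \<open>m \<le> n\<close> by auto
          moreover have "0 \<le> real m * dist u v" by simp
          ultimately show ?thesis unfolding dist_real_def by linarith
        next
          case False
          have "(\<bar>a u\<bar> + B) / d \<le> real m" using m0 m by linarith
          then have "\<bar>a u\<bar> + B \<le> real m * d" using d(1) by (simp add: field_simps)
          also have "\<dots> \<le> real m * dist u v" using False by (intro mult_left_mono) (auto simp: dist_commute)
          finally show ?thesis using bound[of n v] \<open>r > 0\<close> by linarith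
        qed
      qed
      moreover have "b m u \<le> \<alpha> m u" using b_le[of m m u u] by simp
      moreover have "dist (\<alpha> m u) (a u) < r / 2" using P(3) n0 d m by auto
      ultimately show ?thesis using \<open>r > 0\<close> unfolding dist_real_def real_norm_def by linarith
    qed
    then show "\<exists>no. \<forall>m\<ge>no. norm (b m u - a u) < r" by blast
  qed
  interpret L: prob_space L using borel_prob_measuresD(1)[OF N(2)] .
  have "(\<lambda>m. \<integral>u. b m u \<partial>L) \<longlonglongrightarrow> (\<integral>u. a u \<partial>L)"
  proof (rule integral_dominated_convergence[where w="\<lambda>_. B"])
    show "a \<in> borel_measurable L"
      by (rule measurable_borel_prob_measures[OF N(2)]) (rule borel_measurable_LIMSEQ_real[OF b_conv b_meas])
    show "b m \<in> borel_measurable L" for m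
      by (rule measurable_borel_prob_measures[OF N(2) b_meas])
  qed (use b_conv b_bound in auto)
  then have "\<forall>\<^sub>F m in sequentially. dist (\<integral>u. b m u \<partial>L) (\<integral>u. a u \<partial>L) < e / 2"
    using e by (intro tendstoD) auto
  then obtain m where m: "dist (\<integral>u. b m u \<partial>L) (\<integral>u. a u \<partial>L) < e / 2"
    by (meson eventually_happens trivial_limit_sequentially)
  have "\<forall>\<^sub>F n in sequentially. dist (\<integral>u. b m u \<partial>N n) (\<integral>u. b m u \<partial>L) < e / 2"
    using e by (intro tendstoD lip[OF b_lip b_bounded]) auto
  then show ?thesis
    using eventually_ge_at_top[of m]
  proof eventually_elim
    case (elim n)
    have "(\<integral>u. b m u \<partial>N n) \<le> (\<integral>u. \<alpha> n u \<partial>N n)"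
      using b_le[OF elim(2), of u u for u]
      by (intro integral_mono integrable_borel_prob_measures[OF N(1) b_meas b_bound]
          integrable_borel_prob_measures[OF N(1) meas bound]) simp
    then show ?case using elim(1) m unfolding dist_real_def by linarith
  qed
qed

lemma tendsto_integral_continuous_convergence:
  fixes N :: "nat \<Rightarrow> 'e::metric_space measure" and \<alpha> :: "nat \<Rightarrow> 'e \<Rightarrow> real"
  assumes N: "\<And>n. N n \<in> borel_prob_measures" "L \<in> borel_prob_measures"
    and lip: "\<And>(\<phi> :: 'e \<Rightarrow> real) C. C-lipschitz_on UNIV \<phi> \<Longrightarrow> bounded (range \<phi>) \<Longrightarrow>
      (\<lambda>n. \<integral>u. \<phi> u \<partial>N n) \<longlonglongrightarrow> (\<integral>u. \<phi> u \<partial>L)"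
    and meas: "\<And>n. \<alpha> n \<in> borel_measurable borel" and bound: "\<And>n u. \<bar>\<alpha> n u\<bar> \<le> B"
    and conv: "\<And>u. ((\<lambda>(n, v). \<alpha> n v) \<longlongrightarrow> a u) (sequentially \<times>\<^sub>F nhds u)"
  shows "(\<lambda>n. \<integral>u. \<alpha> n u \<partial>N n) \<longlonglongrightarrow> (\<integral>u. a u \<partial>L)"
proof (rule tendstoI)
  fix e :: real assume e: "0 < e"
  have "((\<lambda>(n, v). - \<alpha> n v) \<longlongrightarrow> - a u) (sequentially \<times>\<^sub>F nhds u)" for u
    using tendsto_minus[OF conv[of u]] by (simp add: case_prod_unfold)
  then have "\<forall>\<^sub>F n in sequentially. (\<integral>u. - a u \<partial>L) - e < (\<integral>u. - \<alpha> n u \<partial>N n)"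
    using meas bound by (intro tendsto_integral_lower[OF N lip _ _ _ e, where B=B]) auto
  moreover have "\<forall>\<^sub>F n in sequentially. (\<integral>u. a u \<partial>L) - e < (\<integral>u. \<alpha> n u \<partial>N n)"
    by (rule tendsto_integral_lower[OF N lip meas bound conv e])
  ultimately show "\<forall>\<^sub>F n in sequentially. dist (\<integral>u. \<alpha> n u \<partial>N n) (\<integral>u. a u \<partial>L) < e"
    by eventually_elim (auto simp: dist_real_def)
qed

text \<open>A single continuous function, viewed as a constant sequence, converges continuously;
  hence convergence for bounded Lipschitz functions already decides narrow convergence.\<close>

lemma limitin_narrow_lipschitzI:
  fixes N :: "nat \<Rightarrow> 'e::metric_space measure"
  assumes N: "\<And>n. N n \<in> borel_prob_measures" "L \<in> borel_prob_measures"
    and lip: "\<And>(\<phi> :: 'e \<Rightarrow> real) C. C-lipschitz_on UNIV \<phi> \<Longrightarrow> bounded (range \<phi>) \<Longrightarrow>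
      (\<lambda>n. \<integral>u. \<phi> u \<partial>N n) \<longlonglongrightarrow> (\<integral>u. \<phi> u \<partial>L)"
  shows "limitin narrow_topology N L sequentially"
  unfolding limitin_narrow_iff
proof (intro conjI N(2) allI impI always_eventually N(1))
  fix \<phi> :: "'e \<Rightarrow> real" assume c: "continuous_on UNIV \<phi>" and "bounded (range \<phi>)"
  then obtain B where B: "\<And>u. \<bar>\<phi> u\<bar> \<le> B" unfolding bounded_iff by auto
  have "((\<lambda>(n :: nat, v). \<phi> v) \<longlongrightarrow> \<phi> u) (sequentially \<times>\<^sub>F nhds u)" for u
  proof -
    have "(\<phi> \<longlongrightarrow> \<phi> u) (nhds u)" using c by (simp add: continuous_on_UNIV_iff_nhds)
    then show ?thesis
      using filterlim_compose[OF _ filterlim_snd] by (simp add: case_prod_unfold)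
  qed
  then show "(\<lambda>n. \<integral>u. \<phi> u \<partial>N n) \<longlonglongrightarrow> (\<integral>u. \<phi> u \<partial>L)"
    using B by (intro tendsto_integral_continuous_convergence[OF N lip, where B=B])
      (auto intro: borel_measurable_continuous_onI c)
qed

lemma limitin_narrow_distr:
  fixes N :: "nat \<Rightarrow> 'e::metric_space measure" and \<Phi> :: "nat \<Rightarrow> 'e \<Rightarrow> 'f::metric_space"
  assumes lim: "limitin narrow_topology N L sequentially" and N: "\<And>n. N n \<in> borel_prob_measures"
    and meas: "\<And>n. \<Phi> n \<in> borel_measurable borel"
    and conv: "\<And>u. ((\<lambda>(n, v). \<Phi> n v) \<longlongrightarrow> \<Psi> u) (sequentially \<times>\<^sub>F nhds u)"
  shows "limitin narrow_topology (\<lambda>n. distr (N n) borel (\<Phi> n)) (distr L borel \<Psi>) sequentially"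
proof -
  have L: "L \<in> borel_prob_measures" using lim unfolding limitin_narrow_iff by blast
  have \<Psi>: "\<Psi> \<in> borel_measurable borel"
    by (rule borel_measurable_LIMSEQ_metric[OF meas continuous_convergence_pointwise[OF conv]])
  show ?thesis
    unfolding limitin_narrow_iff
  proof (intro conjI allI impI always_eventually)
    show "distr L borel \<Psi> \<in> borel_prob_measures"
      by (intro distr_borel_prob_measures borel_prob_measuresD[OF L] measurable_borel_prob_measures[OF L] \<Psi>)
    show "distr (N n) borel (\<Phi> n) \<in> borel_prob_measures" for n
      by (intro distr_borel_prob_measures borel_prob_measuresD[OF N] measurable_borel_prob_measures[OF N] meas)
    fix \<phi> :: "'f \<Rightarrow> real" assume c: "continuous_on UNIV \<phi>" and b: "bounded (range \<phi>)"
    obtain B where B: "\<And>u. \<bar>\<phi> u\<bar> \<le> B" using b unfolding bounded_iff by auto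
    have \<phi>: "\<phi> \<in> borel_measurable borel" by (rule borel_measurable_continuous_onI[OF c])
    have "(\<lambda>n. \<integral>u. \<phi> (\<Phi> n u) \<partial>N n) \<longlonglongrightarrow> (\<integral>u. \<phi> (\<Psi> u) \<partial>L)"
    proof (rule tendsto_integral_continuous_convergence[OF N L])
      show "(\<lambda>n. \<integral>u. \<phi> u \<partial>N n) \<longlonglongrightarrow> (\<integral>u. \<phi> u \<partial>L)"
        if "C-lipschitz_on UNIV \<phi>" "bounded (range \<phi>)" for \<phi> :: "'e \<Rightarrow> real" and C
        using lim that lipschitz_on_continuous_on unfolding limitin_narrow_iff by blast
      show "(\<lambda>u. \<phi> (\<Phi> n u)) \<in> borel_measurable borel" for n
        using measurable_compose[OF meas \<phi>] .
      show "\<bar>\<phi> (\<Phi> n u)\<bar> \<le> B" for n u by (rule B)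
      show "((\<lambda>(n, v). \<phi> (\<Phi> n v)) \<longlongrightarrow> \<phi> (\<Psi> u)) (sequentially \<times>\<^sub>F nhds u)" for u
        using continuous_on_tendsto_compose[OF c conv[of u]] by (simp add: case_prod_unfold)
    qed
    then show "(\<lambda>n. \<integral>u. \<phi> u \<partial>distr (N n) borel (\<Phi> n)) \<longlonglongrightarrow> (\<integral>u. \<phi> u \<partial>distr L borel \<Psi>)"
      using \<phi> \<Psi> meas by (simp add: integral_distr measurable_borel_prob_measures[OF N] measurable_borel_prob_measures[OF L])
  qed
qed

lemma compact_insert_range_tendsto:
  fixes f :: "nat \<Rightarrow> 'a::topological_space"
  assumes "f \<longlonglongrightarrow> l"
  shows "compact (insert l (range f))"
  unfolding compact_eq_Heine_Borel
proof (intro allI impI, elim conjE)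
  fix C assume C: "\<forall>U\<in>C. open U" "insert l (range f) \<subseteq> \<Union>C"
  then obtain U where U: "U \<in> C" "l \<in> U" by auto
  then obtain N where N: "\<And>n. n \<ge> N \<Longrightarrow> f n \<in> U"
    using topological_tendstoD[OF assms] C(1) unfolding eventually_sequentially by blast
  have "\<forall>n. \<exists>V\<in>C. f n \<in> V" using C(2) by auto
  then obtain V where V: "\<And>n. V n \<in> C" "\<And>n. f n \<in> V n" by metis
  have "insert l (range f) \<subseteq> \<Union>(insert U (V ` {..<N}))"
    using U N V(2) by (auto simp: not_less dest: leI)
  moreover have "insert U (V ` {..<N}) \<subseteq> C" using U V by auto
  ultimately show "\<exists>C'\<subseteq>C. finite C' \<and> insert l (range f) \<subseteq> \<Union>C'" by blast
qed

lemma tendsto_dist_zero_transform: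
  fixes f g :: "'i \<Rightarrow> 'a::metric_space"
  assumes "(f \<longlongrightarrow> l) F" "((\<lambda>i. dist (f i) (g i)) \<longlongrightarrow> 0) F"
  shows "(g \<longlongrightarrow> l) F"
proof (rule tendstoI)
  fix e :: real assume "e > 0"
  then have "e / 2 > 0" by simp
  from tendstoD[OF assms(1) this] order_tendstoD(2)[OF assms(2) this]
  show "\<forall>\<^sub>F i in F. dist (g i) l < e"
    by eventually_elim (metis dist_triangle_half_r)
qed

lemma uniform_limit_compact_sequentialI:
  fixes f :: "nat \<Rightarrow> 'a::metric_space \<Rightarrow> 'b::metric_space"
  assumes K: "compact K" and l: "continuous_on K l"
    and seq: "\<And>r t t0. strict_mono r \<Longrightarrow> (\<And>j. t j \<in> K) \<Longrightarrow> t0 \<in> K \<Longrightarrow> t \<longlonglongrightarrow> t0 \<Longrightarrow>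
      (\<lambda>j. f (r j) (t j)) \<longlonglongrightarrow> l t0"
  shows "uniform_limit K f l sequentially"
proof (rule uniform_limitI, rule ccontr)
  fix e :: real assume e: "e > 0"
    and "\<not> (\<forall>\<^sub>F n in sequentially. \<forall>x\<in>K. dist (f n x) (l x) < e)"
  then obtain r where r: "strict_mono (r :: nat \<Rightarrow> nat)" "\<And>j. \<not> (\<forall>x\<in>K. dist (f (r j) x) (l x) < e)"
    using not_eventually_sequentiallyD by blast
  then obtain t where t: "\<And>j. t j \<in> K" "\<And>j. \<not> dist (f (r j) (t j)) (l (t j)) < e" by metis
  then obtain t0 q where q: "t0 \<in> K" "strict_mono (q :: nat \<Rightarrow> nat)" "(t \<circ> q) \<longlonglongrightarrow> t0"
    using K unfolding compact_def by metis
  have "(\<lambda>j. f ((r \<circ> q) j) ((t \<circ> q) j)) \<longlonglongrightarrow> l t0"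
    by (rule seq[OF strict_mono_o[OF r(1) q(2)] _ q(1,3)]) (simp add: t(1))
  moreover have "(\<lambda>j. l ((t \<circ> q) j)) \<longlonglongrightarrow> l t0"
    by (rule continuous_on_tendsto_compose[OF l q(3,1)]) (simp add: t(1))
  ultimately have "(\<lambda>j. dist (f ((r \<circ> q) j) ((t \<circ> q) j)) (l ((t \<circ> q) j))) \<longlonglongrightarrow> dist (l t0) (l t0)"
    by (rule tendsto_dist)
  then have "\<forall>\<^sub>F j in sequentially. dist (f ((r \<circ> q) j) ((t \<circ> q) j)) (l ((t \<circ> q) j)) < e"
    using e by (intro order_tendstoD(2)) auto
  then show False using t(2) by (auto simp: eventually_sequentially)
qed

lemma uniform_limit_tendsto_compose:
  fixes f :: "'i \<Rightarrow> 'a::topological_space \<Rightarrow> 'b::metric_space"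
  assumes lim: "uniform_limit K f l F" and l: "continuous_on K l"
    and y: "(y \<longlongrightarrow> x) F" "x \<in> K" "\<And>i. y i \<in> K"
  shows "((\<lambda>i. f i (y i)) \<longlongrightarrow> l x) F"
proof (rule tendstoI)
  fix e :: real assume "e > 0"
  then have e: "e / 2 > 0" by simp
  have "((\<lambda>i. l (y i)) \<longlongrightarrow> l x) F"
    by (rule continuous_on_tendsto_compose[OF l y(1,2)]) (simp add: y(3))
  from tendstoD[OF this e] uniform_limitD[OF lim e]
  show "\<forall>\<^sub>F i in F. dist (f i (y i)) (l x) < e"
  proof eventually_elim
    case (elim i)
    from elim(2) y(3) have "dist (f i (y i)) (l (y i)) < e / 2" by blast
    with elim(1) show ?case by (metis dist_commute dist_triangle_half_r)
  qed
qed

lemma continuous_convergence_imp_uniform_limit: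
  fixes F :: "nat \<Rightarrow> 'a::metric_space \<Rightarrow> 'b::metric_space"
  assumes conv: "\<And>u. ((\<lambda>(n, v). F n v) \<longlongrightarrow> G u) (sequentially \<times>\<^sub>F nhds u)" and K: "compact K"
  shows "uniform_limit K F G sequentially"
proof (rule uniform_limit_compact_sequentialI[OF K])
  show "continuous_on K G"
    using continuous_convergence_imp_continuous[OF conv] continuous_on_subset by blast
  fix r :: "nat \<Rightarrow> nat" and t :: "nat \<Rightarrow> 'a" and t0 assume "strict_mono r" "t \<longlonglongrightarrow> t0"
  then show "(\<lambda>j. F (r j) (t j)) \<longlonglongrightarrow> G t0"
    by (intro continuous_convergenceD[OF conv] filterlim_subseq)
qed

section \<open>Laws of paths\<close>

lemma Rep_Ck_shifted_path:
  assumes "continuous_process M X" "\<omega> \<in> space M"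
  shows "Rep_Ck (shifted_path X t \<omega>) s = X (t + s) \<omega>"
proof -
  have "continuous_on UNIV (\<lambda>s. X s \<omega>)" using assms by (auto simp: continuous_process_def)
  then have "continuous_on UNIV (\<lambda>s. X (t + s) \<omega>)"
    by (rule continuous_on_compose2) (auto intro: continuous_intros)
  then show ?thesis by (simp add: shifted_path_def Rep_Abs_Ck)
qed

lemma measurable_shifted_path:
  fixes X :: "real \<Rightarrow> 'w \<Rightarrow> 'x::{metric_space, second_countable_topology}"
  assumes X: "continuous_process M X"
  shows "shifted_path X t \<in> borel_measurable M"
  unfolding borel_measurable_Ck_iff
proof
  fix s
  have "X (t + s) \<in> borel_measurable M" using X by (auto simp: continuous_process_def)
  then show "(\<lambda>\<omega>. Rep_Ck (shifted_path X t \<omega>) s) \<in> borel_measurable M"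
    using Rep_Ck_shifted_path[OF X] by (subst measurable_cong) auto
qed

lemma path_law_borel_prob_measures:
  fixes X :: "real \<Rightarrow> 'w \<Rightarrow> 'x::{metric_space, second_countable_topology}"
  assumes "prob_space M" "continuous_process M X"
  shows "path_law M X t \<in> borel_prob_measures"
  unfolding path_law_def by (intro distr_borel_prob_measures measurable_shifted_path assms)

lemma tendsto_shifted_path:
  fixes X :: "real \<Rightarrow> 'w \<Rightarrow> 'x::metric_space"
  assumes X: "continuous_process M X" and "\<omega> \<in> space M" and r: "r \<longlonglongrightarrow> t"
  shows "(\<lambda>n. shifted_path X (r n) \<omega>) \<longlonglongrightarrow> shifted_path X t \<omega>"
  unfolding tendsto_Ck_iff
proof (intro allI impI uniform_limitI)
  fix K :: "real set" and e :: real assume K: "compact K" and e: "e > 0"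
  have c: "continuous_on UNIV (\<lambda>s. X s \<omega>)" using assms by (auto simp: continuous_process_def)
  define C where "C = (\<lambda>(a, b). a + b) ` (insert t (range r) \<times> K)"
  have "compact C"
    unfolding C_def using compact_sequence_with_limit[OF r] K
    by (intro compact_continuous_image compact_Times) (auto simp: case_prod_unfold intro!: continuous_intros)
  then have "uniformly_continuous_on C (\<lambda>s. X s \<omega>)"
    using c by (intro compact_uniformly_continuous) (auto intro: continuous_on_subset)
  then obtain d where d: "d > 0" "\<And>x y. x \<in> C \<Longrightarrow> y \<in> C \<Longrightarrow> dist x y < d \<Longrightarrow> dist (X x \<omega>) (X y \<omega>) < e"
    using e unfolding uniformly_continuous_on_def by metis
  have "\<forall>\<^sub>F n in sequentially. dist (r n) t < d" using r d(1) by (rule tendstoD)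
  then show "\<forall>\<^sub>F n in sequentially. \<forall>x\<in>K. dist (Rep_Ck (shifted_path X (r n) \<omega>) x) (Rep_Ck (shifted_path X t \<omega>) x) < e"
  proof eventually_elim
    case (elim n)
    have "r n + x \<in> C" "t + x \<in> C" "dist (r n + x) (t + x) < d" if "x \<in> K" for x
      using that elim by (auto simp: C_def)
    then show ?case using d(2) by (simp add: Rep_Ck_shifted_path[OF X \<open>\<omega> \<in> space M\<close>])
  qed
qed

text \<open>Settles the continuity clause of every notion of almost periodicity or automorphy in
  distribution: shifts of continuous paths are continuous in time, and bounded convergence does the
  rest.\<close>

lemma continuous_map_path_law:
  fixes X :: "real \<Rightarrow> 'w \<Rightarrow> 'x::{metric_space, second_countable_topology}"
  assumes "prob_space M" and X: "continuous_process M X"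
  shows "continuous_map euclidean narrow_topology (path_law M X)"
proof (rule continuous_map_narrowI)
  show "path_law M X t \<in> borel_prob_measures" for t
    by (rule path_law_borel_prob_measures[OF assms])
  interpret prob_space M by fact
  fix \<phi> :: "'x Ck \<Rightarrow> real" assume c: "continuous_on UNIV \<phi>" and "bounded (range \<phi>)"
  then obtain B where B: "\<And>u. \<bar>\<phi> u\<bar> \<le> B" unfolding bounded_iff by auto
  have \<phi>: "\<phi> \<in> borel_measurable borel" by (rule borel_measurable_continuous_onI[OF c])
  have "continuous_on UNIV (\<lambda>t. \<integral>\<omega>. \<phi> (shifted_path X t \<omega>) \<partial>M)"
  proof (rule continuous_on_sequentiallyI)
    fix r :: "nat \<Rightarrow> real" and t assume "r \<longlonglongrightarrow> t"
    then show "(\<lambda>n. \<integral>\<omega>. \<phi> (shifted_path X (r n) \<omega>) \<partial>M) \<longlonglongrightarrow> (\<integral>\<omega>. \<phi> (shifted_path X t \<omega>) \<partial>M)"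
      using \<phi> measurable_shifted_path[OF X] B continuous_on_tendsto_compose[OF c tendsto_shifted_path[OF X]]
      by (intro integral_dominated_convergence[where w="\<lambda>_. B"]) (auto intro: measurable_compose)
  qed
  then show "continuous_on UNIV (\<lambda>t. \<integral>u. \<phi> u \<partial>path_law M X t)"
    using \<phi> measurable_shifted_path[OF X] by (simp add: path_law_def integral_distr)
qed

section \<open>Superposition on path space\<close>

definition compose_Ck :: "(real \<Rightarrow> 'x::topological_space \<Rightarrow> 'y::topological_space) \<Rightarrow> 'x Ck \<Rightarrow> 'y Ck" where
  "compose_Ck F u = Abs_Ck (\<lambda>r. F r (Rep_Ck u r))"

lemma Rep_compose_Ck:
  assumes "continuous_on UNIV (\<lambda>(t, x). F t x)"
  shows "Rep_Ck (compose_Ck F u) r = F r (Rep_Ck u r)"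
proof -
  have "continuous_on UNIV (\<lambda>r. (\<lambda>(t, x). F t x) (r, Rep_Ck u r))"
    by (rule continuous_on_compose2[OF assms]) (auto intro!: continuous_intros)
  then show ?thesis by (simp add: compose_Ck_def Rep_Abs_Ck)
qed

lemma measurable_compose_Ck:
  fixes F :: "real \<Rightarrow> 'x::metric_space \<Rightarrow> 'y::{metric_space, second_countable_topology}"
  assumes F: "continuous_on UNIV (\<lambda>(t, x). F t x)"
  shows "compose_Ck F \<in> borel_measurable borel"
  unfolding borel_measurable_Ck_iff
proof
  fix r
  have "continuous_on UNIV (\<lambda>u. (\<lambda>(t, x). F t x) (r, Rep_Ck u r))"
    by (rule continuous_on_compose2[OF F]) (auto intro!: continuous_intros continuous_on_eval_Ck)
  then show "(\<lambda>u. Rep_Ck (compose_Ck F u) r) \<in> borel_measurable borel"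
    by (intro borel_measurable_continuous_onI) (simp add: Rep_compose_Ck[OF F])
qed

text \<open>Uniform convergence on a compact time set is tested along moving times. There the pair
  of time and path value converges, which is the situation that continuous convergence of F in both
  variables was made for.\<close>

lemma compose_Ck_continuous_convergence:
  fixes F :: "nat \<Rightarrow> real \<Rightarrow> 'x::metric_space \<Rightarrow> 'y::metric_space"
  assumes F: "\<And>n. continuous_on UNIV (\<lambda>(t, x). F n t x)"
    and conv: "\<And>z. ((\<lambda>(n, v). case v of (t, x) \<Rightarrow> F n t x) \<longlongrightarrow> (case z of (t, x) \<Rightarrow> G t x)) (sequentially \<times>\<^sub>F nhds z)"
  shows "((\<lambda>(n, v). compose_Ck (F n) v) \<longlongrightarrow> compose_Ck G u) (sequentially \<times>\<^sub>F nhds u)"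
proof (rule continuous_convergenceI)
  have G: "continuous_on UNIV (\<lambda>(t, x). G t x)"
    by (rule continuous_convergence_imp_continuous[OF conv])
  fix n :: "nat \<Rightarrow> nat" and v assume n: "filterlim n at_top sequentially" and v: "v \<longlonglongrightarrow> u"
  have "(\<lambda>j. compose_Ck (F (n j)) (v j)) \<longlonglongrightarrow> compose_Ck G u"
    unfolding tendsto_Ck_iff
  proof (intro allI impI uniform_limit_compact_sequentialI continuous_on_Rep_Ck)
    fix r :: "nat \<Rightarrow> nat" and t :: "nat \<Rightarrow> real" and t0 assume r: "strict_mono r" and t: "t \<longlonglongrightarrow> t0"
    have "(\<lambda>j. v (r j)) \<longlonglongrightarrow> u" using LIMSEQ_subseq_LIMSEQ[OF v r] by (simp add: o_def)
    then have "(\<lambda>j. (t j, Rep_Ck (v (r j)) (t j))) \<longlonglongrightarrow> (t0, Rep_Ck u t0)"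
      using t by (intro tendsto_Pair tendsto_Rep_Ck)
    moreover have "filterlim (\<lambda>j. n (r j)) sequentially sequentially"
      using filterlim_compose[OF n filterlim_subseq[OF r]] .
    ultimately show "(\<lambda>j. Rep_Ck (compose_Ck (F (n (r j))) (v (r j))) (t j)) \<longlonglongrightarrow> Rep_Ck (compose_Ck G u) t0"
      using continuous_convergenceD[OF conv[of "(t0, Rep_Ck u t0)"], of "\<lambda>j. n (r j)" sequentially]
      by (fastforce simp: Rep_compose_Ck[OF F] Rep_compose_Ck[OF G])
  qed
  then show "\<exists>r :: nat \<Rightarrow> nat. strict_mono r \<and> (\<lambda>j. compose_Ck (F (n (r j))) (v (r j))) \<longlonglongrightarrow> compose_Ck G u"
    by (intro exI[of _ id]) (auto simp: strict_mono_def)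
qed

lemma continuous_on_shift:
  fixes f :: "real \<Rightarrow> 'x::topological_space \<Rightarrow> 'y::topological_space"
  assumes "continuous_on UNIV (\<lambda>(t, x). f t x)"
  shows "continuous_on UNIV (\<lambda>(r, x). f (t + r) x)"
proof -
  have "continuous_on UNIV (\<lambda>z. (\<lambda>(t, x). f t x) (t + fst z, snd z))"
    by (rule continuous_on_compose2[OF assms]) (auto intro!: continuous_intros)
  then show ?thesis by (simp add: case_prod_unfold)
qed

lemma continuous_process_compose:
  fixes X :: "real \<Rightarrow> 'w \<Rightarrow> 'x::topological_space" and f :: "real \<Rightarrow> 'x \<Rightarrow> 'y::topological_space"
  assumes X: "continuous_process M X" and f: "continuous_on UNIV (\<lambda>(t, x). f t x)"
  shows "continuous_process M (\<lambda>t \<omega>. f t (X t \<omega>))"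
  unfolding continuous_process_def
proof (intro conjI allI ballI)
  fix t
  have "continuous_on UNIV (\<lambda>x. (\<lambda>(t, x). f t x) (t, x))"
    by (rule continuous_on_compose2[OF f]) (auto intro!: continuous_intros)
  then have "f t \<in> borel_measurable borel" by (simp add: borel_measurable_continuous_onI)
  moreover have "X t \<in> borel_measurable M" using X by (auto simp: continuous_process_def)
  ultimately show "(\<lambda>\<omega>. f t (X t \<omega>)) \<in> borel_measurable M" by (rule measurable_compose[rotated])
next
  fix \<omega> assume "\<omega> \<in> space M"
  then have "continuous_on UNIV (\<lambda>t. X t \<omega>)" using X by (auto simp: continuous_process_def)
  then have "continuous_on UNIV (\<lambda>t. (\<lambda>(t, x). f t x) (t, X t \<omega>))"
    by (intro continuous_on_compose2[OF f] continuous_intros) auto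
  then show "continuous_on UNIV (\<lambda>t. f t (X t \<omega>))" by simp
qed

text \<open>A shifted path has forgotten its absolute time, so the superposition map has to carry
  the translate of f.\<close>

lemma path_law_compose:
  fixes X :: "real \<Rightarrow> 'w \<Rightarrow> 'x::{metric_space, second_countable_topology}"
    and f :: "real \<Rightarrow> 'x \<Rightarrow> 'y::{metric_space, second_countable_topology}"
  assumes X: "continuous_process M X" and f: "continuous_on UNIV (\<lambda>(t, x). f t x)"
  shows "path_law M (\<lambda>t \<omega>. f t (X t \<omega>)) t = distr (path_law M X t) borel (compose_Ck (\<lambda>r. f (t + r)))"
proof -
  have "shifted_path (\<lambda>t \<omega>. f t (X t \<omega>)) t \<omega> = compose_Ck (\<lambda>r. f (t + r)) (shifted_path X t \<omega>)"
    if "\<omega> \<in> space M" for \<omega>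
    unfolding compose_Ck_def using Rep_Ck_shifted_path[OF X that] by (simp add: shifted_path_def)
  then show ?thesis
    unfolding path_law_def
    by (subst distr_distr[OF measurable_compose_Ck[OF continuous_on_shift[OF f]] measurable_shifted_path[OF X]])
      (auto intro: distr_cong)
qed

section \<open>Compact almost automorphy\<close>

text \<open>Baire category: a pointwise convergent sequence of continuous functions converges almost
  uniformly on some small interval, where small translations do not change the limit.\<close>

lemma pointwise_limit_translates_eq:
  fixes G :: "nat \<Rightarrow> real \<Rightarrow> 'y::metric_space"
  assumes G: "\<And>n. continuous_on UNIV (G n)" and lim: "\<And>t. (\<lambda>n. G n t) \<longlonglongrightarrow> g t"
    and g: "continuous_on UNIV g" and h: "h \<longlonglongrightarrow> 0"
    and lim': "\<And>t. (\<lambda>n. G n (t + h n)) \<longlonglongrightarrow> g' t" and g': "continuous_on UNIV g'"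
  shows "g' \<tau> = g \<tau>"
proof (rule ccontr)
  assume "g' \<tau> \<noteq> g \<tau>"
  \<comment> \<open>Continuity keeps \<open>g'\<close> and \<open>g\<close> more than e apart on a
    whole ball around \<open>\<tau>\<close>; the rest finds a point of this ball at which they are e
    / 4 close.\<close>
  define e where "e = dist (g' \<tau>) (g \<tau>) / 2"
  have e: "e > 0" using \<open>g' \<tau> \<noteq> g \<tau>\<close> by (simp add: e_def)
  have "continuous_on UNIV (\<lambda>t. dist (g' t) (g t))" by (intro continuous_intros g g')
  then have "open ((\<lambda>t. dist (g' t) (g t)) -` {e<..})" by (intro open_vimage) auto
  moreover have "\<tau> \<in> (\<lambda>t. dist (g' t) (g t)) -` {e<..}" using e by (simp add: e_def)
  ultimately obtain d where d: "d > 0" "cball \<tau> d \<subseteq> (\<lambda>t. dist (g' t) (g t)) -` {e<..}"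
    using open_contains_cball by blast
  \<comment> \<open>The times at which the sequence is e / 4 Cauchy from index N on: closed sets,
    and pointwise convergence makes them cover the line.\<close>
  define A where "A N = {t. \<forall>n\<ge>N. \<forall>m\<ge>N. dist (G n t) (G m t) \<le> e / 4}" for N
  have "closed (A N)" for N
  proof -
    have "A N = (\<Inter>n\<in>{N..}. \<Inter>m\<in>{N..}. {t. dist (G n t) (G m t) \<le> e / 4})" by (auto simp: A_def)
    moreover have "closed {t. dist (G n t) (G m t) \<le> e / 4}" for n m
      by (intro closed_Collect_le continuous_intros G)
    ultimately show ?thesis by (auto intro!: closed_INT)
  qed
  have cover: "\<exists>N. t \<in> A N" for t
  proof -
    have "Cauchy (\<lambda>n. G n t)" using lim by (rule LIMSEQ_imp_Cauchy)
    then obtain N where "\<forall>m\<ge>N. \<forall>n\<ge>N. dist (G m t) (G n t) < e / 4"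
      using e unfolding Cauchy_def by (meson divide_pos_pos zero_less_numeral)
    then have "t \<in> A N" unfolding A_def by (simp add: less_imp_le)
    then show ?thesis ..
  qed
  \<comment> \<open>If each \<open>A N\<close> had dense complement in the ball, Baire would make
    the intersection of these complements dense, but it is empty. So some \<open>A N\<close>
    contains a ball.\<close>
  have "\<exists>N. \<not> cball \<tau> d \<subseteq> closure (cball \<tau> d - A N)"
  proof (rule ccontr)
    assume "\<nexists>N. \<not> cball \<tau> d \<subseteq> closure (cball \<tau> d - A N)"
    then have "cball \<tau> d \<subseteq> closure (\<Inter>(range (\<lambda>N. cball \<tau> d - A N)))"
      by (intro Baire) (auto simp: Diff_eq intro!: openin_open_Int \<open>\<And>N. closed (A N)\<close>)
    also have "\<Inter>(range (\<lambda>N. cball \<tau> d - A N)) = {}" using cover by auto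
    finally show False using d(1) by auto
  qed
  then obtain N t where t: "t \<in> cball \<tau> d" "t \<notin> closure (cball \<tau> d - A N)" by blast
  have "open (- closure (cball \<tau> d - A N))" by (simp only: open_Compl closed_closure)
  moreover have "t \<in> closure (ball \<tau> d)" using t(1) d(1) by simp
  ultimately obtain t1 where t1: "t1 \<in> ball \<tau> d" "t1 \<in> - closure (cball \<tau> d - A N)"
    using t(2) by (meson ComplI closure_iff_nhds_not_empty disjoint_iff order_refl)
  have "open (ball \<tau> d \<inter> - closure (cball \<tau> d - A N))" by auto
  then obtain \<rho> where \<rho>: "\<rho> > 0" "ball t1 \<rho> \<subseteq> ball \<tau> d \<inter> - closure (cball \<tau> d - A N)"
    using t1 open_contains_ball by blast
  have A: "s \<in> A N" if "s \<in> ball t1 \<rho>" for s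
    using that \<rho>(2) closure_subset[of "cball \<tau> d - A N"] ball_subset_cball[of \<tau> d] by blast
  have near: "dist (G n s) (g s) \<le> e / 4" if "s \<in> ball t1 \<rho>" "n \<ge> N" for s n
  proof (rule Lim_dist_ubound[OF _ lim[of s]])
    show "\<forall>\<^sub>F m in sequentially. dist (G n s) (G m s) \<le> e / 4"
      using A[OF that(1)] that(2) unfolding A_def eventually_sequentially by blast
  qed simp
  \<comment> \<open>For large n the points \<open>t1 + h n\<close> lie where \<open>G n\<close> is
    uniformly close to g, so the limit along the moving points inherits the closeness.\<close>
  have "(\<lambda>n. t1 + h n) \<longlonglongrightarrow> t1" using tendsto_add[OF tendsto_const h, of t1] by simp
  then have "(\<lambda>n. g (t1 + h n)) \<longlonglongrightarrow> g t1"
    using g by (intro continuous_on_tendsto_compose[OF g]) auto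
  then have "(\<lambda>n. dist (G n (t1 + h n)) (g (t1 + h n))) \<longlonglongrightarrow> dist (g' t1) (g t1)"
    by (intro tendsto_dist lim')
  moreover have "\<forall>\<^sub>F n in sequentially. dist (G n (t1 + h n)) (g (t1 + h n)) \<le> e / 4"
    using tendstoD[OF \<open>(\<lambda>n. t1 + h n) \<longlonglongrightarrow> t1\<close> \<rho>(1)] eventually_ge_at_top[of N]
    by eventually_elim (rule near, simp_all add: dist_commute)
  ultimately have "dist (g' t1) (g t1) \<le> e / 4"
    by (intro tendsto_upperbound) auto
  moreover have "t1 \<in> cball \<tau> d" using t1(1) by simp
  then have "dist (g' t1) (g t1) > e" using d(2) by blast
  ultimately show False using e by linarith
qed

text \<open>The movement of time is absorbed into the translations:
  \<open>s (n j) + (a j - t)\<close> is again a real sequence, so a subsequence of its translates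
  converges to some \<open>g'\<close>, uniformly over the compact set of moving parameters. That
  \<open>g'\<close> agrees with g at (t, x) is the category lemma.\<close>

lemma AA_limit_continuous_convergence:
  fixes f :: "real \<Rightarrow> 'x::metric_space \<Rightarrow> 'y::metric_space"
  assumes f: "f \<in> AAcUc" "\<And>t. continuous_on UNIV (f t)" and lim: "AA_limit f s g"
  shows "((\<lambda>(n, v). case v of (t, x) \<Rightarrow> f (t + s n) x) \<longlongrightarrow> (case z of (t, x) \<Rightarrow> g t x)) (sequentially \<times>\<^sub>F nhds z)"
proof (rule continuous_convergenceI)
  obtain t x where z: "z = (t, x)" by fastforce
  fix n :: "nat \<Rightarrow> nat" and v :: "nat \<Rightarrow> real \<times> 'x"
  assume n: "filterlim n at_top sequentially" and v: "v \<longlonglongrightarrow> z"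
  define a y where "a j = fst (v j)" and "y j = snd (v j)" for j
  have a: "a \<longlonglongrightarrow> t" and y: "y \<longlonglongrightarrow> x"
    using tendsto_fst[OF v] tendsto_snd[OF v] by (simp_all add: a_def[abs_def] y_def[abs_def] z)
  define s' where "s' j = s (n j) + (a j - t)" for j
  obtain k g' where k: "strict_mono k" and lim': "AA_limit f (s' \<circ> k) g'"
    using f(1) unfolding AAcUc_def by blast
  have sub: "filterlim (\<lambda>j. n (k j)) sequentially sequentially"
    using filterlim_compose[OF n filterlim_subseq[OF k]] .
  define K where "K = insert x (range (\<lambda>j. y (k j)))"
  have yk: "(\<lambda>j. y (k j)) \<longlonglongrightarrow> x" using LIMSEQ_subseq_LIMSEQ[OF y k] by (simp add: o_def)
  then have K: "compact K" unfolding K_def by (rule compact_insert_range_tendsto)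
  have unif: "uniform_limit K (\<lambda>j x. f (t + (s' \<circ> k) j) x) (\<lambda>x. g' t x) sequentially"
    using lim' K unfolding AA_limit_def by blast
  have "continuous_on K (g' t)"
    by (rule uniform_limit_theorem[OF _ unif])
      (auto intro: continuous_on_subset[OF f(2)] always_eventually)
  then have "(\<lambda>j. f (t + (s' \<circ> k) j) (y (k j))) \<longlonglongrightarrow> g' t x"
    by (rule uniform_limit_tendsto_compose[OF unif _ yk]) (auto simp: K_def)
  moreover have "g' t x = g t x"
  proof (rule pointwise_limit_translates_eq[where G="\<lambda>j \<tau>. f (\<tau> + s (n (k j))) x" and h="\<lambda>j. a (k j) - t" and \<tau>=t])
    show "continuous_on UNIV (\<lambda>\<tau>. f (\<tau> + s (n (k j))) x)" for j
      using f(1) by (auto simp: AAcUc_def intro!: continuous_on_compose2[where f="\<lambda>\<tau>. \<tau> + s (n (k j))"] continuous_intros)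
    show "(\<lambda>j. f (\<tau> + s (n (k j))) x) \<longlonglongrightarrow> g \<tau> x" for \<tau>
      using lim filterlim_compose[OF _ sub, of "\<lambda>n. f (\<tau> + s n) x"] unfolding AA_limit_def by blast
    show "continuous_on UNIV (\<lambda>\<tau>. g \<tau> x)" "continuous_on UNIV (\<lambda>\<tau>. g' \<tau> x)"
      using f(1) lim lim' unfolding AAcUc_def by blast+
    show "(\<lambda>j. a (k j) - t) \<longlonglongrightarrow> 0"
      using tendsto_diff[OF LIMSEQ_subseq_LIMSEQ[OF a k] tendsto_const[of t]] by (simp add: o_def)
    show "(\<lambda>j. f (\<tau> + (a (k j) - t) + s (n (k j))) x) \<longlonglongrightarrow> g' \<tau> x" for \<tau>
      using lim' unfolding AA_limit_def by (simp add: s'_def algebra_simps)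
  qed
  ultimately show "\<exists>r :: nat \<Rightarrow> nat. strict_mono r \<and>
      (\<lambda>j. case v (r j) of (t, x) \<Rightarrow> f (t + s (n (r j))) x) \<longlonglongrightarrow> (case z of (t, x) \<Rightarrow> g t x)"
    using k by (intro exI[of _ k]) (simp add: z s'_def a_def y_def case_prod_unfold algebra_simps)
qed

lemma AA_limit_continuous:
  fixes f :: "real \<Rightarrow> 'x::metric_space \<Rightarrow> 'y::metric_space"
  assumes "f \<in> AAcUc" "\<And>t. continuous_on UNIV (f t)" "AA_limit f s g"
  shows "continuous_on UNIV (\<lambda>(t, x). g t x)"
  by (rule continuous_convergence_imp_continuous[OF AA_limit_continuous_convergence[OF assms]])

text \<open>The forward argument cannot be repeated, as g is not known to be in
  \<open>AAcUc\<close>. Instead, translates of g are traded for translates of f: on the window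
  [-j, j] times K, the j-th translate of g is within 1 / (j + 1) of a translate of f, by uniform
  convergence on compact sets. Almost automorphy of f then yields a limit along a subsequence, and
  the category lemma identifies it with f.\<close>

lemma AA_limit_continuous_convergence_back:
  fixes f :: "real \<Rightarrow> 'x::metric_space \<Rightarrow> 'y::metric_space"
  assumes f: "f \<in> AAcUc" "\<And>t. continuous_on UNIV (f t)" and lim: "AA_limit f s g"
  shows "((\<lambda>(n, v). case v of (t, x) \<Rightarrow> g (t - s n) x) \<longlongrightarrow> (case z of (t, x) \<Rightarrow> f t x)) (sequentially \<times>\<^sub>F nhds z)"
proof (rule continuous_convergenceI)
  obtain t x where z: "z = (t, x)" by fastforce
  fix n :: "nat \<Rightarrow> nat" and v :: "nat \<Rightarrow> real \<times> 'x"
  assume n: "filterlim n at_top sequentially" and v: "v \<longlonglongrightarrow> z"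
  define a y where "a j = fst (v j)" and "y j = snd (v j)" for j
  have a: "a \<longlonglongrightarrow> t" and y: "y \<longlonglongrightarrow> x"
    using tendsto_fst[OF v] tendsto_snd[OF v] by (simp_all add: a_def[abs_def] y_def[abs_def] z)
  define K where "K = insert x (range y)"
  have K: "compact K" unfolding K_def by (rule compact_insert_range_tendsto[OF y])
  \<comment> \<open>The perturbed backward shift, normalised so that
    \<open>t + r j = a j - s (n j)\<close>.\<close>
  define r where "r j = a j - t - s (n j)" for j
  have "\<exists>m. \<forall>\<tau>\<in>{- real j..real j}. \<forall>x\<in>K. dist (f (\<tau> + (r j + s m)) x) (g (\<tau> + r j) x) < inverse (real (Suc j))" for j
  proof -
    define C where "C = {- real j + r j..real j + r j} \<times> K"
    have "uniform_limit C (\<lambda>n. \<lambda>(t, x). f (t + s n) x) (\<lambda>(t, x). g t x) sequentially"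
      unfolding C_def using K
      by (intro continuous_convergence_imp_uniform_limit[OF AA_limit_continuous_convergence[OF f lim]]) (auto intro: compact_Times)
    then have "\<forall>\<^sub>F m in sequentially. \<forall>v\<in>C. dist ((\<lambda>(t, x). f (t + s m) x) v) ((\<lambda>(t, x). g t x) v) < inverse (real (Suc j))"
      by (rule uniform_limitD) simp
    from eventually_happens'[OF sequentially_bot this]
    obtain m where m: "\<forall>v\<in>C. dist ((\<lambda>(t, x). f (t + s m) x) v) ((\<lambda>(t, x). g t x) v) < inverse (real (Suc j))" ..
    have "dist (f (\<tau> + (r j + s m)) x) (g (\<tau> + r j) x) < inverse (real (Suc j))"
      if "\<tau> \<in> {- real j..real j}" "x \<in> K" for \<tau> x
      using bspec[OF m, of "(\<tau> + r j, x)"] that by (simp add: C_def add.assoc)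
    then show ?thesis by blast
  qed
  then obtain m where m': "\<And>j. \<forall>\<tau>\<in>{- real j..real j}. \<forall>x\<in>K.
      dist (f (\<tau> + (r j + s (m j))) x) (g (\<tau> + r j) x) < inverse (real (Suc j))" by metis
  have m: "dist (f (\<tau> + (r j + s (m j))) x) (g (\<tau> + r j) x) < inverse (real (Suc j))"
    if "\<bar>\<tau>\<bar> \<le> real j" "x \<in> K" for j \<tau> x
    using m'[of j] that by (simp add: abs_le_iff)
  obtain k g' where k: "strict_mono k" and lim': "AA_limit f ((\<lambda>j. r j + s (m j)) \<circ> k) g'"
    using f(1) unfolding AAcUc_def by blast
  have sub: "filterlim (\<lambda>j. n (k j)) sequentially sequentially"
    using filterlim_compose[OF n filterlim_subseq[OF k]] .
  \<comment> \<open>Translates of f converge continuously, hence also along moving parameters w; the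
    replacement error vanishes because a fixed \<open>\<tau>\<close> eventually lies in every
    window.\<close>
  have conv: "(\<lambda>j. g (\<tau> + r (k j)) (w j)) \<longlonglongrightarrow> g' \<tau> x" if w: "w \<longlonglongrightarrow> x" "\<And>j. w j \<in> K" for \<tau> w
  proof -
    have "(\<lambda>j. case (\<tau>, w j) of (t, x) \<Rightarrow> f (t + ((\<lambda>j. r j + s (m j)) \<circ> k) j) x) \<longlonglongrightarrow> (case (\<tau>, x) of (t, x) \<Rightarrow> g' t x)"
      by (rule continuous_convergenceD[OF AA_limit_continuous_convergence[OF f lim'] filterlim_ident])
        (intro tendsto_intros w)
    then have 1: "(\<lambda>j. f (\<tau> + (r (k j) + s (m (k j)))) (w j)) \<longlonglongrightarrow> g' \<tau> x" by simp
    have "(\<lambda>j. dist (f (\<tau> + (r (k j) + s (m (k j)))) (w j)) (g (\<tau> + r (k j)) (w j))) \<longlonglongrightarrow> 0"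
    proof (rule tendsto_sandwich[OF _ _ tendsto_const LIMSEQ_subseq_LIMSEQ[OF LIMSEQ_inverse_real_of_nat k, unfolded o_def]])
      obtain j0 :: nat where j0: "\<bar>\<tau>\<bar> \<le> real j0" using real_arch_simple by blast
      show "\<forall>\<^sub>F j in sequentially. dist (f (\<tau> + (r (k j) + s (m (k j)))) (w j)) (g (\<tau> + r (k j)) (w j)) \<le> inverse (real (Suc (k j)))"
        using eventually_ge_at_top[of j0]
      proof eventually_elim
        case (elim j)
        have "\<bar>\<tau>\<bar> \<le> real (k j)" using j0 elim seq_suble[OF k, of j] by linarith
        then show ?case using m[OF _ w(2)] by (intro less_imp_le)
      qed
    qed auto
    then show ?thesis by (rule tendsto_dist_zero_transform[OF 1])
  qed
  have "(\<lambda>j. g (t + r (k j)) (y (k j))) \<longlonglongrightarrow> g' t x"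
    using LIMSEQ_subseq_LIMSEQ[OF y k] by (intro conv) (auto simp: K_def o_def)
  moreover have "g' t x = f t x"
  proof (rule pointwise_limit_translates_eq[where G="\<lambda>j \<tau>. g (\<tau> - s (n (k j))) x" and h="\<lambda>j. a (k j) - t" and \<tau>=t])
    have g: "continuous_on UNIV (\<lambda>\<tau>. g \<tau> x)"
      using f(1) lim unfolding AAcUc_def by blast
    show "continuous_on UNIV (\<lambda>\<tau>. f \<tau> x)" "continuous_on UNIV (\<lambda>\<tau>. g' \<tau> x)"
      using f(1) lim' unfolding AAcUc_def by blast+
    show "continuous_on UNIV (\<lambda>\<tau>. g (\<tau> - s (n (k j))) x)" for j
      by (rule continuous_on_compose2[OF g]) (auto intro: continuous_intros)
    show "(\<lambda>j. g (\<tau> - s (n (k j))) x) \<longlonglongrightarrow> f \<tau> x" for \<tau>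
      using lim filterlim_compose[OF _ sub, of "\<lambda>n. g (\<tau> - s n) x"] unfolding AA_limit_def by blast
    show "(\<lambda>j. a (k j) - t) \<longlonglongrightarrow> 0"
      using tendsto_diff[OF LIMSEQ_subseq_LIMSEQ[OF a k] tendsto_const[of t]] by (simp add: o_def)
    show "(\<lambda>j. g (\<tau> + (a (k j) - t) - s (n (k j))) x) \<longlonglongrightarrow> g' \<tau> x" for \<tau>
      using conv[of "\<lambda>_. x" \<tau>] by (simp add: K_def r_def algebra_simps)
  qed
  ultimately show "\<exists>r :: nat \<Rightarrow> nat. strict_mono r \<and>
      (\<lambda>j. case v (r j) of (t, x) \<Rightarrow> g (t - s (n (r j))) x) \<longlonglongrightarrow> (case z of (t, x) \<Rightarrow> f t x)"
    using k by (intro exI[of _ k]) (simp add: z r_def a_def y_def case_prod_unfold algebra_simps)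
qed

lemma continuous_convergence_shift:
  fixes F :: "nat \<Rightarrow> real \<Rightarrow> 'x::topological_space \<Rightarrow> 'y::topological_space"
  assumes conv: "\<And>z. ((\<lambda>(n, v). case v of (t, x) \<Rightarrow> F n t x) \<longlongrightarrow> (case z of (t, x) \<Rightarrow> G t x)) (sequentially \<times>\<^sub>F nhds z)"
  shows "((\<lambda>(n, v). case v of (r, x) \<Rightarrow> F n (t + r) x) \<longlongrightarrow> (case z of (r, x) \<Rightarrow> G (t + r) x)) (sequentially \<times>\<^sub>F nhds z)"
proof -
  obtain r x where z: "z = (r, x)" by fastforce
  have 1: "((\<lambda>p. (t + fst (snd p), snd (snd p))) \<longlongrightarrow> (t + fst z, snd z)) (sequentially \<times>\<^sub>F nhds z)"
    by (intro tendsto_intros filterlim_snd)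
  from continuous_convergenceD[OF conv[of "(t + r, x)"] filterlim_fst, of "\<lambda>p. (t + fst (snd p), snd (snd p))" "nhds z"] 1
  show ?thesis by (simp add: z case_prod_unfold)
qed

text \<open>The limit laws \<open>\<psi> t\<close> need not be the path laws of any process, so the
  limits for the superposition are built directly as image measures under the limit function g. A
  common subsequence serves both the laws and f.\<close>

theorem almost_automorphic_in_distr_compose:
  fixes X :: "real \<Rightarrow> 'w \<Rightarrow> 'x::{metric_space, second_countable_topology}"
    and f :: "real \<Rightarrow> 'x \<Rightarrow> 'y::{metric_space, second_countable_topology}"
  assumes M: "prob_space M" and X: "continuous_process M X"
    and f: "continuous_on UNIV (\<lambda>(t, x). f t x)"
    and AA: "almost_automorphic_in_distr M X" "f \<in> AAcUc"
  shows "almost_automorphic_in_distr M (\<lambda>t \<omega>. f t (X t \<omega>))"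
  unfolding almost_automorphic_in_distr_def almost_automorphic_def
proof (intro conjI allI)
  let ?\<phi> = "path_law M X" and ?\<psi> = "path_law M (\<lambda>t \<omega>. f t (X t \<omega>))"
  show "continuous_map euclidean narrow_topology ?\<psi>"
    by (rule continuous_map_path_law[OF M continuous_process_compose[OF X f]])
  have ft: "continuous_on UNIV (f t)" for t
    using continuous_on_compose2[OF f, of UNIV "\<lambda>x. (t, x)"] by (simp add: continuous_on_Pair)
  fix s :: "nat \<Rightarrow> real"
  obtain k \<psi> where k: "strict_mono k"
    and \<psi>: "\<And>t. limitin narrow_topology (\<lambda>n. ?\<phi> (t + s (k n))) (\<psi> t) sequentially"
      "\<And>t. limitin narrow_topology (\<lambda>n. \<psi> (t - s (k n))) (?\<phi> t) sequentially"
    using AA(1) unfolding almost_automorphic_in_distr_def almost_automorphic_def by blast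
  obtain q g where q: "strict_mono q" and g: "AA_limit f (s \<circ> k \<circ> q) g"
    using AA(2) unfolding AAcUc_def by blast
  let ?r = "\<lambda>n. s ((k \<circ> q) n)"
  have \<psi>q: "limitin narrow_topology (\<lambda>n. ?\<phi> (t + ?r n)) (\<psi> t) sequentially"
      "limitin narrow_topology (\<lambda>n. \<psi> (t - ?r n)) (?\<phi> t) sequentially" for t
    using limitin_subsequence[OF q \<psi>(1)[of t]] limitin_subsequence[OF q \<psi>(2)[of t]] by (simp_all add: o_def)
  have g': "AA_limit f ?r g" using g by (simp add: comp_def)
  have gc: "continuous_on UNIV (\<lambda>(t, x). g t x)" by (rule AA_limit_continuous[OF AA(2) ft g])
  have \<psi>P: "\<psi> t \<in> borel_prob_measures" for t using \<psi>(1)[of t] unfolding limitin_narrow_iff by blast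
  have \<phi>P: "?\<phi> t \<in> borel_prob_measures" for t by (rule path_law_borel_prob_measures[OF M X])
  define \<Psi> where "\<Psi> t = distr (\<psi> t) borel (compose_Ck (\<lambda>r. g (t + r)))" for t
  have "limitin narrow_topology (\<lambda>n. ?\<psi> (t + ?r n)) (\<Psi> t) sequentially" for t
    unfolding path_law_compose[OF X f] \<Psi>_def
  proof (rule limitin_narrow_distr[OF \<psi>q(1) \<phi>P measurable_compose_Ck[OF continuous_on_shift[OF f]]])
    have "((\<lambda>(n, v). case v of (r, x) \<Rightarrow> f (t + r + ?r n) x) \<longlongrightarrow> (case z of (r, x) \<Rightarrow> g (t + r) x)) (sequentially \<times>\<^sub>F nhds z)" for z
      by (rule continuous_convergence_shift[OF AA_limit_continuous_convergence[OF AA(2) ft g']])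
    moreover have eq: "t + r + ?r n = t + ?r n + r" for r n by simp
    ultimately show "((\<lambda>(n, v). compose_Ck (\<lambda>r. f (t + ?r n + r)) v) \<longlongrightarrow> compose_Ck (\<lambda>r. g (t + r)) u) (sequentially \<times>\<^sub>F nhds u)" for u
      by (intro compose_Ck_continuous_convergence continuous_on_shift f) (simp only: eq)
  qed
  moreover have "limitin narrow_topology (\<lambda>n. \<Psi> (t - ?r n)) (?\<psi> t) sequentially" for t
    unfolding path_law_compose[OF X f] \<Psi>_def
  proof (rule limitin_narrow_distr[OF \<psi>q(2) \<psi>P measurable_compose_Ck[OF continuous_on_shift[OF gc]]])
    have "((\<lambda>(n, v). case v of (r, x) \<Rightarrow> g (t + r - ?r n) x) \<longlongrightarrow> (case z of (r, x) \<Rightarrow> f (t + r) x)) (sequentially \<times>\<^sub>F nhds z)" for z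
      by (rule continuous_convergence_shift[OF AA_limit_continuous_convergence_back[OF AA(2) ft g']])
    moreover have eq: "t + r - ?r n = t - ?r n + r" for r n by simp
    ultimately show "((\<lambda>(n, v). compose_Ck (\<lambda>r. g (t - ?r n + r)) v) \<longlongrightarrow> compose_Ck (\<lambda>r. f (t + r)) u) (sequentially \<times>\<^sub>F nhds u)" for u
      by (intro compose_Ck_continuous_convergence continuous_on_shift gc) (simp only: eq)
  qed
  ultimately show "\<exists>k. strict_mono k \<and> (\<exists>\<psi>. \<forall>t.
      limitin narrow_topology (\<lambda>n. ?\<psi> (t + s (k n))) (\<psi> t) sequentially \<and>
      limitin narrow_topology (\<lambda>n. \<psi> (t - s (k n))) (?\<psi> t) sequentially)"
    using strict_mono_o[OF k q] by blast
qed

section \<open>Tightness\<close>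

lemma ex_dense_sequence:
  obtains a :: "nat \<Rightarrow> 'e::{metric_space, second_countable_topology}"
  where "\<And>x e. e > 0 \<Longrightarrow> \<exists>i. dist x (a i) < e"
proof -
  obtain D :: "'e set" where D: "countable D" "\<And>X. open X \<Longrightarrow> X \<noteq> {} \<Longrightarrow> \<exists>d\<in>D. d \<in> X"
    using countable_dense_setE by metis
  have "D \<noteq> {}" using D(2)[of UNIV] by auto
  then have r: "range (from_nat_into D) = D" by (rule range_from_nat_into[OF _ D(1)])
  show thesis
  proof (rule that)
    fix x :: 'e and e :: real assume "e > 0"
    then obtain d where "d \<in> D" "d \<in> ball x e" using D(2)[of "ball x e"] by auto
    then show "\<exists>i. dist x (from_nat_into D i) < e" using r by (metis mem_ball rangeE)
  qed
qed

text \<open>A Lipschitz substitute for the indicator of A: 1 on A and 0 from distance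
  \<open>\<delta>\<close> on. For empty A it is constantly 1, because \<open>infdist\<close> is then
  0 by convention.\<close>

definition bump :: "real \<Rightarrow> 'e::metric_space set \<Rightarrow> 'e \<Rightarrow> real" where
  "bump \<delta> A x = max 0 (1 - infdist x A / \<delta>)"

lemma bump_bounds: "0 \<le> bump \<delta> A x" "\<delta> > 0 \<Longrightarrow> bump \<delta> A x \<le> 1"
  by (auto simp: bump_def infdist_nonneg)

lemma bump_lipschitz:
  assumes "\<delta> > 0"
  shows "(1 / \<delta>)-lipschitz_on UNIV (bump \<delta> A)"
proof (rule lipschitz_onI)
  fix x y :: 'a
  have "\<bar>infdist x A - infdist y A\<bar> \<le> dist x y"
    using infdist_triangle_abs[of x A y] by simp
  moreover have "\<bar>bump \<delta> A x - bump \<delta> A y\<bar> \<le> \<bar>infdist x A - infdist y A\<bar> / \<delta>"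
  proof -
    have "\<bar>bump \<delta> A x - bump \<delta> A y\<bar> \<le> \<bar>infdist x A / \<delta> - infdist y A / \<delta>\<bar>"
      unfolding bump_def by (auto simp: max_def abs_if)
    also have "\<dots> = \<bar>infdist x A - infdist y A\<bar> / \<delta>"
      using assms by (simp add: diff_divide_distrib[symmetric])
    finally show ?thesis .
  qed
  ultimately show "dist (bump \<delta> A x) (bump \<delta> A y) \<le> 1 / \<delta> * dist x y"
    using assms by (simp add: dist_real_def) (smt (verit) divide_right_mono)
qed (use assms in simp)

lemma bump_measurable: "\<delta> > 0 \<Longrightarrow> bump \<delta> A \<in> borel_measurable borel"
  by (intro borel_measurable_continuous_onI lipschitz_on_continuous_on[OF bump_lipschitz])

lemma bump_le_indicator:
  assumes "\<delta> > 0" "A \<noteq> {}"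
  shows "bump \<delta> A x \<le> indicator (\<Union>a\<in>A. ball a \<delta>) x"
proof (cases "infdist x A < \<delta>")
  case True
  then obtain a where "a \<in> A" "dist x a < \<delta>"
    using assms(2) by (auto simp: infdist_def cINF_less_iff)
  then have "x \<in> (\<Union>a\<in>A. ball a \<delta>)" by (auto simp: dist_commute)
  then show ?thesis using bump_bounds(2)[OF assms(1), of A x] by simp
next
  case False
  then show ?thesis using assms(1) by (simp add: bump_def)
qed

lemma bump_dense_tendsto:
  assumes "\<delta> > 0" and a: "\<And>x e. e > 0 \<Longrightarrow> \<exists>i. dist x (a i) < e"
  shows "(\<lambda>m :: nat. bump \<delta> (a ` {..m}) x) \<longlonglongrightarrow> 1"
proof (rule LIMSEQ_I)
  fix e :: real assume "e > 0"
  then obtain i where i: "dist x (a i) < e * \<delta>" using a[of "e * \<delta>"] assms(1) by auto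
  have "norm (bump \<delta> (a ` {..m}) x - 1) < e" if "m \<ge> i" for m
  proof -
    have "infdist x (a ` {..m}) \<le> dist x (a i)" using that by (intro infdist_le) auto
    then have "infdist x (a ` {..m}) / \<delta> < e" using i assms(1) by (simp add: field_simps)
    moreover have "0 \<le> infdist x (a ` {..m}) / \<delta>" by (intro divide_nonneg_pos infdist_nonneg assms)
    ultimately show ?thesis by (auto simp: bump_def)
  qed
  then show "\<exists>no. \<forall>m\<ge>no. norm (bump \<delta> (a ` {..m}) x - 1) < e" by blast
qed

lemma bump_integral_tendsto:
  assumes N: "N \<in> borel_prob_measures" and "\<delta> > 0" and a: "\<And>x e. e > 0 \<Longrightarrow> \<exists>i. dist x (a i) < e"
  shows "(\<lambda>m :: nat. \<integral>x. bump \<delta> (a ` {..m}) x \<partial>N) \<longlonglongrightarrow> 1"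
proof -
  interpret prob_space N using borel_prob_measuresD(1)[OF N] .
  have "(\<lambda>m. \<integral>x. bump \<delta> (a ` {..m}) x \<partial>N) \<longlonglongrightarrow> (\<integral>x. 1 \<partial>N)"
    using bump_bounds assms(2)
    by (intro integral_dominated_convergence[where w="\<lambda>_. 1"] AE_I2 bump_dense_tendsto[OF assms(2) a]
        measurable_borel_prob_measures[OF N bump_measurable]) (auto simp: abs_of_nonneg[OF bump_bounds(1)])
  then show ?thesis by (simp add: prob_space)
qed

lemma bump_integral_le:
  assumes N: "N \<in> borel_prob_measures" and "\<delta> > 0" "A \<noteq> {}"
  shows "(\<integral>x. bump \<delta> A x \<partial>N) \<le> measure N (\<Union>a\<in>A. ball a \<delta>)"
proof -
  interpret prob_space N using borel_prob_measuresD(1)[OF N] .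
  have s: "(\<Union>a\<in>A. ball a \<delta>) \<in> sets N"
    unfolding borel_prob_measuresD(2)[OF N] by (intro borel_open) auto
  have "(\<integral>x. bump \<delta> A x \<partial>N) \<le> (\<integral>x. indicator (\<Union>a\<in>A. ball a \<delta>) x \<partial>N)"
    using bump_bounds[of \<delta> A] assms(2) s
    by (intro integral_mono integrable_borel_prob_measures[OF N bump_measurable, where B=1] bump_le_indicator assms)
      (auto simp: abs_of_nonneg[OF bump_bounds(1)] emeasure_eq_measure)
  then show ?thesis using s by simp
qed

text \<open>The direct half of Prokhorov's theorem. If no finite union of
  \<open>\<delta>\<close>-balls carried mass close to 1 for all measures at once, a limit of
  offending measures would keep all finite unions at mass 1 - e at most, although these unions
  exhaust the space.\<close>

lemma sequentially_compact_imp_tight: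
  fixes \<N> :: "'e::{complete_space, second_countable_topology} measure set"
  assumes P: "\<N> \<subseteq> borel_prob_measures"
    and seq: "\<And>N :: nat \<Rightarrow> 'e measure. (\<And>n. N n \<in> \<N>) \<Longrightarrow>
      \<exists>r L. strict_mono r \<and> limitin narrow_topology (\<lambda>n. N (r n)) L sequentially"
    and \<epsilon>: "0 < \<epsilon>"
  shows "\<exists>K. compact K \<and> (\<forall>N\<in>\<N>. measure N (- K) \<le> \<epsilon>)"
proof -
  obtain a :: "nat \<Rightarrow> 'e" where a: "\<And>x e. e > 0 \<Longrightarrow> \<exists>i. dist x (a i) < e"
    using ex_dense_sequence by blast
  have cover: "\<exists>m. \<forall>N\<in>\<N>. 1 - e < measure N (\<Union>i\<le>m. ball (a i) \<delta>)" if \<delta>: "\<delta> > 0" and e: "e > 0" for \<delta> e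
  proof (rule ccontr)
    assume "\<nexists>m. \<forall>N\<in>\<N>. 1 - e < measure N (\<Union>i\<le>m. ball (a i) \<delta>)"
    then have "\<forall>m. \<exists>N. N \<in> \<N> \<and> measure N (\<Union>i\<le>m. ball (a i) \<delta>) \<le> 1 - e" by (meson not_less)
    then obtain N where N: "\<And>m. N m \<in> \<N>" "\<And>m. measure (N m) (\<Union>i\<le>m. ball (a i) \<delta>) \<le> 1 - e" by metis
    obtain r L where r: "strict_mono r" "limitin narrow_topology (\<lambda>n. N (r n)) L sequentially"
      using seq[of N, OF N(1)] by blast
    have L: "L \<in> borel_prob_measures" using r(2) unfolding limitin_narrow_iff by blast
    \<comment> \<open>For n at least m the measure \<open>N (r n)\<close> is poor on an even larger
      union, so for fixed m the bound passes to the limit.\<close>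
    have "(\<integral>x. bump \<delta> (a ` {..m}) x \<partial>L) \<le> 1 - e" for m
    proof (rule tendsto_upperbound)
      have "bounded (range (bump \<delta> (a ` {..m})))"
        using bump_bounds[of \<delta> "a ` {..m}"] \<delta> by (auto intro!: boundedI[of _ 1])
      then show "(\<lambda>n. \<integral>x. bump \<delta> (a ` {..m}) x \<partial>N (r n)) \<longlonglongrightarrow> (\<integral>x. bump \<delta> (a ` {..m}) x \<partial>L)"
        using r(2) lipschitz_on_continuous_on[OF bump_lipschitz[OF \<delta>]] unfolding limitin_narrow_iff by blast
      show "\<forall>\<^sub>F n in sequentially. (\<integral>x. bump \<delta> (a ` {..m}) x \<partial>N (r n)) \<le> 1 - e"
        using eventually_ge_at_top[of m]
      proof eventually_elim
        case (elim n)
        have NP: "N (r n) \<in> borel_prob_measures" using N(1) P by blast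
        interpret prob_space "N (r n)" using borel_prob_measuresD(1)[OF NP] .
        have "m \<le> r n" using elim seq_suble[OF r(1), of n] by linarith
        have "(\<integral>x. bump \<delta> (a ` {..m}) x \<partial>N (r n)) \<le> measure (N (r n)) (\<Union>x\<in>a ` {..m}. ball x \<delta>)"
          by (rule bump_integral_le[OF NP \<delta>]) auto
        also have "\<dots> \<le> measure (N (r n)) (\<Union>i\<le>r n. ball (a i) \<delta>)"
        proof (rule finite_measure_mono)
          show "(\<Union>x\<in>a ` {..m}. ball x \<delta>) \<subseteq> (\<Union>i\<le>r n. ball (a i) \<delta>)"
            using \<open>m \<le> r n\<close> by fastforce
        qed (auto simp: borel_prob_measuresD(2)[OF NP])
        also have "\<dots> \<le> 1 - e" by (rule N(2))
        finally show ?case .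
      qed
    qed simp
    then have "1 \<le> 1 - e" by (intro LIMSEQ_le_const2[OF bump_integral_tendsto[OF L \<delta> a]]) auto
    then show False using e by simp
  qed
  have "\<exists>m. \<forall>N\<in>\<N>. 1 - \<epsilon> * (1 / 2) ^ Suc k < measure N (\<Union>i\<le>m. ball (a i) (1 / real (Suc k)))" for k
    using \<epsilon> by (intro cover) auto
  then obtain m where m: "\<And>k N. N \<in> \<N> \<Longrightarrow>
      1 - \<epsilon> * (1 / 2) ^ Suc k < measure N (\<Union>i\<le>m k. ball (a i) (1 / real (Suc k)))" by metis
  \<comment> \<open>Closed balls, so that K is closed and hence complete; total boundedness comes
    from the shrinking radii.\<close>
  define C where "C k = (\<Union>i\<le>m k. cball (a i) (1 / real (Suc k)))" for k
  have C: "closed (C k)" for k unfolding C_def by (intro closed_UN) auto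
  define K where "K = (\<Inter>k. C k)"
  have "closed K" unfolding K_def using C by auto
  have "compact K"
    unfolding compact_eq_totally_bounded
  proof (intro conjI allI impI complete_eq_closed[THEN iffD2] \<open>closed K\<close>)
    fix e :: real assume "e > 0"
    then obtain k where k: "1 / real (Suc k) < e" using reals_Archimedean by (auto simp: inverse_eq_divide)
    have "K \<subseteq> C k" unfolding K_def by blast
    also have "C k \<subseteq> (\<Union>x\<in>a ` {..m k}. ball x e)"
      unfolding C_def image_image using k by (intro UN_mono) auto
    finally have "K \<subseteq> (\<Union>x\<in>a ` {..m k}. ball x e)" .
    then show "\<exists>F. finite F \<and> K \<subseteq> (\<Union>x\<in>F. ball x e)" by (intro exI[of _ "a ` {..m k}"]) auto
  qed
  moreover have "measure N (- K) \<le> \<epsilon>" if "N \<in> \<N>" for N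
  proof -
    have NP: "N \<in> borel_prob_measures" using that P by blast
    interpret prob_space N using borel_prob_measuresD(1)[OF NP] .
    have s: "- C k \<in> sets N" "C k \<in> sets N" for k using C[of k] by (auto simp: borel_prob_measuresD(2)[OF NP])
    have Ck: "measure N (- C k) \<le> \<epsilon> * (1 / 2) ^ Suc k" for k
    proof -
      have "measure N (\<Union>i\<le>m k. ball (a i) (1 / real (Suc k))) \<le> measure N (C k)"
        using s by (intro finite_measure_mono) (auto simp: C_def)
      moreover have "measure N (- C k) = 1 - measure N (C k)"
        using prob_compl[OF s(2)[of k]] by (simp add: borel_prob_measuresD(3)[OF NP] Compl_eq_Diff_UNIV)
      ultimately show ?thesis using m[OF that, of k] by linarith
    qed
    have geo: "(\<lambda>k. \<epsilon> * (1 / 2) ^ Suc k) sums (\<epsilon> * 1)"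
      by (rule sums_mult[OF power_half_series])
    have sm: "summable (\<lambda>k. measure N (- C k))"
      by (rule summable_comparison_test[OF _ sums_summable[OF geo]]) (use Ck in auto)
    have "measure N (- K) = measure N (\<Union>k. - C k)" by (simp add: K_def)
    also have "\<dots> \<le> (\<Sum>k. measure N (- C k))"
      using s sm by (intro finite_measure_subadditive_countably) auto
    also have "\<dots> \<le> (\<Sum>k. \<epsilon> * (1 / 2) ^ Suc k)"
      by (rule suminf_le[OF Ck sm sums_summable[OF geo]])
    also have "\<dots> = \<epsilon> * 1" by (rule sums_unique[OF geo, symmetric])
    finally show ?thesis by simp
  qed
  ultimately show ?thesis by blast
qed

text \<open>The limits required at time 0 make the set of all path laws sequentially compact, hence
  tight on path space. Evaluation at 0 maps the compact set of paths to one compact set of states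
  that serves all times.\<close>

lemma almost_automorphic_in_distr_imp_tight:
  fixes Y :: "real \<Rightarrow> 'w \<Rightarrow> 'a::{complete_space, second_countable_topology}"
  assumes M: "prob_space M" and Y: "continuous_process M Y"
    and AA: "almost_automorphic_in_distr M Y" and \<epsilon>: "0 < \<epsilon>"
  shows "\<exists>K. compact K \<and> (\<forall>t. measure M {\<omega>\<in>space M. Y t \<omega> \<notin> K} \<le> \<epsilon>)"
proof -
  have "\<exists>r L. strict_mono r \<and> limitin narrow_topology (\<lambda>n. N (r n)) L sequentially"
    if N: "\<And>n. N n \<in> range (path_law M Y)" for N :: "nat \<Rightarrow> 'a Ck measure"
  proof -
    have "\<forall>n. \<exists>t. N n = path_law M Y t" using N by blast
    then obtain t where t: "\<And>n. N n = path_law M Y (t n)" by metis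
    obtain k \<psi> where k: "strict_mono k"
      and "\<And>u. limitin narrow_topology (\<lambda>n. path_law M Y (u + t (k n))) (\<psi> u) sequentially"
      using AA unfolding almost_automorphic_in_distr_def almost_automorphic_def by blast
    from this(2)[of 0] k show ?thesis by (auto simp: t)
  qed
  then obtain K where K: "compact K" "\<And>t. measure (path_law M Y t) (- K) \<le> \<epsilon>"
    using sequentially_compact_imp_tight[of "range (path_law M Y)" \<epsilon>] path_law_borel_prob_measures[OF M Y] \<epsilon>
    by (auto simp: image_subset_iff)
  interpret prob_space M by (rule M)
  have "measure M {\<omega>\<in>space M. Y t \<omega> \<notin> (\<lambda>u. Rep_Ck u 0) ` K} \<le> \<epsilon>" for t
  proof -
    have sK: "- K \<in> sets borel" using compact_imp_closed[OF K(1)] by auto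
    have "measure M {\<omega>\<in>space M. Y t \<omega> \<notin> (\<lambda>u. Rep_Ck u 0) ` K} \<le> measure M (shifted_path Y t -` (- K) \<inter> space M)"
    proof (rule finite_measure_mono)
      show "{\<omega>\<in>space M. Y t \<omega> \<notin> (\<lambda>u. Rep_Ck u 0) ` K} \<subseteq> shifted_path Y t -` (- K) \<inter> space M"
        using Rep_Ck_shifted_path[OF Y, of _ t 0] by (simp add: subset_eq image_iff) metis
      show "shifted_path Y t -` (- K) \<inter> space M \<in> sets M"
        by (rule measurable_sets[OF measurable_shifted_path[OF Y] sK])
    qed
    also have "\<dots> = measure (path_law M Y t) (- K)"
      unfolding path_law_def by (rule measure_distr[OF measurable_shifted_path[OF Y] sK, symmetric])
    also have "\<dots> \<le> \<epsilon>" by (rule K(2))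
    finally show ?thesis .
  qed
  then show ?thesis
    by (intro exI[of _ "(\<lambda>u. Rep_Ck u 0) ` K"]) (auto intro!: compact_continuous_image continuous_on_eval_Ck K(1))
qed

section \<open>Equicontinuity on compact sets\<close>

text \<open>Along the zero sequence f is its own limit, so joint continuity of limit functions
  applies to f itself.\<close>

lemma AAcUc_continuous:
  fixes f :: "real \<Rightarrow> 'x::metric_space \<Rightarrow> 'y::metric_space"
  assumes "f \<in> AAcUc" "\<And>t. continuous_on UNIV (f t)"
  shows "continuous_on UNIV (\<lambda>(t, x). f t x)"
  by (rule AA_limit_continuous[OF assms, of "\<lambda>_. 0"])
    (auto simp: AA_limit_def intro: uniform_limit_const)

text \<open>The times at which equicontinuity fails are taken as translations: by continuous
  convergence at time 0, the values at both of the merging points tend to the same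
  \<open>g 0 l\<close>.\<close>

lemma AAcUc_equicontinuous:
  fixes f :: "real \<Rightarrow> 'x::metric_space \<Rightarrow> 'y::metric_space"
  assumes f: "f \<in> AAcUc" "\<And>t. continuous_on UNIV (f t)" and K: "compact K" and e: "e > 0"
  shows "\<exists>\<eta>>0. \<forall>x\<in>K. \<forall>y\<in>K. dist x y \<le> \<eta> \<longrightarrow> (\<forall>t. dist (f t x) (f t y) \<le> e)"
proof (rule ccontr)
  assume neg: "\<not> ?thesis"
  have "\<exists>x y t. x \<in> K \<and> y \<in> K \<and> dist x y \<le> inverse (real (Suc n)) \<and> dist (f t x) (f t y) > e" for n
  proof -
    have pos: "inverse (real (Suc n)) > 0" by simp
    show ?thesis
      by (rule ccontr, rule notE[OF neg], intro exI[of _ "inverse (real (Suc n))"] conjI[OF pos]) (auto simp: not_less)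
  qed
  then obtain x y t where xyt: "\<And>n. x n \<in> K" "\<And>n. y n \<in> K" "\<And>n. dist (x n) (y n) \<le> inverse (real (Suc n))"
      "\<And>n. dist (f (t n) (x n)) (f (t n) (y n)) > e" by metis
  obtain l r where r: "l \<in> K" "strict_mono (r :: nat \<Rightarrow> nat)" "(x \<circ> r) \<longlonglongrightarrow> l"
    using K xyt(1) unfolding compact_def by metis
  obtain k g where k: "strict_mono k" and g: "AA_limit f ((t \<circ> r) \<circ> k) g"
    using f(1) unfolding AAcUc_def by blast
  have x: "(\<lambda>n. x (r (k n))) \<longlonglongrightarrow> l" using LIMSEQ_subseq_LIMSEQ[OF r(3) k] by (simp add: o_def)
  have "(\<lambda>n. dist (x n) (y n)) \<longlonglongrightarrow> 0"
    using xyt(3) by (intro tendsto_sandwich[OF _ _ tendsto_const LIMSEQ_inverse_real_of_nat]) (auto intro: always_eventually)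
  from LIMSEQ_subseq_LIMSEQ[OF this strict_mono_o[OF r(2) k]]
  have "(\<lambda>n. dist (x (r (k n))) (y (r (k n)))) \<longlonglongrightarrow> 0" by (simp add: o_def)
  then have y: "(\<lambda>n. y (r (k n))) \<longlonglongrightarrow> l" by (rule tendsto_dist_zero_transform[OF x])
  have lim: "(\<lambda>n. f (t (r (k n))) (w n)) \<longlonglongrightarrow> g 0 l" if "w \<longlonglongrightarrow> l" for w
    using continuous_convergenceD[OF AA_limit_continuous_convergence[OF f g, of "(0, l)"] filterlim_ident, of "\<lambda>n. (0, w n)"]
      tendsto_Pair[OF tendsto_const that, of 0] by simp
  have "(\<lambda>n. dist (f (t (r (k n))) (x (r (k n)))) (f (t (r (k n))) (y (r (k n))))) \<longlonglongrightarrow> dist (g 0 l) (g 0 l)"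
    by (intro tendsto_dist lim x y)
  then have "\<forall>\<^sub>F n in sequentially. dist (f (t (r (k n))) (x (r (k n)))) (f (t (r (k n))) (y (r (k n)))) < e"
    using e by (intro order_tendstoD(2)) auto
  then show False using xyt(4) by (auto simp: eventually_sequentially dest: less_asym)
qed

text \<open>Replaces a supremum over K by finitely many sections, so that means of sections are
  enough to control h uniformly on K.\<close>

lemma equicontinuous_finite_net:
  fixes h :: "real \<Rightarrow> 'x::metric_space \<Rightarrow> 'y::real_normed_vector"
  assumes K: "compact K" and \<eta>: "\<eta> > 0"
    and eq: "\<And>t x y. x \<in> K \<Longrightarrow> y \<in> K \<Longrightarrow> dist x y \<le> \<eta> \<Longrightarrow> norm (h t x - h t y) \<le> e"
  shows "\<exists>F. finite F \<and> (\<forall>t. \<forall>y\<in>K. norm (h t y) \<le> e + (\<Sum>x\<in>F. norm (h t x)))"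
proof -
  have "K \<subseteq> (\<Union>x\<in>K. ball x \<eta>)" using \<eta> by auto
  then obtain F where F: "F \<subseteq> K" "finite F" "K \<subseteq> (\<Union>x\<in>F. ball x \<eta>)"
    by (metis compactE_image[OF K] open_ball)
  have "norm (h t y) \<le> e + (\<Sum>x\<in>F. norm (h t x))" if y: "y \<in> K" for t y
  proof -
    obtain x where x: "x \<in> F" "dist x y < \<eta>" using F(3) y by auto
    have "norm (h t y) \<le> norm (h t y - h t x) + norm (h t x)" using norm_triangle_sub[of "h t y" "h t x"] by simp
    also have "norm (h t y - h t x) \<le> e" using x F(1) y by (intro eq) (auto simp: dist_commute)
    also have "norm (h t x) \<le> (\<Sum>x\<in>F. norm (h t x))" by (intro member_le_sum x(1) F(2)) auto
    finally show ?thesis by simp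
  qed
  then show ?thesis using F(2) by blast
qed

text \<open>The hypothesis compares points of one compact set, whereas \<open>y + z\<close> ranges
  over a neighbourhood of K, which is not compact in infinite dimension. But an offending sequence
  converges along a subsequence, and together with its limit and K it forms a compact set to which
  the hypothesis applies.\<close>

lemma compact_perturbation:
  fixes f :: "real \<Rightarrow> 'a::real_normed_vector \<Rightarrow> 'b::real_normed_vector"
  assumes uc: "\<And>\<epsilon> K. \<epsilon> > 0 \<Longrightarrow> compact K \<Longrightarrow>
      \<exists>\<eta>>0. \<forall>x\<in>K. \<forall>y\<in>K. norm (x - y) \<le> \<eta> \<longrightarrow> (\<forall>t. norm (f t x - f t y) \<le> \<epsilon>)"
    and K: "compact K" and e: "e > 0"
  shows "\<exists>\<delta>>0. \<forall>y\<in>K. \<forall>z. norm z \<le> \<delta> \<longrightarrow> (\<forall>t. norm (f t (y + z) - f t y) \<le> e)"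
proof (rule ccontr)
  assume neg: "\<not> ?thesis"
  have "\<exists>y z t. y \<in> K \<and> norm z \<le> inverse (real (Suc n)) \<and> norm (f t (y + z) - f t y) > e" for n
  proof -
    have pos: "inverse (real (Suc n)) > 0" by simp
    show ?thesis
      by (rule ccontr, rule notE[OF neg], intro exI[of _ "inverse (real (Suc n))"] conjI[OF pos]) (auto simp: not_less)
  qed
  then obtain y z t where yzt: "\<And>n. y n \<in> K" "\<And>n. norm (z n) \<le> inverse (real (Suc n))"
      "\<And>n. norm (f (t n) (y n + z n) - f (t n) (y n)) > e" by metis
  obtain l r where r: "l \<in> K" "strict_mono (r :: nat \<Rightarrow> nat)" "(y \<circ> r) \<longlonglongrightarrow> l"
    using K yzt(1) unfolding compact_def by metis
  have "z \<longlonglongrightarrow> 0"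
    using yzt(2) by (intro Lim_null_comparison[OF _ LIMSEQ_inverse_real_of_nat]) (auto intro: always_eventually)
  then have zr: "(z \<circ> r) \<longlonglongrightarrow> 0" by (rule LIMSEQ_subseq_LIMSEQ[OF _ r(2)])
  from tendsto_add[OF r(3) this] have "(\<lambda>n. y (r n) + z (r n)) \<longlonglongrightarrow> l" by (simp add: o_def)
  note uc[OF e compact_Un[OF K compact_insert_range_tendsto[OF this]]]
  then obtain \<eta> where \<eta>: "\<eta> > 0" and *: "\<forall>x\<in>K \<union> insert l (range (\<lambda>n. y (r n) + z (r n))).
      \<forall>x'\<in>K \<union> insert l (range (\<lambda>n. y (r n) + z (r n))). norm (x - x') \<le> \<eta> \<longrightarrow> (\<forall>t. norm (f t x - f t x') \<le> e)"
    by blast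
  have "\<forall>\<^sub>F n in sequentially. dist ((z \<circ> r) n) 0 < \<eta>" using zr \<eta> by (rule tendstoD)
  then obtain n where "norm (z (r n)) < \<eta>" by (auto simp: eventually_sequentially)
  then have "norm (f (t (r n)) (y (r n) + z (r n)) - f (t (r n)) (y (r n))) \<le> e"
    using *[rule_format, of "y (r n) + z (r n)" "y (r n)" "t (r n)"] yzt(1) by simp
  then show False using yzt(3)[of "r n"] by simp
qed

section \<open>Ergodic means\<close>

text \<open>Integrability belongs to the notion because the integral of a non-integrable function is
  0 by convention, and such means would not add up.\<close>

definition null_mean :: "real measure \<Rightarrow> (real \<Rightarrow> real) \<Rightarrow> bool" where
  "null_mean \<mu> v \<longleftrightarrow> (\<forall>r. set_integrable \<mu> {-r..r} v) \<and> (sym_mean \<mu> v \<longlongrightarrow> 0) at_top"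

lemma null_mean_add:
  assumes "null_mean \<mu> u" "null_mean \<mu> v"
  shows "null_mean \<mu> (\<lambda>t. u t + v t)"
proof -
  have "sym_mean \<mu> (\<lambda>t. u t + v t) = (\<lambda>r. sym_mean \<mu> u r + sym_mean \<mu> v r)"
    using assms by (auto simp: sym_mean_def null_mean_def set_integral_add algebra_simps)
  then show ?thesis
    using assms tendsto_add[of "sym_mean \<mu> u" 0 at_top "sym_mean \<mu> v" 0] by (auto simp: null_mean_def)
qed

lemma null_mean_mult:
  assumes "null_mean \<mu> u"
  shows "null_mean \<mu> (\<lambda>t. c * u t)"
proof -
  have "sym_mean \<mu> (\<lambda>t. c * u t) = (\<lambda>r. c * sym_mean \<mu> u r)"
    by (auto simp: sym_mean_def)
  then show ?thesis
    using assms tendsto_mult_left[of "sym_mean \<mu> u" 0 at_top c] by (auto simp: null_mean_def)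
qed

lemma null_mean_sum:
  assumes "finite F" "\<And>x. x \<in> F \<Longrightarrow> null_mean \<mu> (u x)"
  shows "null_mean \<mu> (\<lambda>t. \<Sum>x\<in>F. u x t)"
  using assms
proof (induction F)
  case empty
  have "sym_mean \<mu> (\<lambda>t. 0) = (\<lambda>_. 0)" by (auto simp: sym_mean_def)
  then show ?case by (simp add: null_mean_def set_integrable_def)
next
  case (insert x F)
  then show ?case using null_mean_add[of \<mu> "u x" "\<lambda>t. \<Sum>x\<in>F. u x t"] by simp
qed

locale averaging_measure =
  fixes \<mu> :: "real measure"
  assumes sets_mu: "sets \<mu> = sets borel"
    and infinite: "emeasure \<mu> UNIV = \<infinity>"
    and finite_interval: "is_interval I \<Longrightarrow> bounded I \<Longrightarrow> emeasure \<mu> I < \<infinity>"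
begin

lemma finite_cbox: "emeasure \<mu> {a..b} < \<infinity>"
  by (rule finite_interval) (auto simp: is_interval_cc)

text \<open>The measures of symmetric intervals increase to infinity. Before they become positive,
  division by 0 makes the mean 0 whatever the integrand is.\<close>

lemma eventually_measure_pos: "\<forall>\<^sub>F r in at_top. 0 < measure \<mu> {-r..r}"
proof -
  have "(\<lambda>n. emeasure \<mu> {- real n..real n}) \<longlonglongrightarrow> emeasure \<mu> (\<Union>n. {- real n..real n})"
    by (rule Lim_emeasure_incseq) (auto simp: sets_mu incseq_def)
  moreover have "(\<Union>n. {- real n..real n}) = (UNIV :: real set)"
  proof safe
    fix x :: real
    obtain n :: nat where "\<bar>x\<bar> \<le> real n" using real_arch_simple by blast
    then show "x \<in> (\<Union>n. {- real n..real n})" by (intro UN_I[of n]) auto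
  qed simp
  ultimately have "\<forall>\<^sub>F n in sequentially. 0 < emeasure \<mu> {- real n..real n}"
    using infinite by (intro order_tendstoD(1)[where y="emeasure \<mu> UNIV"]) auto
  then obtain n where n: "0 < emeasure \<mu> {- real n..real n}" by (auto simp: eventually_sequentially)
  show ?thesis
    using eventually_ge_at_top[of "real n"]
  proof eventually_elim
    case (elim r)
    have "0 < emeasure \<mu> {-r..r}"
      using n emeasure_mono[of "{- real n..real n}" "{-r..r}" \<mu>] elim by (auto simp: sets_mu)
    then show ?case
      using finite_cbox[of "-r" r] by (auto simp: measure_def enn2real_positive_iff)
  qed
qed

lemma set_integrable_bounded:
  fixes v :: "real \<Rightarrow> real"
  assumes "v \<in> borel_measurable borel" "\<And>t. t \<in> {-r..r} \<Longrightarrow> \<bar>v t\<bar> \<le> B"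
  shows "set_integrable \<mu> {-r..r} v"
  unfolding set_integrable_def
proof (rule integrableI_bounded_set[where A="{-r..r}" and B=B])
  show "{-r..r} \<in> sets \<mu>" by (simp add: sets_mu)
  have "v \<in> borel_measurable \<mu>" using assms(1) measurable_cong_sets[OF sets_mu] by blast
  then show "(\<lambda>x. indicator {-r..r} x *\<^sub>R v x) \<in> borel_measurable \<mu>"
    using \<open>{-r..r} \<in> sets \<mu>\<close> by measurable
qed (use assms(2) finite_cbox in \<open>auto simp: indicator_def\<close>)

lemma set_integrable_continuous:
  fixes v :: "real \<Rightarrow> real"
  assumes "continuous_on UNIV v"
  shows "set_integrable \<mu> {-r..r} v"
proof -
  have "bounded (v ` {-r..r})"
    by (intro compact_imp_bounded compact_continuous_image continuous_on_subset[OF assms]) auto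
  then obtain B where "\<forall>y\<in>v ` {-r..r}. norm y \<le> B" unfolding bounded_iff ..
  then show ?thesis
    using assms by (intro set_integrable_bounded[of v r B] borel_measurable_continuous_onI) auto
qed

text \<open>All ergodicity claims for the residual go through this criterion; the majorant v may
  change with \<open>\<epsilon>\<close>, as do the compact sets behind it.\<close>

lemma sym_mean_tendsto_0I:
  assumes u: "\<And>t. 0 \<le> u t"
    and bound: "\<And>\<epsilon>. \<epsilon> > 0 \<Longrightarrow> \<exists>v. null_mean \<mu> v \<and> (\<forall>t. u t \<le> \<epsilon> + v t)"
  shows "(sym_mean \<mu> u \<longlongrightarrow> 0) at_top"
proof (rule tendstoI)
  fix e :: real assume e: "e > 0"
  then obtain v where v: "null_mean \<mu> v" "\<And>t. u t \<le> e / 2 + v t" using bound[of "e / 2"] by auto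
  have "\<forall>\<^sub>F r in at_top. sym_mean \<mu> v r < e / 2"
    using v(1) e unfolding null_mean_def by (intro order_tendstoD(2)[of _ 0]) auto
  then show "\<forall>\<^sub>F r in at_top. dist (sym_mean \<mu> u r) 0 < e"
    using eventually_measure_pos
  proof eventually_elim
    case (elim r)
    have const: "set_integrable \<mu> {-r..r} (\<lambda>_. e / 2)" by (intro set_integrable_continuous continuous_intros)
    have int: "set_integrable \<mu> {-r..r} (\<lambda>t. e / 2 + v t)"
      using const v(1) by (intro set_integral_add) (auto simp: null_mean_def)
    \<comment> \<open>\<open>integral_mono'\<close> asks for integrability of the majorant only:
      were u not integrable, its integral would be 0, below that of the nonnegative
      majorant.\<close>
    have "(LINT t:{-r..r}|\<mu>. u t) \<le> (LINT t:{-r..r}|\<mu>. e / 2 + v t)"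
      using int u v(2) order_trans[OF u v(2)] unfolding set_lebesgue_integral_def set_integrable_def
      by (intro integral_mono') (auto simp: indicator_def)
    also have "\<dots> = measure \<mu> {-r..r} * (e / 2) + (LINT t:{-r..r}|\<mu>. v t)"
      using const v(1) finite_cbox[of "-r" r]
      by (subst set_integral_add) (auto simp: null_mean_def set_integral_const sets_mu)
    finally have "sym_mean \<mu> u r \<le> 1 / measure \<mu> {-r..r} * (measure \<mu> {-r..r} * (e / 2) + (LINT t:{-r..r}|\<mu>. v t))"
      unfolding sym_mean_def using elim(2) by (intro mult_left_mono) auto
    also have "\<dots> = e / 2 + sym_mean \<mu> v r"
      using elim(2) by (simp add: sym_mean_def field_simps)
    finally have "sym_mean \<mu> u r < e" using elim(1) by linarith
    moreover have "0 \<le> sym_mean \<mu> u r"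
      unfolding sym_mean_def set_lebesgue_integral_def
      using u by (intro mult_nonneg_nonneg Bochner_Integration.integral_nonneg) auto
    ultimately show ?case by simp
  qed
qed

lemma null_mean_EUc:
  assumes h: "h \<in> EUc \<mu>"
  shows "null_mean \<mu> (\<lambda>t. norm (h t x))"
proof -
  have "continuous_on UNIV (\<lambda>(t, x). h t x)" using h by (simp add: EUc_def)
  from continuous_on_compose2[OF this, of UNIV "\<lambda>t. (t, x)"]
  have "continuous_on UNIV (\<lambda>t. h t x)" by (simp add: continuous_on_Pair)
  then have "set_integrable \<mu> {-r..r} (\<lambda>t. norm (h t x))" for r
    by (intro set_integrable_continuous continuous_intros)
  moreover have "uniform_limit {x} (\<lambda>r x. sym_mean \<mu> (\<lambda>t. norm (h t x)) r) (\<lambda>_. 0) at_top"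
    using h compact_insert[OF compact_empty, of x] unfolding EUc_def by blast
  then have "(sym_mean \<mu> (\<lambda>t. norm (h t x)) \<longlongrightarrow> 0) at_top"
    by (rule tendsto_uniform_limitI) simp
  ultimately show ?thesis by (simp add: null_mean_def)
qed

end

section \<open>Uniform integrability\<close>

text \<open>The crude constant from \<open>x + y \<le> 2 * max x y\<close> serves exponents below
  and above 1 alike; it is applied with p and with 1 / p.\<close>

lemma powr_add_le:
  fixes x y p :: real
  assumes "0 \<le> x" "0 \<le> y" "0 < p"
  shows "(x + y) powr p \<le> 2 powr p * (x powr p + y powr p)"
proof -
  have "(x + y) powr p \<le> (2 * max x y) powr p"
    using assms by (intro powr_mono2) auto
  also have "\<dots> = 2 powr p * max x y powr p"
    using assms by (simp add: powr_mult)
  also have "\<dots> \<le> 2 powr p * (x powr p + y powr p)"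
    by (intro mult_left_mono) (auto simp: max_def)
  finally show ?thesis .
qed

lemma powr_inverse_powr:
  fixes x p :: real
  assumes "0 \<le> x" "p \<noteq> 0"
  shows "(x powr (1 / p)) powr p = x" "(x powr p) powr (1 / p) = x"
  using assms by (simp_all add: powr_powr)

lemma integrable_tail:
  fixes F :: "'w \<Rightarrow> real"
  assumes "integrable M F"
  shows "integrable M (\<lambda>\<omega>. \<bar>F \<omega>\<bar> * indicator {\<omega>. \<bar>F \<omega>\<bar> > c} \<omega>)"
proof (rule Bochner_Integration.integrable_bound[OF assms])
  have "(\<lambda>\<omega>. \<bar>F \<omega>\<bar> * indicator {\<omega>. \<bar>F \<omega>\<bar> > c} \<omega>) = (\<lambda>\<omega>. \<bar>F \<omega>\<bar> * indicator {c<..} \<bar>F \<omega>\<bar>)"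
    by (auto simp: indicator_def)
  then show "(\<lambda>\<omega>. \<bar>F \<omega>\<bar> * indicator {\<omega>. \<bar>F \<omega>\<bar> > c} \<omega>) \<in> borel_measurable M"
    using borel_measurable_integrable[OF assms] by simp
qed (auto simp: indicator_def)

context prob_space
begin

lemma uniformly_integrable_dominated:
  fixes F G :: "'i \<Rightarrow> 'a \<Rightarrow> real"
  assumes F: "uniformly_integrable M F" "\<And>i \<omega>. 0 \<le> F i \<omega>"
    and G: "\<And>i. G i \<in> borel_measurable M" "\<And>i \<omega>. \<bar>G i \<omega>\<bar> \<le> a + b * F i \<omega>"
    and ab: "0 \<le> a" "0 \<le> b"
  shows "uniformly_integrable M G"
  unfolding uniformly_integrable_def
proof (intro conjI allI impI)
  have Fi: "integrable M (F i)" for i using F(1) by (simp add: uniformly_integrable_def)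
  fix i
  have "integrable M (\<lambda>\<omega>. a + b * F i \<omega>)" using Fi by simp
  then show "integrable M (G i)"
    by (rule Bochner_Integration.integrable_bound) (use G F(2) ab in \<open>auto intro: order_trans\<close>)
next
  fix \<epsilon> :: real assume "\<epsilon> > 0"
  then have "\<epsilon> / (a + b + 1) > 0" using ab by simp
  then obtain c where c: "\<And>i. (\<integral>\<omega>. \<bar>F i \<omega>\<bar> * indicator {\<omega>. \<bar>F i \<omega>\<bar> > c} \<omega> \<partial>M) \<le> \<epsilon> / (a + b + 1)"
    using F(1) unfolding uniformly_integrable_def by blast
  have Fi: "integrable M (F i)" for i using F(1) by (simp add: uniformly_integrable_def)
  \<comment> \<open>Above the threshold \<open>a + b * max c 1\<close> one has F > max c 1, hence a
    is at most a F, and G is at most (a + b) F on the tail of F.\<close>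
  have pw: "\<bar>G i \<omega>\<bar> * indicator {\<omega>. \<bar>G i \<omega>\<bar> > a + b * max c 1} \<omega>
      \<le> (a + b) * (\<bar>F i \<omega>\<bar> * indicator {\<omega>. \<bar>F i \<omega>\<bar> > c} \<omega>)" for i \<omega>
  proof (cases "\<bar>G i \<omega>\<bar> > a + b * max c 1")
    case True
    then have "b * max c 1 < b * F i \<omega>" using G(2)[of i \<omega>] by linarith
    then have *: "max c 1 < F i \<omega>" using ab(2) by (simp add: mult_less_cancel_left)
    then have "a * 1 \<le> a * F i \<omega>" using ab(1) by (intro mult_left_mono) auto
    then have "\<bar>G i \<omega>\<bar> \<le> (a + b) * F i \<omega>" using G(2)[of i \<omega>] by (simp add: distrib_right)
    then show ?thesis using True * F(2)[of i \<omega>] by simp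
  next
    case False
    then show ?thesis using ab by simp
  qed
  have "(\<integral>\<omega>. \<bar>G i \<omega>\<bar> * indicator {\<omega>. \<bar>G i \<omega>\<bar> > a + b * max c 1} \<omega> \<partial>M) \<le> \<epsilon>" for i
  proof -
    have "(\<integral>\<omega>. \<bar>G i \<omega>\<bar> * indicator {\<omega>. \<bar>G i \<omega>\<bar> > a + b * max c 1} \<omega> \<partial>M)
        \<le> (\<integral>\<omega>. (a + b) * (\<bar>F i \<omega>\<bar> * indicator {\<omega>. \<bar>F i \<omega>\<bar> > c} \<omega>) \<partial>M)"
      using ab by (intro integral_mono' integrable_mult_right integrable_tail Fi pw) auto
    also have "\<dots> \<le> (a + b) * (\<epsilon> / (a + b + 1))"
      using mult_left_mono[OF c[of i], of "a + b"] ab by simp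
    also have "\<dots> \<le> \<epsilon>" using ab \<open>\<epsilon> > 0\<close> by (simp add: field_simps)
    finally show ?thesis .
  qed
  then show "\<exists>c. \<forall>i. (\<integral>\<omega>. \<bar>G i \<omega>\<bar> * indicator {\<omega>. \<bar>G i \<omega>\<bar> > c} \<omega> \<partial>M) \<le> \<epsilon>" by blast
qed

lemma uniformly_integrable_bounded:
  assumes F: "uniformly_integrable M F" "\<And>i \<omega>. 0 \<le> F i \<omega>"
  shows "\<exists>B. \<forall>i. (\<integral>\<omega>. F i \<omega> \<partial>M) \<le> B"
proof -
  obtain c where c: "\<And>i. (\<integral>\<omega>. \<bar>F i \<omega>\<bar> * indicator {\<omega>. \<bar>F i \<omega>\<bar> > c} \<omega> \<partial>M) \<le> 1"
    using F(1) unfolding uniformly_integrable_def by (meson zero_less_one)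
  have Fi: "integrable M (F i)" for i using F(1) by (simp add: uniformly_integrable_def)
  have "(\<integral>\<omega>. F i \<omega> \<partial>M) \<le> max c 0 + 1" for i
  proof -
    have "(\<integral>\<omega>. F i \<omega> \<partial>M) \<le> (\<integral>\<omega>. max c 0 + \<bar>F i \<omega>\<bar> * indicator {\<omega>. \<bar>F i \<omega>\<bar> > c} \<omega> \<partial>M)"
      using F(2) by (intro integral_mono Fi Bochner_Integration.integrable_add integrable_tail) (auto simp: indicator_def)
    also have "\<dots> = max c 0 + (\<integral>\<omega>. \<bar>F i \<omega>\<bar> * indicator {\<omega>. \<bar>F i \<omega>\<bar> > c} \<omega> \<partial>M)"
      by (subst Bochner_Integration.integral_add) (auto intro: integrable_tail Fi simp: prob_space)
    finally show ?thesis using c[of i] by linarith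
  qed
  then show ?thesis by blast
qed

lemma uniformly_integrable_small_sets:
  assumes F: "uniformly_integrable M F" "\<And>i \<omega>. 0 \<le> F i \<omega>" and e: "e > 0"
  shows "\<exists>\<delta>>0. \<forall>i. \<forall>A\<in>sets M. prob A \<le> \<delta> \<longrightarrow> (\<integral>\<omega>. F i \<omega> * indicator A \<omega> \<partial>M) \<le> e"
proof -
  obtain c where c: "\<And>i. (\<integral>\<omega>. \<bar>F i \<omega>\<bar> * indicator {\<omega>. \<bar>F i \<omega>\<bar> > c} \<omega> \<partial>M) \<le> e / 2"
    using F(1) e unfolding uniformly_integrable_def by (meson half_gt_zero)
  have Fi: "integrable M (F i)" for i using F(1) by (simp add: uniformly_integrable_def)
  \<comment> \<open>At height c the integral over A is at most \<open>max c 0 * prob A\<close> plus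
    a tail; the added 1 keeps the denominator positive.\<close>
  define \<delta> where "\<delta> = e / 2 / (max c 0 + 1)"
  have "(\<integral>\<omega>. F i \<omega> * indicator A \<omega> \<partial>M) \<le> e" if A: "A \<in> sets M" "prob A \<le> \<delta>" for i A
  proof -
    have iA: "integrable M (\<lambda>\<omega>. max c 0 * indicator A \<omega> :: real)"
      using A(1) by (auto intro!: integrable_mult_right simp: emeasure_eq_measure)
    have "(\<integral>\<omega>. F i \<omega> * indicator A \<omega> \<partial>M)
        \<le> (\<integral>\<omega>. max c 0 * indicator A \<omega> + \<bar>F i \<omega>\<bar> * indicator {\<omega>. \<bar>F i \<omega>\<bar> > c} \<omega> \<partial>M)"
      using F(2) by (intro integral_mono' Bochner_Integration.integrable_add integrable_tail Fi iA) (auto simp: indicator_def)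
    also have "\<dots> = max c 0 * prob A + (\<integral>\<omega>. \<bar>F i \<omega>\<bar> * indicator {\<omega>. \<bar>F i \<omega>\<bar> > c} \<omega> \<partial>M)"
      using A(1) by (subst Bochner_Integration.integral_add[OF iA integrable_tail[OF Fi]]) simp
    also have "max c 0 * prob A \<le> max c 0 * \<delta>" using A(2) by (intro mult_left_mono) auto
    also have "max c 0 * \<delta> \<le> e / 2" using e unfolding \<delta>_def by (simp add: field_simps max_def)
    finally show ?thesis using c[of i] by linarith
  qed
  moreover have "\<delta> > 0" using e unfolding \<delta>_def by (simp add: max_def)
  ultimately show ?thesis by blast
qed

text \<open>A Vitali theorem for three kinds of domination at once: V is fixed, U is uniformly
  integrable, R vanishes in mean. Truncation at V plus a constant leaves a dominated part, and the
  excess is at most a tail of U plus R.\<close>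

lemma vitali_dominated:
  fixes W U R :: "nat \<Rightarrow> 'a \<Rightarrow> real"
  assumes W: "\<And>n. W n \<in> borel_measurable M" "\<And>n \<omega>. 0 \<le> W n \<omega>"
    and lim: "\<And>\<omega>. \<omega> \<in> space M \<Longrightarrow> (\<lambda>n. W n \<omega>) \<longlonglongrightarrow> 0"
    and bound: "\<And>n \<omega>. \<omega> \<in> space M \<Longrightarrow> W n \<omega> \<le> V \<omega> + U n \<omega> + R n \<omega>"
    and V: "integrable M V" "\<And>\<omega>. 0 \<le> V \<omega>"
    and U: "uniformly_integrable M U" "\<And>n \<omega>. 0 \<le> U n \<omega>"
    and R: "\<And>n. integrable M (R n)" "\<And>n \<omega>. 0 \<le> R n \<omega>" "(\<lambda>n. \<integral>\<omega>. R n \<omega> \<partial>M) \<longlonglongrightarrow> 0"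
  shows "(\<lambda>n. \<integral>\<omega>. W n \<omega> \<partial>M) \<longlonglongrightarrow> 0"
proof (rule tendstoI)
  fix e :: real assume e: "e > 0"
  obtain c where c: "\<And>i. (\<integral>\<omega>. \<bar>U i \<omega>\<bar> * indicator {\<omega>. \<bar>U i \<omega>\<bar> > c} \<omega> \<partial>M) \<le> e / 3"
    using U(1) e unfolding uniformly_integrable_def by (meson divide_pos_pos zero_less_numeral)
  have Ui: "integrable M (U n)" for n using U(1) by (simp add: uniformly_integrable_def)
  define c0 where "c0 = max c 0"
  define T where "T n \<omega> = \<bar>U n \<omega>\<bar> * indicator {\<omega>. \<bar>U n \<omega>\<bar> > c} \<omega>" for n \<omega>
  have T: "integrable M (T n)" for n unfolding T_def by (rule integrable_tail[OF Ui])
  have Vc: "integrable M (\<lambda>\<omega>. V \<omega> + c0)" using V(1) by simp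
  have mint: "integrable M (\<lambda>\<omega>. min (W n \<omega>) (V \<omega> + c0))" for n
    using W borel_measurable_integrable[OF Vc] V(2)
    by (intro Bochner_Integration.integrable_bound[OF Vc]) (auto simp: c0_def abs_le_iff)
  have "(\<lambda>n. \<integral>\<omega>. min (W n \<omega>) (V \<omega> + c0) \<partial>M) \<longlonglongrightarrow> (\<integral>\<omega>. 0 \<partial>M)"
  proof (rule integral_dominated_convergence[OF _ _ Vc])
    show "(\<lambda>\<omega>. min (W n \<omega>) (V \<omega> + c0)) \<in> borel_measurable M" for n
      using mint by (rule borel_measurable_integrable)
    show "AE \<omega> in M. (\<lambda>n. min (W n \<omega>) (V \<omega> + c0)) \<longlonglongrightarrow> 0"
    proof (rule AE_I2)
      fix \<omega> assume "\<omega> \<in> space M"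
      from tendsto_min[OF lim[OF this] tendsto_const[of "V \<omega> + c0"]]
      show "(\<lambda>n. min (W n \<omega>) (V \<omega> + c0)) \<longlonglongrightarrow> 0"
        using V(2)[of \<omega>] by (simp add: c0_def min_def)
    qed
    show "AE \<omega> in M. norm (min (W n \<omega>) (V \<omega> + c0)) \<le> V \<omega> + c0" for n
      using W(2) V(2) by (auto simp: c0_def)
  qed simp
  then have "\<forall>\<^sub>F n in sequentially. (\<integral>\<omega>. min (W n \<omega>) (V \<omega> + c0) \<partial>M) < e / 3"
    using e by (intro order_tendstoD(2)[of _ 0]) auto
  moreover have "\<forall>\<^sub>F n in sequentially. (\<integral>\<omega>. R n \<omega> \<partial>M) < e / 3"
    using e by (intro order_tendstoD(2)[OF R(3)]) auto
  ultimately show "\<forall>\<^sub>F n in sequentially. dist (\<integral>\<omega>. W n \<omega> \<partial>M) 0 < e"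
  proof eventually_elim
    case (elim n)
    have pw: "W n \<omega> \<le> min (W n \<omega>) (V \<omega> + c0) + T n \<omega> + R n \<omega>" if "\<omega> \<in> space M" for \<omega>
      using bound[OF that, of n] V(2)[of \<omega>] U(2)[of n \<omega>] R(2)[of n \<omega>] W(2)[of n \<omega>]
      by (auto simp: T_def c0_def indicator_def min_def max_def)
    have "(\<integral>\<omega>. W n \<omega> \<partial>M) \<le> (\<integral>\<omega>. min (W n \<omega>) (V \<omega> + c0) + T n \<omega> + R n \<omega> \<partial>M)"
      using W(2) R(2) V(2) pw
      by (intro integral_mono' Bochner_Integration.integrable_add mint T R(1))
        (auto simp: T_def c0_def intro!: add_nonneg_nonneg)
    also have "\<dots> = (\<integral>\<omega>. min (W n \<omega>) (V \<omega> + c0) \<partial>M) + (\<integral>\<omega>. T n \<omega> \<partial>M) + (\<integral>\<omega>. R n \<omega> \<partial>M)"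
      by (simp add: mint T R(1))
    also have "\<dots> < e / 3 + e / 3 + e / 3"
      using elim c[of n] unfolding T_def by linarith
    finally have "(\<integral>\<omega>. W n \<omega> \<partial>M) < e" by simp
    moreover have "0 \<le> (\<integral>\<omega>. W n \<omega> \<partial>M)" using W(2) by (intro Bochner_Integration.integral_nonneg) auto
    ultimately show ?case by simp
  qed
qed

end

section \<open>Superposition of pseudo almost automorphic processes\<close>

lemma continuous_process_tendsto:
  assumes "continuous_process M X" "\<omega> \<in> space M" "r \<longlonglongrightarrow> t"
  shows "(\<lambda>n. X (r n) \<omega>) \<longlonglongrightarrow> X t \<omega>"
  using assms by (auto simp: continuous_process_def intro: continuous_on_tendsto_compose[of UNIV "\<lambda>t. X t \<omega>"])

locale superposition = averaging_measure \<mu> + prob_space M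
  for \<mu> :: "real measure" and M :: "'w measure" +
  fixes f g h :: "real \<Rightarrow> 'a::{banach, second_countable_topology} \<Rightarrow> 'b::{banach, second_countable_topology}"
    and X Y Z :: "real \<Rightarrow> 'w \<Rightarrow> 'a"
  assumes f: "continuous_on UNIV (\<lambda>(t, x). f t x)" and fgh: "\<And>t x. f t x = g t x + h t x"
    and g: "g \<in> AAcUc" "\<And>t. continuous_on UNIV (g t)" and h: "h \<in> EUc \<mu>"
    and uc: "\<And>\<epsilon> K. \<epsilon> > 0 \<Longrightarrow> compact K \<Longrightarrow>
      \<exists>\<eta>>0. \<forall>x\<in>K. \<forall>y\<in>K. norm (x - y) \<le> \<eta> \<longrightarrow> (\<forall>t. norm (f t x - f t y) \<le> \<epsilon>)"
    and X: "continuous_process M X" and Y: "continuous_process M Y"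
    and XYZ: "\<And>t \<omega>. \<omega> \<in> space M \<Longrightarrow> X t \<omega> = Y t \<omega> + Z t \<omega>"
    and AA: "almost_automorphic_in_distr M Y"
    and Z_meas: "\<And>t. Z t \<in> borel_measurable M"
begin

definition residual :: "real \<Rightarrow> 'w \<Rightarrow> 'b" where
  "residual t \<omega> = f t (X t \<omega>) - g t (Y t \<omega>)"

lemma residual_eq: "residual t \<omega> = (f t (X t \<omega>) - f t (Y t \<omega>)) + h t (Y t \<omega>)"
  by (simp add: residual_def fgh)

lemma g_continuous: "continuous_on UNIV (\<lambda>(t, x). g t x)"
  by (rule AAcUc_continuous[OF g])

lemma fX: "continuous_process M (\<lambda>t \<omega>. f t (X t \<omega>))" and fY: "continuous_process M (\<lambda>t \<omega>. f t (Y t \<omega>))"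
  and gY: "continuous_process M (\<lambda>t \<omega>. g t (Y t \<omega>))"
  by (rule continuous_process_compose[OF X f], rule continuous_process_compose[OF Y f],
      rule continuous_process_compose[OF Y g_continuous])

lemma measurable_processes [measurable]:
  "(\<lambda>\<omega>. f t (X t \<omega>)) \<in> borel_measurable M" "(\<lambda>\<omega>. f t (Y t \<omega>)) \<in> borel_measurable M"
  "(\<lambda>\<omega>. g t (Y t \<omega>)) \<in> borel_measurable M" "(\<lambda>\<omega>. Y t \<omega>) \<in> borel_measurable M" "(\<lambda>\<omega>. Z t \<omega>) \<in> borel_measurable M"
  using fX fY gY Y Z_meas by (auto simp: continuous_process_def)

lemma measurable_residual [measurable]: "(\<lambda>\<omega>. residual t \<omega>) \<in> borel_measurable M"
  unfolding residual_def by measurable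

lemma measurable_hY [measurable]: "(\<lambda>\<omega>. h t (Y t \<omega>)) \<in> borel_measurable M"
proof -
  have "(\<lambda>\<omega>. f t (Y t \<omega>) - g t (Y t \<omega>)) \<in> borel_measurable M" by measurable
  then show ?thesis by (simp add: fgh)
qed

lemma residual_tendsto: "\<omega> \<in> space M \<Longrightarrow> r \<longlonglongrightarrow> t \<Longrightarrow> (\<lambda>n. residual (r n) \<omega>) \<longlonglongrightarrow> residual t \<omega>"
  unfolding residual_def
  by (intro tendsto_diff continuous_process_tendsto[OF fX] continuous_process_tendsto[OF gY])

lemma Z_tendsto:
  assumes "\<omega> \<in> space M" "r \<longlonglongrightarrow> t"
  shows "(\<lambda>n. Z (r n) \<omega>) \<longlonglongrightarrow> Z t \<omega>"
proof -
  have "Z t \<omega> = X t \<omega> - Y t \<omega>" for t using XYZ[OF assms(1), of t] by simp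
  then show ?thesis
    using tendsto_diff[OF continuous_process_tendsto[OF X assms] continuous_process_tendsto[OF Y assms]] by simp
qed

lemma escape_sets [measurable]: "compact K \<Longrightarrow> {\<omega>\<in>space M. Y t \<omega> \<notin> K} \<in> sets M"
proof -
  assume "compact K"
  then have K: "K \<in> sets borel" by (intro borel_closed compact_imp_closed)
  have "{\<omega>\<in>space M. Y t \<omega> \<notin> K} = (\<lambda>\<omega>. Y t \<omega>) -` (- K) \<inter> space M" by auto
  then show ?thesis using measurable_sets[OF measurable_processes(4), of "- K" t] K by auto
qed

text \<open>On K the function h is equicontinuous in x uniformly in t, being a difference: f is so
  by hypothesis and g by almost automorphy, each with e / 2.\<close>

lemma h_majorant:
  assumes K: "compact K" and e: "e > 0"
  shows "\<exists>v. null_mean \<mu> v \<and> (\<forall>t. 0 \<le> v t) \<and> (\<forall>t. \<forall>y\<in>K. norm (h t y) \<le> e + v t)"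
proof -
  have "e / 2 > 0" using e by simp
  obtain \<eta> where \<eta>: "\<eta> > 0" "\<forall>x\<in>K. \<forall>y\<in>K. dist x y \<le> \<eta> \<longrightarrow> (\<forall>t. dist (g t x) (g t y) \<le> e / 2)"
    using AAcUc_equicontinuous[OF g K \<open>e / 2 > 0\<close>] by blast
  obtain \<eta>' where \<eta>': "\<eta>' > 0" "\<forall>x\<in>K. \<forall>y\<in>K. norm (x - y) \<le> \<eta>' \<longrightarrow> (\<forall>t. norm (f t x - f t y) \<le> e / 2)"
    using uc[OF \<open>e / 2 > 0\<close> K] by blast
  have "norm (h t x - h t y) \<le> e" if "x \<in> K" "y \<in> K" "dist x y \<le> min \<eta> \<eta>'" for t x y
  proof -
    have "norm (g t x - g t y) \<le> e / 2" "norm (f t x - f t y) \<le> e / 2"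
      using \<eta>(2) \<eta>'(2) that by (auto simp: dist_norm)
    moreover have "h t x - h t y = (f t x - f t y) - (g t x - g t y)" by (simp add: fgh)
    ultimately show ?thesis using norm_triangle_ineq4[of "f t x - f t y" "g t x - g t y"] by simp
  qed
  then obtain F where F: "finite F" "\<forall>t. \<forall>y\<in>K. norm (h t y) \<le> e + (\<Sum>x\<in>F. norm (h t x))"
    using equicontinuous_finite_net[OF K, of "min \<eta> \<eta>'" h e] \<eta>(1) \<eta>'(1) by auto
  then show ?thesis
    by (intro exI[of _ "\<lambda>t. \<Sum>x\<in>F. norm (h t x)"])
      (auto intro!: null_mean_sum null_mean_EUc[OF h] sum_nonneg)
qed

section \<open>Ergodicity of the residual in probability (p = 0)\<close>

lemma residual_ergodic_0:
  assumes Z: "Z \<in> ergodic_Lp 0 M \<mu>"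
  shows "residual \<in> ergodic_Lp 0 M \<mu>"
proof -
  define z where "z t = (\<integral>\<omega>. min (norm (Z t \<omega>)) 1 \<partial>M)" for t
  have zint: "integrable M (\<lambda>\<omega>. min (norm (Z t \<omega>)) 1)" for t
    by (intro integrable_const_bound[where B=1]) auto
  have zb: "0 \<le> z t" "z t \<le> 1" for t
  proof -
    show "0 \<le> z t" unfolding z_def by (intro Bochner_Integration.integral_nonneg) auto
    have "z t \<le> (\<integral>\<omega>. 1 \<partial>M)" unfolding z_def by (intro integral_mono zint) auto
    then show "z t \<le> 1" by (simp add: prob_space)
  qed
  have z: "null_mean \<mu> z"
  proof -
    have "z \<in> borel_measurable \<mu>" using Z unfolding ergodic_Lp_def z_def[abs_def] by simp
    then have "z \<in> borel_measurable borel" using measurable_cong_sets[OF sets_mu] by blast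
    then have "set_integrable \<mu> {-r..r} z" for r using zb by (intro set_integrable_bounded[where B=1]) auto
    then show ?thesis using Z unfolding ergodic_Lp_def null_mean_def z_def[abs_def] by simp
  qed
  define u where "u t = (\<integral>\<omega>. min (norm (residual t \<omega>)) 1 \<partial>M)" for t
  have "\<exists>v. null_mean \<mu> v \<and> (\<forall>t. u t \<le> \<epsilon> + v t)" if \<epsilon>: "\<epsilon> > 0" for \<epsilon>
  proof -
    have e4: "\<epsilon> / 4 > 0" using \<epsilon> by simp
    obtain K where K: "compact K" "\<And>t. prob {\<omega>\<in>space M. Y t \<omega> \<notin> K} \<le> \<epsilon> / 4"
      using almost_automorphic_in_distr_imp_tight[OF prob_space_axioms Y AA e4] by blast
    obtain v where v: "null_mean \<mu> v" "\<And>t. 0 \<le> v t" "\<And>t y. y \<in> K \<Longrightarrow> norm (h t y) \<le> \<epsilon> / 4 + v t"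
      using h_majorant[OF K(1) e4] by blast
    obtain \<delta> where \<delta>: "\<delta> > 0" "\<forall>y\<in>K. \<forall>z. norm z \<le> \<delta> \<longrightarrow> (\<forall>t. norm (f t (y + z) - f t y) \<le> \<epsilon> / 4)"
      using compact_perturbation[OF uc K(1) e4] by blast
    \<comment> \<open>Capped at 1 because only \<open>min (norm (Z t \<omega>)) 1\<close> has a mean
      here: when the norm exceeds \<open>\<delta>\<close>, this minimum is still at least d.\<close>
    define d where "d = min \<delta> 1"
    have d: "d > 0" "d \<le> \<delta>" "d \<le> 1" using \<delta>(1) by (auto simp: d_def)
    have "u t \<le> \<epsilon> + (v t + 1 / d * z t)" for t
    proof -
      let ?E = "{\<omega>\<in>space M. Y t \<omega> \<notin> K}"
      have E: "?E \<in> sets M" by (rule escape_sets[OF K(1)])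
      \<comment> \<open>Three cases: Y outside K is paid by the indicator; Y in K and small Z by two
        terms \<open>\<epsilon> / 4\<close> and v; large Z by the last term, as in Markov's
        inequality.\<close>
      have pw: "min (norm (residual t \<omega>)) 1 \<le> (\<epsilon> / 2 + v t) + indicator ?E \<omega> + 1 / d * min (norm (Z t \<omega>)) 1"
        if \<omega>: "\<omega> \<in> space M" for \<omega>
      proof (cases "Y t \<omega> \<in> K")
        case False
        then have "indicator ?E \<omega> = (1::real)" using \<omega> by simp
        moreover have "0 \<le> 1 / d * min (norm (Z t \<omega>)) 1" using d(1) by simp
        ultimately show ?thesis using \<epsilon> v(2)[of t] by linarith
      next
        case True
        show ?thesis
        proof (cases "norm (Z t \<omega>) \<le> \<delta>")
          case small: True
          have "norm (f t (X t \<omega>) - f t (Y t \<omega>)) \<le> \<epsilon> / 4"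
            using \<delta>(2) True small XYZ[OF \<omega>, of t] by simp
          moreover have "norm (h t (Y t \<omega>)) \<le> \<epsilon> / 4 + v t" using v(3)[OF True] .
          moreover have "norm (residual t \<omega>) \<le> norm (f t (X t \<omega>) - f t (Y t \<omega>)) + norm (h t (Y t \<omega>))"
            unfolding residual_eq by (rule norm_triangle_ineq)
          moreover have "0 \<le> 1 / d * min (norm (Z t \<omega>)) 1" using d(1) by simp
          ultimately show ?thesis using True by (simp add: min_le_iff_disj)
        next
          case False
          then have "1 \<le> 1 / d * min (norm (Z t \<omega>)) 1" using d by (simp add: field_simps)
          then show ?thesis using \<epsilon> v(2)[of t] by (auto simp: indicator_def min_le_iff_disj)
        qed
      qed
      have iE: "integrable M (indicator ?E :: _ \<Rightarrow> real)" using E by (simp add: emeasure_eq_measure)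
      have "u t \<le> (\<integral>\<omega>. (\<epsilon> / 2 + v t) + indicator ?E \<omega> + 1 / d * min (norm (Z t \<omega>)) 1 \<partial>M)"
        unfolding u_def
      proof (rule integral_mono[OF _ _ pw])
        show "integrable M (\<lambda>\<omega>. min (norm (residual t \<omega>)) 1)"
          by (rule integrable_const_bound[where B=1]) auto
        show "integrable M (\<lambda>\<omega>. (\<epsilon> / 2 + v t) + indicator ?E \<omega> + 1 / d * min (norm (Z t \<omega>)) 1)"
          by (intro Bochner_Integration.integrable_add integrable_mult_right zint iE integrable_const)
      qed
      also have "\<dots> = (\<epsilon> / 2 + v t) + prob ?E + 1 / d * z t"
        using E zint[of t] iE by (simp add: z_def prob_space)
      also have "\<dots> \<le> \<epsilon> + (v t + 1 / d * z t)" using K(2)[of t] \<epsilon> by linarith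
      finally show ?thesis .
    qed
    then show ?thesis
      using null_mean_add[OF v(1) null_mean_mult[OF z, of "1 / d"]] by blast
  qed
  then have "(sym_mean \<mu> u \<longlongrightarrow> 0) at_top"
    by (rule sym_mean_tendsto_0I[rotated]) (auto simp: u_def intro!: Bochner_Integration.integral_nonneg)
  \<comment> \<open>Continuity supplies the measurability clause of \<open>ergodic_Lp\<close> at p =
    0.\<close>
  moreover have "continuous_on UNIV u"
  proof (rule continuous_on_sequentiallyI)
    fix r :: "nat \<Rightarrow> real" and t assume r: "r \<longlonglongrightarrow> t"
    show "(\<lambda>n. u (r n)) \<longlonglongrightarrow> u t"
      unfolding u_def
      by (rule integral_dominated_convergence[where w="\<lambda>_. 1"])
        (auto intro!: AE_I2 tendsto_min tendsto_norm residual_tendsto r)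
  qed
  then have "u \<in> borel_measurable \<mu>"
    using borel_measurable_continuous_onI measurable_cong_sets[OF sets_mu] by blast
  ultimately show ?thesis unfolding ergodic_Lp_def u_def[abs_def] by simp
qed

section \<open>Ergodicity of the residual in p-th mean (p > 0)\<close>

context
  fixes p C L :: real
  assumes p: "p > 0" and growth: "\<And>t x. norm (f t x) + norm (g t x) \<le> C * (1 + norm x)"
    and lipschitz: "\<And>t. L-lipschitz_on UNIV (f t)"
    and UI: "uniformly_integrable M (\<lambda>t \<omega>. norm (Y t \<omega>) powr p)"
    and Z: "Z \<in> ergodic_Lp p M \<mu>"
begin

text \<open>Up to the factor \<open>C powr p\<close>, the p-th power of the growth bound along Y; it
  inherits uniform integrability from Y.\<close>

definition weight :: "real \<Rightarrow> 'w \<Rightarrow> real" where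
  "weight t \<omega> = (1 + norm (Y t \<omega>)) powr p"

lemma C_nonneg: "0 \<le> C"
proof -
  have "0 \<le> norm (f 0 0) + norm (g 0 0)" by simp
  also have "\<dots> \<le> C * (1 + norm (0::'a))" by (rule growth)
  finally show ?thesis by simp
qed

lemma weight_nonneg: "0 \<le> weight t \<omega>"
  by (simp add: weight_def)

lemma UI_weight: "uniformly_integrable M weight"
proof (rule uniformly_integrable_dominated[OF UI, of weight "2 powr p" "2 powr p"])
  show "\<bar>weight t \<omega>\<bar> \<le> 2 powr p + 2 powr p * norm (Y t \<omega>) powr p" for t \<omega>
    using powr_add_le[of 1 "norm (Y t \<omega>)" p] p by (simp add: weight_def algebra_simps)
  show "weight t \<in> borel_measurable M" for t
    unfolding weight_def[abs_def] by measurable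
qed auto

lemma weight_integrable: "integrable M (weight t)"
  using UI_weight by (simp add: uniformly_integrable_def)

lemma Z_integrable: "integrable M (\<lambda>\<omega>. norm (Z t \<omega>) powr p)"
  using Z p by (simp add: ergodic_Lp_def Lp_def)

lemma residual_bound:
  assumes "\<omega> \<in> space M"
  shows "norm (residual t \<omega>) powr p \<le> ((2 * C) powr p * 2 powr p) * (weight t \<omega> + norm (Z t \<omega>) powr p)"
proof -
  have "norm (residual t \<omega>) \<le> norm (f t (X t \<omega>)) + norm (g t (Y t \<omega>))"
    unfolding residual_def by (rule norm_triangle_ineq4)
  also have "\<dots> \<le> C * (1 + norm (X t \<omega>)) + C * (1 + norm (Y t \<omega>))"
    using growth[of t "X t \<omega>"] growth[of t "Y t \<omega>"] norm_ge_zero[of "g t (X t \<omega>)"] norm_ge_zero[of "f t (Y t \<omega>)"]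
    by linarith
  also have "\<dots> \<le> C * ((1 + norm (Y t \<omega>)) + norm (Z t \<omega>)) + C * ((1 + norm (Y t \<omega>)) + norm (Z t \<omega>))"
    using XYZ[OF assms, of t] norm_triangle_ineq[of "Y t \<omega>" "Z t \<omega>"] C_nonneg
    by (intro add_mono[OF mult_left_mono mult_left_mono]) auto
  also have "\<dots> = (2 * C) * ((1 + norm (Y t \<omega>)) + norm (Z t \<omega>))" by simp
  finally have "norm (residual t \<omega>) powr p \<le> ((2 * C) * ((1 + norm (Y t \<omega>)) + norm (Z t \<omega>))) powr p"
    using p by (intro powr_mono2) auto
  also have "\<dots> = (2 * C) powr p * ((1 + norm (Y t \<omega>)) + norm (Z t \<omega>)) powr p"
    by (rule powr_mult)
  also have "\<dots> \<le> (2 * C) powr p * (2 powr p * (weight t \<omega> + norm (Z t \<omega>) powr p))"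
    unfolding weight_def using p by (intro mult_left_mono powr_add_le) auto
  finally show ?thesis by (simp add: mult.assoc)
qed

lemma residual_integrable: "integrable M (\<lambda>\<omega>. norm (residual t \<omega>) powr p)"
proof (rule Bochner_Integration.integrable_bound)
  show "integrable M (\<lambda>\<omega>. ((2 * C) powr p * 2 powr p) * (weight t \<omega> + norm (Z t \<omega>) powr p))"
    by (intro integrable_mult_right Bochner_Integration.integrable_add weight_integrable Z_integrable)
  show "AE \<omega> in M. norm (norm (residual t \<omega>) powr p)
      \<le> norm (((2 * C) powr p * 2 powr p) * (weight t \<omega> + norm (Z t \<omega>) powr p))"
    using residual_bound weight_nonneg by (auto simp: abs_of_nonneg)
qed measurable

lemma Z_mean_continuous:
  assumes "r \<longlonglongrightarrow> t"
  shows "(\<lambda>n. \<integral>\<omega>. norm (Z (r n) \<omega> - Z t \<omega>) powr p \<partial>M) \<longlonglongrightarrow> 0"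
proof -
  have "((\<lambda>s. Lp_norm p M (\<lambda>\<omega>. Z s \<omega> - Z t \<omega>)) \<longlongrightarrow> 0) (at t)" using Z p by (simp add: ergodic_Lp_def)
  \<comment> \<open>The value at t itself is 0, which turns the punctured limit into a full one, so
    that the sequence r may hit t.\<close>
  moreover have "Lp_norm p M (\<lambda>\<omega>. Z t \<omega> - Z t \<omega>) = 0" using p by (simp add: Lp_norm_def)
  ultimately have "((\<lambda>s. Lp_norm p M (\<lambda>\<omega>. Z s \<omega> - Z t \<omega>)) \<longlongrightarrow> 0) (nhds t)"
    using tendsto_at_iff_tendsto_nhds[of "\<lambda>s. Lp_norm p M (\<lambda>\<omega>. Z s \<omega> - Z t \<omega>)" t] by simp
  from filterlim_compose[OF this assms]
  have "(\<lambda>n. Lp_norm p M (\<lambda>\<omega>. Z (r n) \<omega> - Z t \<omega>) powr p) \<longlonglongrightarrow> 0"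
    using p by (intro tendsto_zero_powrI[where b=p] tendsto_const) (auto simp: Lp_norm_def)
  then show ?thesis
    using p by (simp add: Lp_norm_def powr_inverse_powr Bochner_Integration.integral_nonneg)
qed

lemma Z_diff_integrable: "integrable M (\<lambda>\<omega>. norm (Z s \<omega> - Z t \<omega>) powr p)"
proof (rule Bochner_Integration.integrable_bound)
  show "integrable M (\<lambda>\<omega>. 2 powr p * (norm (Z s \<omega>) powr p + norm (Z t \<omega>) powr p))"
    by (intro integrable_mult_right Bochner_Integration.integrable_add Z_integrable)
  have "norm (Z s \<omega> - Z t \<omega>) powr p \<le> 2 powr p * (norm (Z s \<omega>) powr p + norm (Z t \<omega>) powr p)" for \<omega>
    using p by (intro order_trans[OF powr_mono2 powr_add_le] norm_triangle_ineq4) auto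
  then show "AE \<omega> in M. norm (norm (Z s \<omega> - Z t \<omega>) powr p) \<le> norm (2 powr p * (norm (Z s \<omega>) powr p + norm (Z t \<omega>) powr p))"
    by (auto simp: abs_of_nonneg)
qed measurable

lemma Z_powr_le: "norm (Z s \<omega>) powr p \<le> 2 powr p * norm (Z t \<omega>) powr p + 2 powr p * norm (Z s \<omega> - Z t \<omega>) powr p"
proof -
  have "norm (Z s \<omega>) powr p \<le> (norm (Z t \<omega>) + norm (Z s \<omega> - Z t \<omega>)) powr p"
    using p by (intro powr_mono2 norm_triangle_sub) auto
  also have "\<dots> \<le> 2 powr p * (norm (Z t \<omega>) powr p + norm (Z s \<omega> - Z t \<omega>) powr p)"
    using p by (intro powr_add_le) auto
  finally show ?thesis by (simp add: distrib_left)
qed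

lemma UI_subfamily: "uniformly_integrable M F \<Longrightarrow> uniformly_integrable M (\<lambda>n. F (r n))"
  unfolding uniformly_integrable_def by blast

lemma Lp_norm_Z_continuous: "continuous_on UNIV (\<lambda>t. Lp_norm p M (Z t))"
proof (rule continuous_on_sequentiallyI)
  fix r :: "nat \<Rightarrow> real" and t assume r: "r \<longlonglongrightarrow> t"
  have "(\<lambda>n. \<integral>\<omega>. \<bar>norm (Z (r n) \<omega>) powr p - norm (Z t \<omega>) powr p\<bar> \<partial>M) \<longlonglongrightarrow> 0"
  proof (rule vitali_dominated[where V="\<lambda>\<omega>. (2 powr p + 1) * norm (Z t \<omega>) powr p" and U="\<lambda>_ _. 0"
        and R="\<lambda>n \<omega>. 2 powr p * norm (Z (r n) \<omega> - Z t \<omega>) powr p"])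
    fix \<omega> assume \<omega>: "\<omega> \<in> space M"
    have "(\<lambda>n. norm (Z (r n) \<omega>) powr p) \<longlonglongrightarrow> norm (Z t \<omega>) powr p"
      using p by (intro tendsto_powr' tendsto_norm Z_tendsto \<omega> r tendsto_const) auto
    from tendsto_rabs[OF tendsto_diff[OF this tendsto_const[of "norm (Z t \<omega>) powr p"]]]
    show "(\<lambda>n. \<bar>norm (Z (r n) \<omega>) powr p - norm (Z t \<omega>) powr p\<bar>) \<longlonglongrightarrow> 0" by simp
    show "\<bar>norm (Z (r n) \<omega>) powr p - norm (Z t \<omega>) powr p\<bar>
        \<le> (2 powr p + 1) * norm (Z t \<omega>) powr p + 0 + 2 powr p * norm (Z (r n) \<omega> - Z t \<omega>) powr p" for n
    proof -
      have "0 \<le> 2 powr p * norm (Z t \<omega>) powr p" "0 \<le> norm (Z (r n) \<omega>) powr p" "0 \<le> norm (Z t \<omega>) powr p"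
        "0 \<le> 2 powr p * norm (Z (r n) \<omega> - Z t \<omega>) powr p" by auto
      then show ?thesis
        using Z_powr_le[of "r n" \<omega> t] unfolding distrib_right by linarith
    qed
  next
    show "(\<lambda>n. \<integral>\<omega>. 2 powr p * norm (Z (r n) \<omega> - Z t \<omega>) powr p \<partial>M) \<longlonglongrightarrow> 0"
      using tendsto_mult_left[OF Z_mean_continuous[OF r], of "2 powr p"] by simp
  qed (auto simp: uniformly_integrable_def intro!: Z_integrable Z_diff_integrable)
  note W = this
  have le: "norm ((\<integral>\<omega>. norm (Z (r n) \<omega>) powr p \<partial>M) - (\<integral>\<omega>. norm (Z t \<omega>) powr p \<partial>M))
      \<le> (\<integral>\<omega>. \<bar>norm (Z (r n) \<omega>) powr p - norm (Z t \<omega>) powr p\<bar> \<partial>M)" for n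
    using integral_abs_bound[of M "\<lambda>\<omega>. norm (Z (r n) \<omega>) powr p - norm (Z t \<omega>) powr p"]
    by (simp add: Z_integrable)
  have "(\<lambda>n. (\<integral>\<omega>. norm (Z (r n) \<omega>) powr p \<partial>M) - (\<integral>\<omega>. norm (Z t \<omega>) powr p \<partial>M)) \<longlonglongrightarrow> 0"
    by (rule Lim_null_comparison[OF _ W]) (intro always_eventually allI le)
  then have "(\<lambda>n. \<integral>\<omega>. norm (Z (r n) \<omega>) powr p \<partial>M) \<longlonglongrightarrow> (\<integral>\<omega>. norm (Z t \<omega>) powr p \<partial>M)"
    by (simp add: LIM_zero_iff)
  then show "(\<lambda>n. Lp_norm p M (Z (r n))) \<longlonglongrightarrow> Lp_norm p M (Z t)"
    unfolding Lp_norm_def using p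
    by (intro tendsto_powr' tendsto_const) (auto intro!: always_eventually Bochner_Integration.integral_nonneg)
qed

text \<open>Uniform integrability is given for Y only. The powers of Z at \<open>r n\<close> are
  therefore compared with those at t: the part at t goes into the fixed majorant, the increments
  vanish in mean, and the weights of Y form the uniformly integrable part.\<close>

lemma residual_Lp_continuous: "((\<lambda>s. Lp_norm p M (\<lambda>\<omega>. residual s \<omega> - residual t \<omega>)) \<longlongrightarrow> 0) (at t)"
  unfolding tendsto_at_iff_sequentially o_def
proof (intro allI impI)
  fix r assume r: "r \<longlonglongrightarrow> t"
  define D where "D = (2 * C) powr p * 2 powr p"
  have D: "D \<ge> 0" by (simp add: D_def)
  have "(\<lambda>n. \<integral>\<omega>. norm (residual (r n) \<omega> - residual t \<omega>) powr p \<partial>M) \<longlonglongrightarrow> 0"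
  proof (rule vitali_dominated[where U="\<lambda>n \<omega>. 2 powr p * D * weight (r n) \<omega>"
        and R="\<lambda>n \<omega>. 2 powr p * D * 2 powr p * norm (Z (r n) \<omega> - Z t \<omega>) powr p"
        and V="\<lambda>\<omega>. 2 powr p * D * 2 powr p * norm (Z t \<omega>) powr p + 2 powr p * norm (residual t \<omega>) powr p"])
    fix \<omega> assume \<omega>: "\<omega> \<in> space M"
    have "(\<lambda>n. residual (r n) \<omega> - residual t \<omega>) \<longlonglongrightarrow> 0"
      using tendsto_diff[OF residual_tendsto[OF \<omega> r] tendsto_const[of "residual t \<omega>"]] by simp
    then show "(\<lambda>n. norm (residual (r n) \<omega> - residual t \<omega>) powr p) \<longlonglongrightarrow> 0"
      using p by (intro tendsto_zero_powrI[where b=p] tendsto_const tendsto_norm_zero) auto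
    fix n
    have "norm (residual (r n) \<omega> - residual t \<omega>) powr p
        \<le> 2 powr p * (norm (residual (r n) \<omega>) powr p + norm (residual t \<omega>) powr p)"
      using p by (intro order_trans[OF powr_mono2 powr_add_le] norm_triangle_ineq4) auto
    also have "norm (residual (r n) \<omega>) powr p \<le> D * (weight (r n) \<omega> + norm (Z (r n) \<omega>) powr p)"
      using residual_bound[OF \<omega>] by (simp add: D_def)
    also have "D * (weight (r n) \<omega> + norm (Z (r n) \<omega>) powr p)
        \<le> D * (weight (r n) \<omega> + (2 powr p * norm (Z t \<omega>) powr p + 2 powr p * norm (Z (r n) \<omega> - Z t \<omega>) powr p))"
      using D Z_powr_le[of "r n" \<omega> t] by (intro mult_left_mono) auto
    finally show "norm (residual (r n) \<omega> - residual t \<omega>) powr p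
        \<le> (2 powr p * D * 2 powr p * norm (Z t \<omega>) powr p + 2 powr p * norm (residual t \<omega>) powr p)
          + 2 powr p * D * weight (r n) \<omega> + 2 powr p * D * 2 powr p * norm (Z (r n) \<omega> - Z t \<omega>) powr p"
      by (simp add: algebra_simps)
  next
    show "(\<lambda>n. \<integral>\<omega>. 2 powr p * D * 2 powr p * norm (Z (r n) \<omega> - Z t \<omega>) powr p \<partial>M) \<longlonglongrightarrow> 0"
      using tendsto_mult_left[OF Z_mean_continuous[OF r], of "2 powr p * D * 2 powr p"] by simp
    show "uniformly_integrable M (\<lambda>n \<omega>. 2 powr p * D * weight (r n) \<omega>)"
      using D weight_integrable
      by (intro uniformly_integrable_dominated[OF UI_subfamily[OF UI_weight], of r _ 0 "2 powr p * D"])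
        (auto simp: weight_nonneg abs_mult abs_of_nonneg intro: borel_measurable_integrable)
    show "integrable M (\<lambda>\<omega>. 2 powr p * D * 2 powr p * norm (Z t \<omega>) powr p + 2 powr p * norm (residual t \<omega>) powr p)"
      by (intro Bochner_Integration.integrable_add integrable_mult_right Z_integrable residual_integrable)
    show "integrable M (\<lambda>\<omega>. 2 powr p * D * 2 powr p * norm (Z (r n) \<omega> - Z t \<omega>) powr p)" for n
      by (intro integrable_mult_right Z_diff_integrable)
  qed (simp_all add: D weight_nonneg)
  then show "(\<lambda>n. Lp_norm p M (\<lambda>\<omega>. residual (r n) \<omega> - residual t \<omega>)) \<longlonglongrightarrow> 0"
    unfolding Lp_norm_def using p
    by (intro tendsto_zero_powrI[where b="1/p"] tendsto_const)
      (auto intro!: always_eventually Bochner_Integration.integral_nonneg)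
qed

lemma residual_Lp_bounded: "\<exists>B. \<forall>t. Lp_norm p M (residual t) \<le> B"
proof -
  define D where "D = (2 * C) powr p * 2 powr p"
  have D: "D \<ge> 0" by (simp add: D_def)
  obtain B where B: "\<And>t. (\<integral>\<omega>. weight t \<omega> \<partial>M) \<le> B"
    using uniformly_integrable_bounded[OF UI_weight weight_nonneg] by blast
  obtain Cz where Cz: "\<And>t. Lp_norm p M (Z t) \<le> Cz" using Z p unfolding ergodic_Lp_def by auto
  have "Lp_norm p M (residual t) \<le> (D * (B + Cz powr p)) powr (1 / p)" for t
  proof -
    have "0 \<le> Lp_norm p M (Z t)" by (simp add: Lp_norm_def)
    then have "Lp_norm p M (Z t) powr p \<le> Cz powr p" using Cz[of t] p by (intro powr_mono2) auto
    then have Zb: "(\<integral>\<omega>. norm (Z t \<omega>) powr p \<partial>M) \<le> Cz powr p"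
      using p by (simp add: Lp_norm_def powr_inverse_powr Bochner_Integration.integral_nonneg)
    have "(\<integral>\<omega>. norm (residual t \<omega>) powr p \<partial>M) \<le> (\<integral>\<omega>. D * (weight t \<omega> + norm (Z t \<omega>) powr p) \<partial>M)"
      using residual_bound unfolding D_def[symmetric]
      by (intro integral_mono residual_integrable integrable_mult_right Bochner_Integration.integrable_add weight_integrable Z_integrable)
    also have "\<dots> = D * ((\<integral>\<omega>. weight t \<omega> \<partial>M) + (\<integral>\<omega>. norm (Z t \<omega>) powr p \<partial>M))"
      by (simp add: weight_integrable Z_integrable)
    also have "\<dots> \<le> D * (B + Cz powr p)" using D B[of t] Zb by (intro mult_left_mono) auto
    finally show ?thesis
      unfolding Lp_norm_def using p by (intro powr_mono2) (auto intro!: Bochner_Integration.integral_nonneg)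
  qed
  then show ?thesis by blast
qed

lemma residual_Lp_mean: "(sym_mean \<mu> (\<lambda>t. Lp_norm p M (residual t)) \<longlongrightarrow> 0) at_top"
proof (rule sym_mean_tendsto_0I)
  show "0 \<le> Lp_norm p M (residual t)" for t by (simp add: Lp_norm_def)
  fix \<epsilon> :: real assume \<epsilon>: "\<epsilon> > 0"
  \<comment> \<open>k is the constant of \<open>powr_add_le\<close> for the exponent 1 / p. It
    enters twice because three terms are separated one after the other, and the two copies of e then
    contribute \<open>4 * k * k * e = \<epsilon>\<close>.\<close>
  define k where "k = 2 powr (1 / p)"
  have k: "k > 0" by (simp add: k_def)
  define e where "e = \<epsilon> / (4 * k * k)"
  have e: "e > 0" using \<epsilon> k by (simp add: e_def)
  \<comment> \<open>Chosen so that \<open>C powr p * \<epsilon>'\<close> is at most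
    \<open>e powr p\<close>; the added 1 covers C = 0.\<close>
  define \<epsilon>' where "\<epsilon>' = e powr p / (C powr p + 1)"
  have "C powr p + 1 > 0" by (simp add: add_nonneg_pos)
  then have \<epsilon>': "\<epsilon>' > 0" and C\<epsilon>': "C powr p * \<epsilon>' \<le> e powr p"
    using e by (auto simp: \<epsilon>'_def field_simps)
  \<comment> \<open>Tightness is needed at the level \<open>\<delta>\<close> given by uniform
    integrability: off K only the growth bound is at hand, and its weight is small just on events of
    small probability.\<close>
  obtain \<delta> where \<delta>: "\<delta> > 0" "\<And>t A. A \<in> sets M \<Longrightarrow> prob A \<le> \<delta> \<Longrightarrow> (\<integral>\<omega>. weight t \<omega> * indicator A \<omega> \<partial>M) \<le> \<epsilon>'"
    using uniformly_integrable_small_sets[OF UI_weight weight_nonneg \<epsilon>'] by blast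
  obtain K where K: "compact K" "\<And>t. prob {\<omega>\<in>space M. Y t \<omega> \<notin> K} \<le> \<delta>"
    using almost_automorphic_in_distr_imp_tight[OF prob_space_axioms Y AA \<delta>(1)] by blast
  obtain v where v: "null_mean \<mu> v" "\<And>t. 0 \<le> v t" "\<And>t y. y \<in> K \<Longrightarrow> norm (h t y) \<le> e + v t"
    using h_majorant[OF K(1) e] by blast
  have L: "L \<ge> 0" using lipschitz lipschitz_on_nonneg by blast
  have "Lp_norm p M (residual t) \<le> \<epsilon> + (2 * k * L * Lp_norm p M (Z t) + 2 * k * k * v t)" for t
  proof -
    let ?E = "{\<omega>\<in>space M. Y t \<omega> \<notin> K}"
    have E: "?E \<in> sets M" by (rule escape_sets[OF K(1)])
    have iE: "integrable M (\<lambda>\<omega>. weight t \<omega> * indicator ?E \<omega>)"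
      using E weight_integrable by (rule integrable_real_mult_indicator)
    have "norm (residual t \<omega>) powr p \<le> 2 powr p * (L powr p * norm (Z t \<omega>) powr p
        + ((e + v t) powr p + C powr p * (weight t \<omega> * indicator ?E \<omega>)))" if \<omega>: "\<omega> \<in> space M" for \<omega>
    proof -
      have 1: "norm (f t (X t \<omega>) - f t (Y t \<omega>)) powr p \<le> L powr p * norm (Z t \<omega>) powr p"
      proof -
        have "norm (f t (X t \<omega>) - f t (Y t \<omega>)) \<le> L * norm (Z t \<omega>)"
          using lipschitz_onD[OF lipschitz, of "X t \<omega>" "Y t \<omega>" t] XYZ[OF \<omega>, of t] by (simp add: dist_norm)
        then show ?thesis
          using p L powr_mono2[of p _ "L * norm (Z t \<omega>)"] by (simp add: powr_mult)
      qed
      have 2: "norm (h t (Y t \<omega>)) powr p \<le> (e + v t) powr p + C powr p * (weight t \<omega> * indicator ?E \<omega>)"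
      proof (cases "Y t \<omega> \<in> K")
        case True
        have "norm (h t (Y t \<omega>)) powr p \<le> (e + v t) powr p"
          using v(3)[OF True, of t] p by (intro powr_mono2) auto
        then show ?thesis using True by simp
      next
        case False
        have "norm (h t (Y t \<omega>)) \<le> norm (f t (Y t \<omega>)) + norm (g t (Y t \<omega>))"
          using norm_triangle_ineq4[of "f t (Y t \<omega>)" "g t (Y t \<omega>)"] by (simp add: fgh)
        also have "\<dots> \<le> C * (1 + norm (Y t \<omega>))" by (rule growth)
        finally have "norm (h t (Y t \<omega>)) powr p \<le> (C * (1 + norm (Y t \<omega>))) powr p"
          using p by (intro powr_mono2) auto
        then have "norm (h t (Y t \<omega>)) powr p \<le> C powr p * weight t \<omega>"
          using C_nonneg by (simp add: powr_mult weight_def)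
        then show ?thesis using False \<omega> by (simp add: add_increasing)
      qed
      have "norm (residual t \<omega>) powr p \<le> 2 powr p * (norm (f t (X t \<omega>) - f t (Y t \<omega>)) powr p + norm (h t (Y t \<omega>)) powr p)"
        unfolding residual_eq using p by (intro order_trans[OF powr_mono2 powr_add_le] norm_triangle_ineq) auto
      also have "\<dots> \<le> 2 powr p * (L powr p * norm (Z t \<omega>) powr p
        + ((e + v t) powr p + C powr p * (weight t \<omega> * indicator ?E \<omega>)))"
        by (intro mult_left_mono add_mono 1 2) auto
      finally show ?thesis .
    qed
    then have "(\<integral>\<omega>. norm (residual t \<omega>) powr p \<partial>M) \<le> (\<integral>\<omega>. 2 powr p * (L powr p * norm (Z t \<omega>) powr p
        + ((e + v t) powr p + C powr p * (weight t \<omega> * indicator ?E \<omega>))) \<partial>M)"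
      by (intro integral_mono residual_integrable integrable_mult_right Bochner_Integration.integrable_add Z_integrable iE) auto
    also have "\<dots> = 2 powr p * (L powr p * (\<integral>\<omega>. norm (Z t \<omega>) powr p \<partial>M)
        + ((e + v t) powr p + C powr p * (\<integral>\<omega>. weight t \<omega> * indicator ?E \<omega> \<partial>M)))"
      using Z_integrable iE by (simp add: prob_space)
    also have "\<dots> \<le> 2 powr p * (L powr p * (\<integral>\<omega>. norm (Z t \<omega>) powr p \<partial>M) + ((e + v t) powr p + e powr p))"
    proof -
      have "C powr p * (\<integral>\<omega>. weight t \<omega> * indicator ?E \<omega> \<partial>M) \<le> C powr p * \<epsilon>'"
        using \<delta>(2)[OF E K(2)[of t], of t] by (intro mult_left_mono) auto
      then show ?thesis using C\<epsilon>' by (intro mult_left_mono add_left_mono) auto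
    qed
    finally have "Lp_norm p M (residual t) \<le>
        (2 powr p * (L powr p * (\<integral>\<omega>. norm (Z t \<omega>) powr p \<partial>M) + ((e + v t) powr p + e powr p))) powr (1 / p)"
      unfolding Lp_norm_def using p by (intro powr_mono2) (auto intro!: Bochner_Integration.integral_nonneg)
    also have "\<dots> = 2 * (L powr p * (\<integral>\<omega>. norm (Z t \<omega>) powr p \<partial>M) + ((e + v t) powr p + e powr p)) powr (1 / p)"
      using p by (subst powr_mult) (auto simp: powr_powr intro!: add_nonneg_nonneg Bochner_Integration.integral_nonneg)
    also have "\<dots> \<le> 2 * (k * ((L powr p * (\<integral>\<omega>. norm (Z t \<omega>) powr p \<partial>M)) powr (1 / p)
        + k * (((e + v t) powr p) powr (1 / p) + (e powr p) powr (1 / p))))"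
    proof (intro mult_left_mono)
      have "(L powr p * (\<integral>\<omega>. norm (Z t \<omega>) powr p \<partial>M) + ((e + v t) powr p + e powr p)) powr (1 / p)
        \<le> k * ((L powr p * (\<integral>\<omega>. norm (Z t \<omega>) powr p \<partial>M)) powr (1 / p) + ((e + v t) powr p + e powr p) powr (1 / p))"
        unfolding k_def using p by (intro powr_add_le) (auto intro!: Bochner_Integration.integral_nonneg)
      also have "((e + v t) powr p + e powr p) powr (1 / p) \<le> k * (((e + v t) powr p) powr (1 / p) + (e powr p) powr (1 / p))"
        unfolding k_def using p by (intro powr_add_le) auto
      finally show "(L powr p * (\<integral>\<omega>. norm (Z t \<omega>) powr p \<partial>M) + ((e + v t) powr p + e powr p)) powr (1 / p)
        \<le> k * ((L powr p * (\<integral>\<omega>. norm (Z t \<omega>) powr p \<partial>M)) powr (1 / p)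
        + k * (((e + v t) powr p) powr (1 / p) + (e powr p) powr (1 / p)))"
        using k by simp
    qed simp
    also have "(L powr p * (\<integral>\<omega>. norm (Z t \<omega>) powr p \<partial>M)) powr (1 / p) = L * Lp_norm p M (Z t)"
      using L p by (simp add: powr_mult powr_inverse_powr Lp_norm_def Bochner_Integration.integral_nonneg)
    also have "((e + v t) powr p) powr (1 / p) = e + v t" using e v(2)[of t] p by (intro powr_inverse_powr) auto
    also have "(e powr p) powr (1 / p) = e" using e p by (intro powr_inverse_powr) auto
    also have "2 * (k * (L * Lp_norm p M (Z t) + k * (e + v t + e))) = 4 * k * k * e + (2 * k * L * Lp_norm p M (Z t) + 2 * k * k * v t)"
      by (simp add: algebra_simps)
    also have "4 * k * k * e = \<epsilon>" using k by (simp add: e_def)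
    finally show ?thesis .
  qed
  moreover have "null_mean \<mu> (\<lambda>t. Lp_norm p M (Z t))"
    using Z p set_integrable_continuous[OF Lp_norm_Z_continuous] by (simp add: null_mean_def ergodic_Lp_def)
  ultimately show "\<exists>v. null_mean \<mu> v \<and> (\<forall>t. Lp_norm p M (residual t) \<le> \<epsilon> + v t)"
    using null_mean_add[OF null_mean_mult null_mean_mult[OF v(1)]] by blast
qed

lemma residual_ergodic_pos: "residual \<in> ergodic_Lp p M \<mu>"
  using p residual_Lp_continuous residual_Lp_bounded residual_Lp_mean residual_integrable
  by (auto simp: ergodic_Lp_def Lp_def)

lemma UI_gY: "uniformly_integrable M (\<lambda>t \<omega>. norm (g t (Y t \<omega>)) powr p)"
proof (rule uniformly_integrable_dominated[OF UI_weight weight_nonneg, of _ 0 "C powr p"])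
  fix t \<omega>
  have "norm (g t (Y t \<omega>)) \<le> C * (1 + norm (Y t \<omega>))"
    using growth[of t "Y t \<omega>"] norm_ge_zero[of "f t (Y t \<omega>)"] by linarith
  then have "norm (g t (Y t \<omega>)) powr p \<le> (C * (1 + norm (Y t \<omega>))) powr p"
    using p by (intro powr_mono2) auto
  then show "\<bar>norm (g t (Y t \<omega>)) powr p\<bar> \<le> 0 + C powr p * weight t \<omega>"
    using C_nonneg by (simp add: powr_mult weight_def)
qed auto

end

end

theorem pseudo_almost_automorphic_in_p_distr_compose:
  fixes X :: "real \<Rightarrow> 'w \<Rightarrow> 'a::{banach, second_countable_topology}"
    and f g h :: "real \<Rightarrow> 'a \<Rightarrow> 'b::{banach, second_countable_topology}"
  assumes M: "prob_space M" and \<mu>: "averaging_measure \<mu>" and p: "p \<ge> 0"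
    and X: "continuous_process M X" and f: "continuous_on UNIV (\<lambda>(t, x). f t x)"
    and fgh: "\<And>t x. f t x = g t x + h t x"
    and g: "g \<in> AAcUc" "\<And>t. continuous_on UNIV (g t)" and h: "h \<in> EUc \<mu>"
    and uc: "\<And>\<epsilon> K. \<epsilon> > 0 \<Longrightarrow> compact K \<Longrightarrow>
      \<exists>\<eta>>0. \<forall>x\<in>K. \<forall>y\<in>K. norm (x - y) \<le> \<eta> \<longrightarrow> (\<forall>t. norm (f t x - f t y) \<le> \<epsilon>)"
    and growth: "p > 0 \<Longrightarrow> \<exists>C. \<forall>t x. norm (f t x) + norm (g t x) \<le> C * (1 + norm x)"
    and lipschitz: "p > 0 \<Longrightarrow> \<exists>L. \<forall>t. L-lipschitz_on UNIV (f t)"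
    and PAA: "pseudo_almost_automorphic_in_p_distr p M \<mu> X"
  shows "pseudo_almost_automorphic_in_p_distr p M \<mu> (\<lambda>t \<omega>. f t (X t \<omega>))"
proof -
  obtain Y Z where XYZ: "\<And>t \<omega>. \<omega> \<in> space M \<Longrightarrow> X t \<omega> = Y t \<omega> + Z t \<omega>"
    and Y: "continuous_process M Y" and AAp: "almost_automorphic_in_p_distr p M Y" and Z: "Z \<in> ergodic_Lp p M \<mu>"
    using PAA unfolding pseudo_almost_automorphic_in_p_distr_def by blast
  have AA: "almost_automorphic_in_distr M Y" using AAp by (simp add: almost_automorphic_in_p_distr_def)
  have Zm: "Z t \<in> borel_measurable M" for t
    using Z by (auto simp: ergodic_Lp_def Lp_def split: if_splits)
  interpret superposition \<mu> M f g h X Y Z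
    by (intro superposition.intro superposition_axioms.intro M \<mu> f fgh g h uc X Y XYZ AA Zm)
  \<comment> \<open>The almost automorphic case needs g jointly continuous; this comes from
    \<open>AAcUc\<close> and continuity in the second variable.\<close>
  have gYAA: "almost_automorphic_in_distr M (\<lambda>t \<omega>. g t (Y t \<omega>))"
    by (rule almost_automorphic_in_distr_compose[OF M Y g_continuous AA g(1)])
  have "almost_automorphic_in_p_distr p M (\<lambda>t \<omega>. g t (Y t \<omega>)) \<and> residual \<in> ergodic_Lp p M \<mu>"
  proof (cases "p > 0")
    case True
    obtain C L where C: "\<And>t x. norm (f t x) + norm (g t x) \<le> C * (1 + norm x)"
      and L: "\<And>t. L-lipschitz_on UNIV (f t)"
      using growth[OF True] lipschitz[OF True] by blast
    have UI: "uniformly_integrable M (\<lambda>t \<omega>. norm (Y t \<omega>) powr p)"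
      using AAp True by (simp add: almost_automorphic_in_p_distr_def)
    show ?thesis
      using residual_ergodic_pos[OF True C L UI Z] UI_gY[OF True C L UI Z] gYAA
      by (simp add: almost_automorphic_in_p_distr_def)
  next
    case False
    then have "p = 0" using p by simp
    then show ?thesis using residual_ergodic_0 Z gYAA by (simp add: almost_automorphic_in_p_distr_def)
  qed
  moreover have "\<forall>t. \<forall>\<omega>\<in>space M. f t (X t \<omega>) = g t (Y t \<omega>) + residual t \<omega>" by (simp add: residual_def)
  ultimately show ?thesis
    unfolding pseudo_almost_automorphic_in_p_distr_def using gY
    by (intro exI[of _ "\<lambda>t \<omega>. g t (Y t \<omega>)"] exI[of _ residual]) simp
qed

section \<open>Prokhorov's theorem\<close>

text \<open>The diagonal sequence is a subsequence of the i-th extraction only from some index on;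
  this is what \<open>tail\<close> compensates for.\<close>

lemma diagonal_subsequence:
  assumes ex: "\<And>i s. strict_mono (s :: nat \<Rightarrow> nat) \<Longrightarrow> \<exists>r. strict_mono r \<and> P i (s \<circ> r)"
    and sub: "\<And>i s r. strict_mono (r :: nat \<Rightarrow> nat) \<Longrightarrow> P i s \<Longrightarrow> P i (s \<circ> r)"
    and tail: "\<And>i s k. P i (s \<circ> (+) k) \<Longrightarrow> P i s"
  shows "\<exists>r. strict_mono (r :: nat \<Rightarrow> nat) \<and> (\<forall>i :: nat. P i r)"
proof -
  interpret subseqs P by unfold_locales (rule ex)
  have "P i diagseq" for i by (rule tail[OF diagseq_holds[OF sub]])
  then show ?thesis using subseq_diagseq by blast
qed

text \<open>The error is the integral of G over the event that c leaves F; a finite F allows limits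
  of point masses to be taken termwise.\<close>

lemma (in prob_space) integral_finite_approx:
  fixes c :: "'a \<Rightarrow> 'c" and G :: "'c \<Rightarrow> real"
  assumes c: "c \<in> measurable M (count_space UNIV)" and F: "finite F" and G: "\<And>w. \<bar>G w\<bar> \<le> B"
  shows "\<bar>(\<integral>x. G (c x) \<partial>M) - (\<Sum>w\<in>F. G w * prob {x\<in>space M. c x = w})\<bar>
    \<le> B * (1 - (\<Sum>w\<in>F. prob {x\<in>space M. c x = w}))"
proof -
  let ?E = "\<lambda>w. {x\<in>space M. c x = w}"
  have E: "?E w \<in> sets M" for w
    using measurable_sets[OF c, of "{w}"] by (simp add: vimage_def Int_def conj_commute)
  have iE: "integrable M (indicator (?E w) :: _ \<Rightarrow> real)" for w using E by (simp add: emeasure_eq_measure)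
  have iG: "integrable M (\<lambda>x. G (c x))"
    using c G by (intro integrable_const_bound[where B=B]) (auto intro: measurable_compose)
  have split: "indicat_real (?E w) x = (if w = c x then 1 else 0)" if "x \<in> space M" for w x
    using that by auto
  have pw: "\<bar>G (c x) - (\<Sum>w\<in>F. G w * indicator (?E w) x)\<bar> \<le> B * (1 - (\<Sum>w\<in>F. indicator (?E w) x))"
    if "x \<in> space M" for x
    using F G[of "c x"] by (simp add: split[OF that] sum.delta if_distrib cong: if_cong)
  have "\<bar>\<integral>x. G (c x) - (\<Sum>w\<in>F. G w * indicator (?E w) x) \<partial>M\<bar>
      \<le> (\<integral>x. \<bar>G (c x) - (\<Sum>w\<in>F. G w * indicator (?E w) x)\<bar> \<partial>M)"
    by (rule integral_abs_bound)
  also have "\<dots> \<le> (\<integral>x. B * (1 - (\<Sum>w\<in>F. indicator (?E w) x)) \<partial>M)"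
    using pw by (intro integral_mono integrable_abs Bochner_Integration.integrable_diff iG integrable_mult_right
      Bochner_Integration.integrable_sum iE integrable_const)
  also have "\<dots> = B * (1 - (\<Sum>w\<in>F. prob (?E w)))"
    using E iE by (simp add: prob_space)
  also have "(\<integral>x. G (c x) - (\<Sum>w\<in>F. G w * indicator (?E w) x) \<partial>M)
      = (\<integral>x. G (c x) \<partial>M) - (\<Sum>w\<in>F. G w * prob (?E w))"
    using E iE iG by simp
  finally show ?thesis .
qed

lemma (in prob_space) countable_valued_concentrated:
  fixes c :: "'a \<Rightarrow> 'c::countable"
  assumes c: "c \<in> measurable M (count_space UNIV)" and e: "e > 0"
  shows "\<exists>F. finite F \<and> 1 - e < (\<Sum>w\<in>F. prob {x\<in>space M. c x = w})"
proof -
  let ?E = "\<lambda>w. {x\<in>space M. c x = w}"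
  have E: "?E w \<in> sets M" for w
    using measurable_sets[OF c, of "{w}"] by (simp add: vimage_def Int_def conj_commute)
  define A where "A j = {x\<in>space M. to_nat (c x) < j}" for j
  have A: "A j \<in> sets M" for j
  proof -
    have "A j = c -` {w. to_nat w < j} \<inter> space M" by (auto simp: A_def)
    then show ?thesis by (simp only:) (rule measurable_sets[OF c], simp)
  qed
  have "(\<lambda>j. prob (A j)) \<longlonglongrightarrow> prob (\<Union>j. A j)"
    using A by (intro finite_Lim_measure_incseq) (auto simp: A_def incseq_def)
  moreover have "(\<Union>j. A j) = space M" by (auto simp: A_def)
  ultimately have "(\<lambda>j. prob (A j)) \<longlonglongrightarrow> 1" by (simp add: prob_space)
  then have "\<forall>\<^sub>F j in sequentially. 1 - e < prob (A j)" using e by (intro order_tendstoD(1)) auto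
  then obtain j where j: "1 - e < prob (A j)" by (auto simp: eventually_sequentially)
  define F where "F = {w :: 'c. to_nat w < j}"
  have "finite F" unfolding F_def
    by (rule finite_imageD[of to_nat]) (auto intro: finite_subset[of _ "{..<j}"])
  moreover have "prob (A j) = (\<Sum>w\<in>F. prob (?E w))"
  proof -
    have "A j = (\<Union>w\<in>F. ?E w)" by (auto simp: A_def F_def)
    then show ?thesis
      using E \<open>finite F\<close> by (auto intro!: finite_measure_finite_Union simp: disjoint_family_on_def)
  qed
  ultimately show ?thesis using j by auto
qed

text \<open>The limit masses belong to a probability, so a finite set carries almost all of them;
  the masses along N on this set converge, and nothing can escape to other values.\<close>

lemma tendsto_integral_countable_valued:
  fixes N :: "nat \<Rightarrow> 'e measure" and \<Omega> :: "'f measure" and c :: "'e \<Rightarrow> 'c::countable" and d :: "'f \<Rightarrow> 'c"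
  assumes N: "\<And>n. prob_space (N n)" "\<And>n. c \<in> measurable (N n) (count_space UNIV)"
    and \<Omega>: "prob_space \<Omega>" "d \<in> measurable \<Omega> (count_space UNIV)"
    and lim: "\<And>w. (\<lambda>n. measure (N n) {x\<in>space (N n). c x = w}) \<longlonglongrightarrow> measure \<Omega> {u\<in>space \<Omega>. d u = w}"
    and G: "\<And>w. \<bar>G w\<bar> \<le> (B :: real)"
  shows "(\<lambda>n. \<integral>x. G (c x) \<partial>N n) \<longlonglongrightarrow> (\<integral>u. G (d u) \<partial>\<Omega>)"
proof (rule tendstoI)
  fix e :: real assume e: "e > 0"
  have B: "B \<ge> 0" using G abs_ge_zero order_trans by blast
  \<comment> \<open>The two truncation errors \<open>B * e'\<close> then total at most e / 2; B + 1
    covers B = 0.\<close>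
  define e' where "e' = e / (4 * (B + 1))"
  have e': "e' > 0" "2 * (B * e') < e" using e B by (auto simp: e'_def field_simps add_pos_nonneg)
  obtain F where F: "finite F" "1 - e' < (\<Sum>w\<in>F. measure \<Omega> {u\<in>space \<Omega>. d u = w})"
    using prob_space.countable_valued_concentrated[OF \<Omega> e'(1)] by blast
  let ?p = "\<lambda>n w. measure (N n) {x\<in>space (N n). c x = w}" and ?q = "\<lambda>w. measure \<Omega> {u\<in>space \<Omega>. d u = w}"
  have l1: "(\<lambda>n. \<Sum>w\<in>F. ?p n w) \<longlonglongrightarrow> (\<Sum>w\<in>F. ?q w)" by (intro tendsto_sum lim)
  have "(\<lambda>n. \<bar>(\<Sum>w\<in>F. G w * ?p n w) - (\<Sum>w\<in>F. G w * ?q w)\<bar>) \<longlonglongrightarrow> \<bar>(\<Sum>w\<in>F. G w * ?q w) - (\<Sum>w\<in>F. G w * ?q w)\<bar>"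
    by (intro tendsto_intros lim)
  then have "\<forall>\<^sub>F n in sequentially. \<bar>(\<Sum>w\<in>F. G w * ?p n w) - (\<Sum>w\<in>F. G w * ?q w)\<bar> < e - 2 * (B * e')"
    using e' by (intro order_tendstoD(2)) auto
  moreover have "\<forall>\<^sub>F n in sequentially. 1 - e' < (\<Sum>w\<in>F. ?p n w)"
    using l1 F(2) by (rule order_tendstoD(1))
  ultimately show "\<forall>\<^sub>F n in sequentially. dist (\<integral>x. G (c x) \<partial>N n) (\<integral>u. G (d u) \<partial>\<Omega>) < e"
  proof eventually_elim
    case (elim n)
    have "\<bar>(\<integral>x. G (c x) \<partial>N n) - (\<Sum>w\<in>F. G w * ?p n w)\<bar> \<le> B * (1 - (\<Sum>w\<in>F. ?p n w))"
      by (rule prob_space.integral_finite_approx[OF N F(1) G])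
    also have "\<dots> \<le> B * e'" using B elim(2) by (intro mult_left_mono) auto
    finally have 1: "\<bar>(\<integral>x. G (c x) \<partial>N n) - (\<Sum>w\<in>F. G w * ?p n w)\<bar> \<le> B * e'" .
    have "\<bar>(\<integral>u. G (d u) \<partial>\<Omega>) - (\<Sum>w\<in>F. G w * ?q w)\<bar> \<le> B * (1 - (\<Sum>w\<in>F. ?q w))"
      by (rule prob_space.integral_finite_approx[OF \<Omega> F(1) G])
    also have "\<dots> \<le> B * e'" using B F(2) by (intro mult_left_mono) auto
    finally show ?case using 1 elim(1) unfolding dist_real_def by linarith
  qed
qed

text \<open>A consistent family of cylinder masses \<open>m\<close> on finite words is realised by random words on
  \<open>[0, 1)\<close>: the word \<open>w\<close> owns a half-open interval of length \<open>m w\<close>, which the words extending \<open>w\<close>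
  by one letter partition from left to right.\<close>

locale word_masses =
  fixes m :: "nat list \<Rightarrow> real"
  assumes nonneg: "0 \<le> m w" and total: "m [] = 1" and split: "(\<lambda>i. m (w @ [i])) sums m w"
begin

text \<open>Left endpoint of the interval owned by w: at every level, the masses of the earlier
  siblings of the prefix of w.\<close>

definition left :: "nat list \<Rightarrow> real" where
  "left w = (\<Sum>k<length w. \<Sum>j<w ! k. m (take k w @ [j]))"

lemma left_simps: "left [] = 0" "left (w @ [i]) = left w + (\<Sum>j<i. m (w @ [j]))"
  by (auto simp: left_def nth_append intro!: sum.cong)

text \<open>The next letter is the first one whose cumulated mass passes u: the quantile transform,
  one letter at a time.\<close>

primrec word :: "real \<Rightarrow> nat \<Rightarrow> nat list" where
  "word u 0 = []"
| "word u (Suc k) = word u k @ [LEAST i. u < left (word u k) + (\<Sum>j\<le>i. m (word u k @ [j]))]"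

lemma length_word [simp]: "length (word u k) = k"
  by (induction k) auto

lemma take_word: "k \<le> l \<Longrightarrow> take k (word u l) = word u k"
  by (induction l) (auto simp: le_Suc_eq)

lemma word_interval:
  assumes "u \<in> {0..<1}"
  shows "u \<in> {left (word u k)..<left (word u k) + m (word u k)}"
proof (induction k)
  case 0
  then show ?case using assms by (simp add: left_simps total)
next
  case (Suc k)
  define w where "w = word u k"
  have "(\<lambda>i. \<Sum>j\<le>i. m (w @ [j])) \<longlonglongrightarrow> m w"
    using split[of w] by (simp add: sums_def_le)
  moreover have "u - left w < m w" using Suc by (simp add: w_def)
  \<comment> \<open>Since the interval excludes its right end, some partial sum passes u strictly,
    and the least index in \<open>word\<close> exists.\<close>
  ultimately have "\<forall>\<^sub>F i in sequentially. u - left w < (\<Sum>j\<le>i. m (w @ [j]))"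
    by (rule order_tendstoD(1))
  then obtain i where "u - left w < (\<Sum>j\<le>i. m (w @ [j]))" by (auto simp: eventually_sequentially)
  then have ex: "u < left w + (\<Sum>j\<le>i. m (w @ [j]))" by simp
  define l where "l = (LEAST i. u < left w + (\<Sum>j\<le>i. m (w @ [j])))"
  have upper: "u < left w + (\<Sum>j\<le>l. m (w @ [j]))" unfolding l_def by (rule LeastI[of "\<lambda>i. u < left w + (\<Sum>j\<le>i. m (w @ [j]))" i, OF ex])
  have lower: "left w + (\<Sum>j<l. m (w @ [j])) \<le> u"
  proof (cases l)
    case 0
    then show ?thesis using Suc by (simp add: w_def)
  next
    case (Suc l')
    then have "\<not> u < left w + (\<Sum>j\<le>l'. m (w @ [j]))"
      using not_less_Least[of l' "\<lambda>i. u < left w + (\<Sum>j\<le>i. m (w @ [j]))"] by (simp add: l_def)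
    then show ?thesis using Suc by (simp add: lessThan_Suc_atMost)
  qed
  have w_l: "word u (Suc k) = w @ [l]" by (simp add: w_def l_def)
  show ?case
    unfolding w_l left_simps using upper lower by (simp add: lessThan_Suc_atMost[symmetric])
qed

text \<open>With \<open>word_interval\<close> this identifies the event that the random word equals
  w with the interval of w, whose length is \<open>m w\<close>.\<close>

lemma interval_word:
  assumes "u \<in> {left w..<left w + m w}"
  shows "u \<in> {0..<1} \<and> word u (length w) = w"
  using assms
proof (induction w rule: rev_induct)
  case Nil
  then show ?case by (simp add: left_simps total)
next
  case (snoc i w)
  have "(\<Sum>j\<le>i. m (w @ [j])) \<le> (\<Sum>j. m (w @ [j]))"
    by (rule sum_le_suminf[OF sums_summable[OF split]]) (auto intro: nonneg)
  then have part: "(\<Sum>j\<le>i. m (w @ [j])) \<le> m w" by (simp only: sums_unique[OF split, symmetric])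
  have u: "left w + (\<Sum>j<i. m (w @ [j])) \<le> u" "u < left w + (\<Sum>j\<le>i. m (w @ [j]))"
    using snoc.prems by (auto simp: left_simps lessThan_Suc_atMost[symmetric])
  moreover have "0 \<le> (\<Sum>j<i. m (w @ [j]))" by (intro sum_nonneg nonneg)
  ultimately have "u \<in> {left w..<left w + m w}" using part by auto
  then have IH: "u \<in> {0..<1}" "word u (length w) = w" using snoc.IH by auto
  have "(LEAST i. u < left w + (\<Sum>j\<le>i. m (w @ [j]))) = i"
  proof (rule Least_equality[of "\<lambda>i. u < left w + (\<Sum>j\<le>i. m (w @ [j]))", OF u(2)])
    fix i' assume i': "u < left w + (\<Sum>j\<le>i'. m (w @ [j]))"
    show "i \<le> i'"
    proof (rule ccontr)
      assume "\<not> i \<le> i'"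
      then have "(\<Sum>j\<le>i'. m (w @ [j])) \<le> (\<Sum>j<i. m (w @ [j]))"
        by (intro sum_mono2) (auto intro: nonneg)
      then show False using u(1) i' by linarith
    qed
  qed
  then show ?case using IH by simp
qed

declare word.simps(2) [simp del]

definition unit_space :: "real measure" where
  "unit_space = restrict_space lborel {0..<1}"

lemma space_unit_space: "space unit_space = {0..<1}"
  by (simp add: unit_space_def space_restrict_space)

lemma prob_space_unit_space: "prob_space unit_space"
  by (rule prob_spaceI) (simp add: unit_space_def space_restrict_space emeasure_restrict_space)

lemma word_fibre: "{u\<in>space unit_space. word u k = w} = (if length w = k then {left w..<left w + m w} else {})"
proof (cases "length w = k")
  case True
  have "u \<in> {0..<1} \<and> word u k = w \<longleftrightarrow> u \<in> {left w..<left w + m w}" for u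
    using word_interval[of u k] interval_word[of u w] True by blast
  then show ?thesis using True unfolding space_unit_space by (auto simp del: atLeastLessThan_iff)
next
  case False
  then show ?thesis by auto
qed

lemma measurable_word: "(\<lambda>u. word u k) \<in> measurable unit_space (count_space UNIV)"
  unfolding measurable_count_space_eq_countable[OF countableI_type]
proof (intro conjI ballI)
  fix w
  have "{left w..<left w + m w} \<subseteq> {0..<1}" using interval_word[of _ w] by blast
  then have "{left w..<left w + m w} \<in> sets unit_space"
    by (auto simp: unit_space_def sets_restrict_space_iff)
  moreover have "(\<lambda>u. word u k) -` {w} \<inter> space unit_space = {u\<in>space unit_space. word u k = w}" by auto
  ultimately show "(\<lambda>u. word u k) -` {w} \<inter> space unit_space \<in> sets unit_space"
    unfolding word_fibre by auto
qed auto

lemma measure_word: "measure unit_space {u\<in>space unit_space. word u k = w} = (if length w = k then m w else 0)"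
proof -
  have "{left w..<left w + m w} \<subseteq> {0..<1}" using interval_word[of _ w] by blast
  then have "measure unit_space {left w..<left w + m w} = m w"
    using nonneg[of w] by (simp add: unit_space_def measure_restrict_space)
  then show ?thesis unfolding word_fibre by simp
qed

end

text \<open>The word \<open>code k x\<close> records, for the scales \<open>1, 1/2, 1/4, \<dots>\<close>, the first ball around a point of
  \<open>a\<close> that contains \<open>x\<close>. Along a diagonal subsequence the masses of all codes converge, tightness
  makes the limit masses consistent, and the random words realising them select points that
  converge to a variable with the limit law.\<close>

lemma prokhorov:
  fixes N :: "nat \<Rightarrow> 'e::{complete_space, second_countable_topology} measure" and a :: "nat \<Rightarrow> 'e"
  assumes N: "\<And>n. N n \<in> borel_prob_measures"
    and a: "\<And>x e. e > 0 \<Longrightarrow> \<exists>i. dist x (a i) < e"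
    and tight: "\<And>\<delta> \<epsilon>. \<delta> > 0 \<Longrightarrow> \<epsilon> > 0 \<Longrightarrow> \<exists>j. \<forall>n. 1 - \<epsilon> \<le> measure (N n) (\<Union>i\<le>j. ball (a i) \<delta>)"
  shows "\<exists>r L. strict_mono r \<and> limitin narrow_topology (\<lambda>n. N (r n)) L sequentially"
proof -
  define c where "c k x = (LEAST i. dist x (a i) < (1 / 2) ^ k)" for k and x :: 'e
  have c_dist: "dist x (a (c k x)) < (1 / 2) ^ k" for k x
    unfolding c_def using a[of "(1 / 2) ^ k" x] by (auto intro: LeastI_ex)
  have c_le: "c k x \<le> i" if "dist x (a i) < (1 / 2) ^ k" for k x i
    unfolding c_def using that by (rule Least_le)
  have c_meas: "c k \<in> measurable borel (count_space UNIV)" for k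
    unfolding c_def[abs_def] by measurable
  define code where "code k x = map (\<lambda>j. c j x) [0..<k]" for k x
  have code_simps: "code 0 x = []" "code (Suc k) x = code k x @ [c k x]" "length (code k x) = k" for k x
    by (auto simp: code_def)
  have code_meas: "code k \<in> measurable borel (count_space UNIV)" for k
  proof (induction k)
    case 0
    then show ?case by (simp add: code_simps[abs_def])
  next
    case (Suc k)
    have "(\<lambda>x. (code k x, c k x)) \<in> measurable borel (count_space UNIV \<Otimes>\<^sub>M count_space UNIV)"
      using Suc c_meas by (rule measurable_Pair)
    then have "(\<lambda>x. (code k x, c k x)) \<in> measurable borel (count_space UNIV)"
      by (simp add: pair_measure_countable)
    then have "(\<lambda>x. (\<lambda>(w, i). w @ [i]) (code k x, c k x)) \<in> measurable borel (count_space UNIV)"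
      by (rule measurable_compose) simp
    then show ?case by (simp add: code_simps[abs_def])
  qed
  have code_sets: "{x. code k x = w} \<in> sets borel" for k w
    using measurable_sets[OF code_meas, of "{w}" k] by (simp add: vimage_def)
  define p where "p n w = measure (N n) {x. code (length w) x = w}" for n w
  have p01: "0 \<le> p n w" "p n w \<le> 1" for n w
    using prob_space.prob_le_1[OF borel_prob_measuresD(1)[OF N]] by (auto simp: p_def)
  \<comment> \<open>\<open>from_nat\<close> enumerates all words, so one subsequence makes all
    masses converge.\<close>
  obtain r where r: "strict_mono (r :: nat \<Rightarrow> nat)" and conv: "\<And>i :: nat. convergent (\<lambda>n. p (r n) (from_nat i))"
  proof -
    have "\<exists>r. strict_mono r \<and> (\<forall>i :: nat. convergent (\<lambda>n. p (r n) (from_nat i)))"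
    proof (rule diagonal_subsequence)
      fix i and s :: "nat \<Rightarrow> nat"
      have "bounded (range (\<lambda>n. p (s n) (from_nat i)))"
        using p01 by (intro boundedI[of _ 1]) auto
      from bounded_imp_convergent_subsequence[OF this]
      show "\<exists>r. strict_mono r \<and> convergent (\<lambda>n. p ((s \<circ> r) n) (from_nat i))"
        by (auto simp: convergent_def o_def)
    next
      fix i and s r :: "nat \<Rightarrow> nat" assume "strict_mono r" "convergent (\<lambda>n. p (s n) (from_nat i))"
      then show "convergent (\<lambda>n. p ((s \<circ> r) n) (from_nat i))"
        using convergent_subseq_convergent[of "\<lambda>n. p (s n) (from_nat i)" r] by (simp add: o_def)
    next
      fix i k and s :: "nat \<Rightarrow> nat" assume "convergent (\<lambda>n. p ((s \<circ> (+) k) n) (from_nat i))"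
      then show "convergent (\<lambda>n. p (s n) (from_nat i))"
        using convergent_ignore_initial_segment[of "\<lambda>n. p (s n) (from_nat i)" k] by (simp add: o_def add.commute)
    qed
    then show thesis using that by blast
  qed
  define m where "m w = lim (\<lambda>n. p (r n) w)" for w
  have m: "(\<lambda>n. p (r n) w) \<longlonglongrightarrow> m w" for w
    using conv[of "to_nat w"] by (simp add: m_def convergent_LIMSEQ_iff)
  have m_nonneg: "0 \<le> m w" for w by (rule LIMSEQ_le_const[OF m]) (use p01 in auto)
  \<comment> \<open>The mass of w missed by its extensions with letters below I is that of the
    points of code w whose next letter is at least I.\<close>
  have p_split: "p n w - (\<Sum>i<I. p n (w @ [i])) = measure (N n) {x. code (length w) x = w \<and> I \<le> c (length w) x}" for n w I
  proof -
    interpret prob_space "N n" using borel_prob_measuresD(1)[OF N] .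
    have s: "{x. code (length w) x = w \<and> P (c (length w) x)} \<in> sets (N n)" for P
    proof -
      have "{x. code (length w) x = w \<and> P (c (length w) x)} = {x. code (length w) x = w} \<inter> (c (length w) -` {i. P i} \<inter> space borel)"
        by auto
      also have "\<dots> \<in> sets borel" by (intro sets.Int code_sets measurable_sets[OF c_meas]) simp
      finally show ?thesis by (simp add: borel_prob_measuresD(2)[OF N])
    qed
    have "p n w = measure (N n) ({x. code (length w) x = w \<and> c (length w) x < I} \<union> {x. code (length w) x = w \<and> I \<le> c (length w) x})"
      unfolding p_def by (rule arg_cong[where f="measure (N n)"]) auto
    also have "\<dots> = measure (N n) {x. code (length w) x = w \<and> c (length w) x < I} + measure (N n) {x. code (length w) x = w \<and> I \<le> c (length w) x}"
      by (intro finite_measure_Union s) auto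
    also have "{x. code (length w) x = w \<and> c (length w) x < I} = (\<Union>i<I. {x. code (length w) x = w \<and> c (length w) x = i})"
      by auto
    also have "measure (N n) \<dots> = (\<Sum>i<I. measure (N n) {x. code (length w) x = w \<and> c (length w) x = i})"
      by (intro finite_measure_finite_Union) (use s in \<open>auto simp: disjoint_family_on_def\<close>)
    also have "\<dots> = (\<Sum>i<I. p n (w @ [i]))"
      by (auto simp: p_def code_simps intro!: sum.cong arg_cong[where f="measure (N n)"])
    finally show ?thesis by simp
  qed
  \<comment> \<open>A letter above j means lying in none of the first balls up to index j. Tightness
    bounds this mass uniformly in n, so no mass of w is lost in the limit.\<close>
  have m_split: "(\<lambda>i. m (w @ [i])) sums m w" for w
    unfolding sums_def
  proof (rule LIMSEQ_I)
    fix \<epsilon> :: real assume \<epsilon>: "\<epsilon> > 0"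
    define k where "k = length w"
    obtain j where j: "\<And>n. 1 - \<epsilon> / 2 \<le> measure (N n) (\<Union>i\<le>j. ball (a i) ((1 / 2) ^ k))"
      using tight[of "(1 / 2) ^ k" "\<epsilon> / 2"] \<epsilon> by auto
    have "norm ((\<Sum>i<I. m (w @ [i])) - m w) < \<epsilon>" if I: "I \<ge> Suc j" for I
    proof -
      have lim: "(\<lambda>n. p (r n) w - (\<Sum>i<I. p (r n) (w @ [i]))) \<longlonglongrightarrow> m w - (\<Sum>i<I. m (w @ [i]))"
        by (intro tendsto_intros m)
      have "p n w - (\<Sum>i<I. p n (w @ [i])) \<le> \<epsilon> / 2" for n
      proof -
        interpret prob_space "N n" using borel_prob_measuresD(1)[OF N] .
        have s: "(\<Union>i\<le>j. ball (a i) ((1 / 2) ^ k)) \<in> sets (N n)"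
          by (auto simp: borel_prob_measuresD(2)[OF N])
        have "measure (N n) {x. code (length w) x = w \<and> I \<le> c (length w) x} \<le> measure (N n) (space (N n) - (\<Union>i\<le>j. ball (a i) ((1 / 2) ^ k)))"
        proof (rule finite_measure_mono)
          show "{x. code (length w) x = w \<and> I \<le> c (length w) x} \<subseteq> space (N n) - (\<Union>i\<le>j. ball (a i) ((1 / 2) ^ k))"
          proof safe
            fix x i assume "I \<le> c (length w) x" "i \<le> j" "x \<in> ball (a i) ((1 / 2) ^ k)"
            then show False using c_le[of x i k] I by (simp add: dist_commute k_def)
          qed (simp add: borel_prob_measuresD(3)[OF N])
        qed (use s in auto)
        also have "\<dots> \<le> \<epsilon> / 2" using prob_compl[OF s] j[of n] by simp
        finally show ?thesis using p_split[of n w I] by simp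
      qed
      then have "m w - (\<Sum>i<I. m (w @ [i])) \<le> \<epsilon> / 2" by (intro LIMSEQ_le_const2[OF lim]) auto
      moreover have "0 \<le> m w - (\<Sum>i<I. m (w @ [i]))"
        using p_split by (intro LIMSEQ_le_const[OF lim]) auto
      ultimately show ?thesis using \<epsilon> by (simp add: abs_if)
    qed
    then show "\<exists>no. \<forall>n\<ge>no. norm ((\<Sum>i<n. m (w @ [i])) - m w) < \<epsilon>" by blast
  qed
  have "p n [] = 1" for n
    using prob_space.prob_space[OF borel_prob_measuresD(1)[OF N, of n]] borel_prob_measuresD(3)[OF N, of n]
    by (simp add: p_def code_simps)
  then have "m [] = 1" using m[of "[]"] by (simp add: LIMSEQ_const_iff)
  then interpret word_masses m by unfold_locales (auto intro: m_nonneg m_split)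
  interpret \<Omega>: prob_space unit_space by (rule prob_space_unit_space)
  \<comment> \<open>A representative with code w; the choice is arbitrary when w is the code of no
    point.\<close>
  define pt where "pt w = (SOME x. code (length w) x = w)" for w
  have pt_code: "code k (pt (code k x)) = code k x" for k x
    unfolding pt_def by (rule someI2[of _ x]) (simp_all add: code_simps)
  \<comment> \<open>A word selected by u owns a nonempty interval, hence has positive limit mass,
    hence positive mass under some \<open>N (r n)\<close>; so it is the code of a point.\<close>
  have pt_word: "code k (pt (word u k)) = word u k" if u: "u \<in> {0..<1}" for u k
  proof -
    have "0 < m (word u k)" using word_interval[OF u, of k] by auto
    then have "\<forall>\<^sub>F n in sequentially. 0 < p (r n) (word u k)" using m by (intro order_tendstoD(1))
    then obtain n where "0 < p (r n) (word u k)" by (auto simp: eventually_sequentially)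
    then obtain x where "code k x = word u k"
      unfolding p_def length_word by (metis (mono_tags, lifting) Collect_empty_eq less_irrefl measure_empty)
    then show ?thesis using pt_code[of k x] by simp
  qed
  \<comment> \<open>Equal letters at scale \<open>(1 / 2) ^ k\<close> put both points in the same
    ball of that radius.\<close>
  have close: "dist x y \<le> 2 * (1 / 2) ^ k" if "c k x = c k y" for x y k
    using c_dist[of x k] c_dist[of y k] that dist_triangle2[of x y "a (c k y)"] by simp
  have c_word: "c k (pt (word u l)) = word u (Suc k) ! k" if u: "u \<in> {0..<1}" and "k < l" for u k l
  proof -
    have "c k (pt (word u l)) = code l (pt (word u l)) ! k" using that(2) by (simp add: code_def)
    also have "\<dots> = word u l ! k" by (simp only: pt_word[OF u])
    also have "\<dots> = take (Suc k) (word u l) ! k" by simp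
    also have "\<dots> = word u (Suc k) ! k" using that(2) by (simp only: take_word Suc_leI)
    finally show ?thesis .
  qed
  have close_word: "dist (pt (word u l)) (pt (word u l')) \<le> 2 * (1 / 2) ^ k"
    if "u \<in> {0..<1}" "k < l" "k < l'" for u k l l'
    by (rule close) (simp only: c_word[OF that(1,2)] c_word[OF that(1,3)])
  have small: "(\<lambda>k. 2 * (1 / 2 :: real) ^ k) \<longlonglongrightarrow> 0"
    using tendsto_mult_left[OF LIMSEQ_power_zero[of "1/2 :: real"], of 2] by simp
  have "Cauchy (\<lambda>k. pt (word u k))" if u: "u \<in> {0..<1}" for u
    unfolding Cauchy_def
  proof (intro allI impI)
    fix e :: real assume "e > 0"
    then have "\<forall>\<^sub>F k in sequentially. 2 * (1 / 2 :: real) ^ k < e" using small by (intro order_tendstoD(2)[OF small])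
    then obtain k where "2 * (1 / 2 :: real) ^ k < e" by (auto simp: eventually_sequentially)
    then show "\<exists>M. \<forall>i\<ge>M. \<forall>j\<ge>M. dist (pt (word u i)) (pt (word u j)) < e"
      using close_word[OF u, of k] by (intro exI[of _ "Suc k"]) (meson Suc_le_lessD le_less_trans)
  qed
  define \<zeta> where "\<zeta> u = lim (\<lambda>k. pt (word u k))" for u
  have \<zeta>: "(\<lambda>k. pt (word u k)) \<longlonglongrightarrow> \<zeta> u" if "u \<in> {0..<1}" for u
    using Cauchy_convergent[OF \<open>\<And>u. u \<in> {0..<1} \<Longrightarrow> Cauchy (\<lambda>k. pt (word u k))\<close>[OF that]]
    unfolding \<zeta>_def convergent_LIMSEQ_iff .
  have \<zeta>_meas: "\<zeta> \<in> borel_measurable unit_space"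
  proof (rule borel_measurable_LIMSEQ_metric[where f="\<lambda>k u. pt (word u k)"])
    show "(\<lambda>u. pt (word u k)) \<in> borel_measurable unit_space" for k
      using measurable_compose[OF measurable_word, of pt borel k] by simp
  qed (simp add: \<zeta> space_unit_space)
  define L where "L = distr unit_space borel \<zeta>"
  have L: "L \<in> borel_prob_measures"
    unfolding L_def by (rule distr_borel_prob_measures[OF prob_space_unit_space \<zeta>_meas])
  have "limitin narrow_topology (\<lambda>n. N (r n)) L sequentially"
  proof (rule limitin_narrow_lipschitzI[OF N L])
    fix \<phi> :: "'e \<Rightarrow> real" and C assume lip: "C-lipschitz_on UNIV \<phi>" and "bounded (range \<phi>)"
    then obtain B where B: "\<And>x. \<bar>\<phi> x\<bar> \<le> B" unfolding bounded_iff by auto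
    have C: "C \<ge> 0" by (rule lipschitz_on_nonneg[OF lip])
    have \<phi>_meas: "\<phi> \<in> borel_measurable borel"
      by (intro borel_measurable_continuous_onI lipschitz_on_continuous_on[OF lip])
    have lipD: "\<bar>\<phi> x - \<phi> y\<bar> \<le> C * d" if "dist x y \<le> d" for x y d
      using lipschitz_onD[OF lip, of x y] mult_left_mono[OF that C] by (simp add: dist_real_def)
    show "(\<lambda>n. \<integral>x. \<phi> x \<partial>N (r n)) \<longlonglongrightarrow> (\<integral>x. \<phi> x \<partial>L)"
    proof (rule tendstoI)
      fix e :: real assume e: "e > 0"
      have "(\<lambda>k. C * (2 * (1 / 2) ^ k)) \<longlonglongrightarrow> 0" using tendsto_mult_left[OF small, of C] by simp
      then have "\<forall>\<^sub>F k in sequentially. C * (2 * (1 / 2) ^ k) < e / 3" using e by (intro order_tendstoD(2)) auto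
      then obtain k where k: "C * (2 * (1 / 2) ^ k) < e / 3" by (auto simp: eventually_sequentially)
      \<comment> \<open>The test function is read off at the representative of a code. The codes
        used below have length \<open>Suc k\<close>, the shortest that include the letter of scale
        \<open>(1 / 2) ^ k\<close>.\<close>
      define G where "G w = \<phi> (pt w)" for w
      have G_meas: "(\<lambda>x. G (code (Suc k) x)) \<in> borel_measurable borel"
        using measurable_compose[OF code_meas, of G borel "Suc k"] by simp
      have 1: "\<bar>(\<integral>x. \<phi> x \<partial>N n) - (\<integral>x. G (code (Suc k) x) \<partial>N n)\<bar> \<le> e / 3" for n
      proof -
        interpret prob_space "N n" using borel_prob_measuresD(1)[OF N] .
        have i: "integrable (N n) \<phi>" "integrable (N n) (\<lambda>x. G (code (Suc k) x))"
          using B by (auto intro!: integrable_borel_prob_measures[OF N, where B=B] \<phi>_meas G_meas) (simp add: G_def)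
        have pw: "\<bar>\<phi> x - G (code (Suc k) x)\<bar> \<le> e / 3" for x
        proof -
          have "c k x = c k (pt (code (Suc k) x))" using pt_code[of "Suc k" x] by (simp add: code_simps)
          from lipD[OF close[OF this]] show ?thesis using k by (simp add: G_def)
        qed
        have "\<bar>\<integral>x. \<phi> x - G (code (Suc k) x) \<partial>N n\<bar> \<le> (\<integral>x. \<bar>\<phi> x - G (code (Suc k) x)\<bar> \<partial>N n)"
          by (rule integral_abs_bound)
        also have "\<dots> \<le> (\<integral>x. e / 3 \<partial>N n)" using pw i by (intro integral_mono) auto
        finally show ?thesis using i by (simp add: prob_space)
      qed
      have 2: "\<bar>(\<integral>x. \<phi> x \<partial>L) - (\<integral>u. G (word u (Suc k)) \<partial>unit_space)\<bar> \<le> e / 3"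
      proof -
        have mm: "(\<lambda>u. G (word u (Suc k))) \<in> borel_measurable unit_space"
          by (rule measurable_compose[OF measurable_word]) simp
        have i: "integrable unit_space (\<lambda>u. \<phi> (\<zeta> u))" "integrable unit_space (\<lambda>u. G (word u (Suc k)))"
          by (rule \<Omega>.integrable_const_bound[where B=B, OF _ measurable_compose[OF \<zeta>_meas \<phi>_meas]], simp add: B)
            (rule \<Omega>.integrable_const_bound[where B=B, OF _ mm], simp add: B G_def)
        have pw: "\<bar>\<phi> (\<zeta> u) - G (word u (Suc k))\<bar> \<le> e / 3" if u: "u \<in> space unit_space" for u
        proof -
          have u': "u \<in> {0..<1}" using u by (simp add: space_unit_space)
          have "dist (\<zeta> u) (pt (word u (Suc k))) \<le> 2 * (1 / 2) ^ k"
          proof (rule tendsto_upperbound[OF tendsto_dist[OF \<zeta>[OF u'] tendsto_const]])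
            show "\<forall>\<^sub>F l in sequentially. dist (pt (word u l)) (pt (word u (Suc k))) \<le> 2 * (1 / 2) ^ k"
              using eventually_gt_at_top[of k] by eventually_elim (rule close_word[OF u'], auto)
          qed simp
          from lipD[OF this] show ?thesis using k by (simp add: G_def)
        qed
        have "\<bar>\<integral>u. \<phi> (\<zeta> u) - G (word u (Suc k)) \<partial>unit_space\<bar> \<le> (\<integral>u. \<bar>\<phi> (\<zeta> u) - G (word u (Suc k))\<bar> \<partial>unit_space)"
          by (rule integral_abs_bound)
        also have "\<dots> \<le> (\<integral>u. e / 3 \<partial>unit_space)" using pw i by (intro integral_mono) auto
        finally show ?thesis using i by (simp add: \<Omega>.prob_space L_def integral_distr[OF \<zeta>_meas \<phi>_meas])
      qed
      have "(\<lambda>n. \<integral>x. G (code (Suc k) x) \<partial>N (r n)) \<longlonglongrightarrow> (\<integral>u. G (word u (Suc k)) \<partial>unit_space)"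
      proof (rule tendsto_integral_countable_valued[OF borel_prob_measuresD(1)[OF N] _ prob_space_unit_space measurable_word])
        show "code (Suc k) \<in> measurable (N (r n)) (count_space UNIV)" for n
          using code_meas measurable_cong_sets[OF borel_prob_measuresD(2)[OF N]] by blast
        show "\<bar>G w\<bar> \<le> B" for w by (simp add: G_def B)
        fix w
        show "(\<lambda>n. measure (N (r n)) {x\<in>space (N (r n)). code (Suc k) x = w}) \<longlonglongrightarrow> measure unit_space {u\<in>space unit_space. word u (Suc k) = w}"
        proof (cases "length w = Suc k")
          case True
          then show ?thesis using m[of w] by (simp add: measure_word p_def borel_prob_measuresD(3)[OF N])
        next
          case False
          then have "{x\<in>space (N (r n)). code (Suc k) x = w} = {}" for n using code_simps(3)[of "Suc k"] by auto
          then show ?thesis using False by (simp only: measure_word if_False measure_empty tendsto_const)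
        qed
      qed
      then have "\<forall>\<^sub>F n in sequentially. dist (\<integral>x. G (code (Suc k) x) \<partial>N (r n)) (\<integral>u. G (word u (Suc k)) \<partial>unit_space) < e / 3"
        using e by (intro tendstoD) auto
      then show "\<forall>\<^sub>F n in sequentially. dist (\<integral>x. \<phi> x \<partial>N (r n)) (\<integral>x. \<phi> x \<partial>L) < e"
      proof eventually_elim
        case (elim n)
        then show ?case using 1[of "r n"] 2 unfolding dist_real_def by linarith
      qed
    qed
  qed
  then show ?thesis using r by blast
qed

section \<open>The bounded Lipschitz distance\<close>

definition bl_class :: "('e::metric_space \<Rightarrow> real) set" where
  "bl_class = {\<phi>. 1-lipschitz_on UNIV \<phi> \<and> (\<forall>x. \<bar>\<phi> x\<bar> \<le> 1)}"

text \<open>\<open>Metric_space\<close> demands nonnegativity and symmetry for all arguments, also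
  outside the carrier; the value 0 there provides both.\<close>

definition bl_dist :: "'e::metric_space measure \<Rightarrow> 'e measure \<Rightarrow> real" where
  "bl_dist N N' = (if N \<in> borel_prob_measures \<and> N' \<in> borel_prob_measures
    then SUP \<phi>\<in>bl_class. \<bar>(\<integral>x. \<phi> x \<partial>N) - (\<integral>x. \<phi> x \<partial>N')\<bar> else 0)"

lemma bl_class_measurable: "\<phi> \<in> bl_class \<Longrightarrow> \<phi> \<in> borel_measurable borel"
  unfolding bl_class_def by (auto intro!: borel_measurable_continuous_onI lipschitz_on_continuous_on)

lemma zero_in_bl_class: "(\<lambda>_. 0) \<in> bl_class"
  by (auto simp: bl_class_def intro!: lipschitz_onI)

lemma bl_class_integral_bound:
  assumes "\<phi> \<in> bl_class" "N \<in> borel_prob_measures"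
  shows "\<bar>\<integral>x. \<phi> x \<partial>N\<bar> \<le> 1"
proof -
  interpret prob_space N using borel_prob_measuresD(1)[OF assms(2)] .
  have b: "\<bar>\<phi> x\<bar> \<le> 1" for x using assms(1) by (simp add: bl_class_def)
  have "\<bar>\<integral>x. \<phi> x \<partial>N\<bar> \<le> (\<integral>x. \<bar>\<phi> x\<bar> \<partial>N)" by (rule integral_abs_bound)
  also have "\<dots> \<le> (\<integral>x. 1 \<partial>N)"
    using b by (intro integral_mono integrable_abs integrable_borel_prob_measures[OF assms(2) bl_class_measurable[OF assms(1)], of 1]) auto
  finally show ?thesis by (simp add: prob_space)
qed

lemma bl_dist_upper:
  assumes "\<phi> \<in> bl_class" "N \<in> borel_prob_measures" "N' \<in> borel_prob_measures"
  shows "\<bar>(\<integral>x. \<phi> x \<partial>N) - (\<integral>x. \<phi> x \<partial>N')\<bar> \<le> bl_dist N N'"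
proof -
  have "bdd_above ((\<lambda>\<phi>. \<bar>(\<integral>x. \<phi> x \<partial>N) - (\<integral>x. \<phi> x \<partial>N')\<bar>) ` bl_class)"
  proof (rule bdd_aboveI2)
    fix \<phi> :: "'a \<Rightarrow> real" assume \<phi>: "\<phi> \<in> bl_class"
    show "\<bar>(\<integral>x. \<phi> x \<partial>N) - (\<integral>x. \<phi> x \<partial>N')\<bar> \<le> 2"
      using bl_class_integral_bound[OF \<phi> assms(2)] bl_class_integral_bound[OF \<phi> assms(3)] by linarith
  qed
  from cSUP_upper[OF assms(1) this] show ?thesis using assms by (simp add: bl_dist_def)
qed

lemma bl_dist_least:
  assumes "N \<in> borel_prob_measures" "N' \<in> borel_prob_measures"
    and "\<And>\<phi>. \<phi> \<in> bl_class \<Longrightarrow> \<bar>(\<integral>x. \<phi> x \<partial>N) - (\<integral>x. \<phi> x \<partial>N')\<bar> \<le> c"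
  shows "bl_dist N N' \<le> c"
proof -
  have "bl_class \<noteq> {}" using zero_in_bl_class by blast
  then have "(SUP \<phi>\<in>bl_class. \<bar>(\<integral>x. \<phi> x \<partial>N) - (\<integral>x. \<phi> x \<partial>N')\<bar>) \<le> c"
    using assms(3) by (rule cSUP_least)
  then show ?thesis using assms(1,2) by (simp add: bl_dist_def)
qed

lemma bl_dist_lipschitz:
  fixes \<phi> :: "'e::metric_space \<Rightarrow> real"
  assumes N: "N \<in> borel_prob_measures" "N' \<in> borel_prob_measures"
    and \<phi>: "C-lipschitz_on UNIV \<phi>" "\<And>x. \<bar>\<phi> x\<bar> \<le> B"
  shows "\<bar>(\<integral>x. \<phi> x \<partial>N) - (\<integral>x. \<phi> x \<partial>N')\<bar> \<le> (C + B + 1) * bl_dist N N'"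
proof -
  have C: "C \<ge> 0" by (rule lipschitz_on_nonneg[OF \<phi>(1)])
  have B: "B \<ge> 0" using \<phi>(2) abs_ge_zero order_trans by blast
  \<comment> \<open>Dividing by D brings both the Lipschitz constant and the bound below 1; the
    added 1 makes D positive.\<close>
  define D where "D = C + B + 1"
  have D: "D > 0" "C \<le> D" "B \<le> D" using B C by (auto simp: D_def)
  have "(\<lambda>x. \<phi> x / D) \<in> bl_class"
    unfolding bl_class_def
  proof (safe intro!: lipschitz_onI)
    fix x y :: 'e
    have "\<bar>\<phi> x - \<phi> y\<bar> \<le> C * dist x y" using lipschitz_onD[OF \<phi>(1), of x y] by (simp add: dist_real_def)
    also have "\<dots> \<le> D * dist x y" using D(2) by (intro mult_right_mono) auto
    finally show "dist (\<phi> x / D) (\<phi> y / D) \<le> 1 * dist x y"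
      using D(1) by (simp add: dist_real_def diff_divide_distrib[symmetric] field_simps)
    show "\<bar>\<phi> x / D\<bar> \<le> 1" using \<phi>(2)[of x] D by (simp add: field_simps)
  qed simp
  from bl_dist_upper[OF this N]
  have "\<bar>(\<integral>x. \<phi> x \<partial>N) / D - (\<integral>x. \<phi> x \<partial>N') / D\<bar> \<le> bl_dist N N'" by simp
  then have "\<bar>(\<integral>x. \<phi> x \<partial>N) - (\<integral>x. \<phi> x \<partial>N')\<bar> / D \<le> bl_dist N N'"
    using D(1) by (simp add: diff_divide_distrib[symmetric])
  then have "\<bar>(\<integral>x. \<phi> x \<partial>N) - (\<integral>x. \<phi> x \<partial>N')\<bar> \<le> D * bl_dist N N'"
    using D(1) by (simp add: field_simps)
  then show ?thesis by (simp only: D_def)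
qed

lemma bl_dist_tendsto_imp_narrow:
  assumes N: "\<And>n. N n \<in> borel_prob_measures" "L \<in> borel_prob_measures"
    and lim: "(\<lambda>n. bl_dist (N n) L) \<longlonglongrightarrow> 0"
  shows "limitin narrow_topology N L sequentially"
proof (rule limitin_narrow_lipschitzI[OF N])
  fix \<phi> :: "'a \<Rightarrow> real" and C assume \<phi>: "C-lipschitz_on UNIV \<phi>" and "bounded (range \<phi>)"
  then obtain B where B: "\<And>x. \<bar>\<phi> x\<bar> \<le> B" unfolding bounded_iff by auto
  have "(\<lambda>n. (C + B + 1) * bl_dist (N n) L) \<longlonglongrightarrow> 0" using tendsto_mult_left[OF lim, of "C + B + 1"] by simp
  then have "(\<lambda>n. (\<integral>x. \<phi> x \<partial>N n) - (\<integral>x. \<phi> x \<partial>L)) \<longlonglongrightarrow> 0"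
    by (rule Lim_null_comparison[rotated])
      (use bl_dist_lipschitz[OF N \<phi> B] in simp)
  then show "(\<lambda>n. \<integral>x. \<phi> x \<partial>N n) \<longlonglongrightarrow> (\<integral>x. \<phi> x \<partial>L)" by (simp add: LIM_zero_iff)
qed

text \<open>Closed sets form an intersection-stable generator, and the indicator of a closed set is
  the pointwise limit of its bumps with shrinking width.\<close>

lemma borel_prob_measures_eqI:
  fixes N :: "'e::metric_space measure"
  assumes N: "N \<in> borel_prob_measures" "N' \<in> borel_prob_measures"
    and eq: "\<And>\<phi> :: 'e \<Rightarrow> real. continuous_on UNIV \<phi> \<Longrightarrow> bounded (range \<phi>) \<Longrightarrow> (\<integral>x. \<phi> x \<partial>N) = (\<integral>x. \<phi> x \<partial>N')"
  shows "N = N'"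
proof -
  interpret N: prob_space N using borel_prob_measuresD(1)[OF N(1)] .
  interpret N': prob_space N' using borel_prob_measuresD(1)[OF N(2)] .
  show ?thesis
  proof (rule measure_eqI_generator_eq[where E="Collect closed" and \<Omega>=UNIV and A="\<lambda>_. UNIV"])
    show "sets N = sigma_sets UNIV (Collect closed)" "sets N' = sigma_sets UNIV (Collect closed)"
      by (simp_all add: borel_prob_measuresD(2)[OF N(1)] borel_prob_measuresD(2)[OF N(2)] borel_eq_closed)
    fix F :: "'e set" assume "F \<in> Collect closed"
    then have F: "closed F" by simp
    show "emeasure N F = emeasure N' F"
    proof (cases "F = {}")
      case False
      have lim: "(\<lambda>k. bump (1 / real (Suc k)) F x) \<longlonglongrightarrow> indicator F x" for x
      proof (cases "x \<in> F")
        case True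
        then show ?thesis by (simp add: bump_def)
      next
        case x: False
        then have "infdist x F > 0" using F False infdist_pos_not_in_closed by blast
        then obtain k0 where k0: "1 / infdist x F \<le> real k0" using real_arch_simple by blast
        have "\<forall>\<^sub>F k in sequentially. bump (1 / real (Suc k)) F x = 0"
          using eventually_ge_at_top[of k0]
        proof eventually_elim
          case (elim k)
          have "1 / infdist x F \<le> real (Suc k)" using k0 elim by linarith
          then have "1 \<le> infdist x F * real (Suc k)"
            using \<open>infdist x F > 0\<close> by (simp add: field_simps)
          then show ?case by (simp add: bump_def)
        qed
        then show ?thesis using x by (simp add: tendsto_eventually)
      qed
      have "(\<lambda>k. \<integral>x. bump (1 / real (Suc k)) F x \<partial>\<nu>) \<longlonglongrightarrow> measure \<nu> F" if \<nu>: "\<nu> \<in> borel_prob_measures" for \<nu>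
      proof -
        interpret prob_space \<nu> using borel_prob_measuresD(1)[OF \<nu>] .
        have b1: "bump (1 / real (Suc k)) F x \<le> 1" for k x by (rule bump_bounds(2)) simp
        have Fs: "F \<in> sets \<nu>" using F by (simp add: borel_prob_measuresD(2)[OF \<nu>])
        have "(\<lambda>k. \<integral>x. bump (1 / real (Suc k)) F x \<partial>\<nu>) \<longlonglongrightarrow> (\<integral>x. indicator F x \<partial>\<nu>)"
          using lim b1 Fs
          by (intro integral_dominated_convergence[where w="\<lambda>_. 1"] measurable_borel_prob_measures[OF \<nu> bump_measurable])
            (auto simp: abs_of_nonneg[OF bump_bounds(1)])
        then show ?thesis using Fs by simp
      qed
      note limN = this
      have "(\<integral>x. bump (1 / real (Suc k)) F x \<partial>N) = (\<integral>x. bump (1 / real (Suc k)) F x \<partial>N')" for k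
      proof (rule eq)
        show "continuous_on UNIV (bump (1 / real (Suc k)) F)"
          by (rule lipschitz_on_continuous_on[OF bump_lipschitz]) simp
        show "bounded (range (bump (1 / real (Suc k)) F))"
          using bump_bounds[of "1 / real (Suc k)" F] by (auto intro!: boundedI[of _ 1] simp: abs_of_nonneg[OF bump_bounds(1)])
      qed
      then have "measure N F = measure N' F"
        using LIMSEQ_unique[OF limN[OF N(1)]] limN[OF N(2)] by simp
      then show ?thesis by (simp add: N.emeasure_eq_measure N'.emeasure_eq_measure)
    qed simp
  qed (auto simp: Int_stable_def N.emeasure_eq_measure)
qed

lemma Metric_space_bl_dist: "Metric_space borel_prob_measures (bl_dist :: 'e::metric_space measure \<Rightarrow> _)"
proof
  fix N N' :: "'e measure"
  show "0 \<le> bl_dist N N'"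
    using bl_dist_upper[OF zero_in_bl_class, of N N'] by (cases "N \<in> borel_prob_measures \<and> N' \<in> borel_prob_measures") (auto simp: bl_dist_def)
  show "bl_dist N N' = bl_dist N' N"
    by (auto simp: bl_dist_def abs_minus_commute)
next
  fix N N' :: "'e measure" assume N: "N \<in> borel_prob_measures" "N' \<in> borel_prob_measures"
  show "bl_dist N N' = 0 \<longleftrightarrow> N = N'"
  proof
    assume "bl_dist N N' = 0"
    \<comment> \<open>At distance 0 the constant sequence N converges narrowly to \<open>N'\<close>,
      so all integrals of test functions agree.\<close>
    then have lim: "limitin narrow_topology (\<lambda>_::nat. N) N' sequentially"
      using N by (intro bl_dist_tendsto_imp_narrow) auto
    show "N = N'"
    proof (rule borel_prob_measures_eqI[OF N])
      fix \<phi> :: "'e \<Rightarrow> real" assume "continuous_on UNIV \<phi>" "bounded (range \<phi>)"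
      then have "(\<lambda>_::nat. \<integral>x. \<phi> x \<partial>N) \<longlonglongrightarrow> (\<integral>x. \<phi> x \<partial>N')" using lim unfolding limitin_narrow_iff by blast
      then show "(\<integral>x. \<phi> x \<partial>N) = (\<integral>x. \<phi> x \<partial>N')" by (simp add: LIMSEQ_const_iff)
    qed
  next
    assume "N = N'"
    then have "bl_dist N N' \<le> 0" using N by (intro bl_dist_least) auto
    moreover have "0 \<le> bl_dist N N'" using bl_dist_upper[OF zero_in_bl_class N] by simp
    ultimately show "bl_dist N N' = 0" by simp
  qed
next
  fix N N' N'' :: "'e measure"
  assume N: "N \<in> borel_prob_measures" "N' \<in> borel_prob_measures" "N'' \<in> borel_prob_measures"
  show "bl_dist N N'' \<le> bl_dist N N' + bl_dist N' N''"
  proof (rule bl_dist_least[OF N(1,3)])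
    fix \<phi> :: "'e \<Rightarrow> real" assume "\<phi> \<in> bl_class"
    from bl_dist_upper[OF this N(1,2)] bl_dist_upper[OF this N(2,3)]
    show "\<bar>(\<integral>x. \<phi> x \<partial>N) - (\<integral>x. \<phi> x \<partial>N'')\<bar> \<le> bl_dist N N' + bl_dist N' N''" by linarith
  qed
qed

section \<open>Partition of unity and comparison with the narrow topology\<close>

lemma bump_mono:
  assumes "\<delta> > 0" "A \<subseteq> A'" "A \<noteq> {}"
  shows "bump \<delta> A x \<le> bump \<delta> A' x"
proof -
  have "infdist x A' / \<delta> \<le> infdist x A / \<delta>"
    using assms by (intro divide_right_mono infdist_mono) auto
  then show ?thesis by (simp add: bump_def)
qed

text \<open>When \<open>a\<close> is dense, the increments of \<open>m \<mapsto> bump \<delta> (a ` {..m})\<close> form a partition of unity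
  into functions of small support.\<close>

definition bump_step :: "real \<Rightarrow> (nat \<Rightarrow> 'e::metric_space) \<Rightarrow> nat \<Rightarrow> 'e \<Rightarrow> real" where
  "bump_step \<delta> a i x = (case i of 0 \<Rightarrow> bump \<delta> (a ` {..0}) x
    | Suc j \<Rightarrow> bump \<delta> (a ` {..Suc j}) x - bump \<delta> (a ` {..j}) x)"

lemma sum_bump_step: "(\<Sum>i\<le>m. bump_step \<delta> a i x) = bump \<delta> (a ` {..m}) x"
  by (induction m) (simp_all add: bump_step_def)

lemma bump_step_nonneg: "\<delta> > 0 \<Longrightarrow> 0 \<le> bump_step \<delta> a i x"
  by (cases i) (auto simp: bump_step_def bump_bounds(1) intro!: bump_mono)

lemma bump_step_le_1: "\<delta> > 0 \<Longrightarrow> bump_step \<delta> a i x \<le> 1"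
proof (cases i)
  case (Suc j)
  assume "\<delta> > 0"
  then show ?thesis using bump_bounds[of \<delta> "a ` {..j}" x] bump_bounds(2)[of \<delta> "a ` {..Suc j}" x] by (simp add: bump_step_def Suc del: atMost_Suc)
qed (simp add: bump_step_def bump_bounds)

lemma continuous_on_bump_step: "\<delta> > 0 \<Longrightarrow> continuous_on UNIV (bump_step \<delta> a i)"
  unfolding bump_step_def[abs_def]
  by (cases i) (auto intro!: continuous_intros lipschitz_on_continuous_on[OF bump_lipschitz] simp del: atMost_Suc)

text \<open>The increment is nonzero only where adding \<open>a i\<close> lowers the distance to the
  points so far; there \<open>a i\<close> is a nearest point, and the bump is positive.\<close>

lemma bump_step_support:
  assumes \<delta>: "\<delta> > 0" and pos: "bump_step \<delta> a i x \<noteq> 0"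
  shows "dist x (a i) < \<delta>"
proof (cases i)
  case 0
  have "\<not> 1 \<le> infdist x {a 0} / \<delta>"
    using pos by (auto simp: bump_step_def bump_def 0)
  then show ?thesis using \<delta> 0 by (simp add: infdist_def)
next
  case (Suc j)
  have I: "infdist x (a ` {..Suc j}) = min (infdist x (a ` {..j})) (dist x (a (Suc j)))"
  proof -
    have "infdist x (a ` {..j} \<union> {a (Suc j)}) = min (infdist x (a ` {..j})) (infdist x {a (Suc j)})"
      by (rule infdist_Un_min) auto
    moreover have "a ` {..Suc j} = a ` {..j} \<union> {a (Suc j)}" by (auto simp: atMost_Suc)
    ultimately show ?thesis by (simp add: infdist_def)
  qed
  have ne: "bump \<delta> (a ` {..Suc j}) x \<noteq> bump \<delta> (a ` {..j}) x"
    using pos by (simp add: bump_step_def Suc del: atMost_Suc)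
  then have "infdist x (a ` {..Suc j}) = dist x (a (Suc j))"
    unfolding bump_def I by (auto simp: min_def split: if_splits)
  moreover have "bump \<delta> (a ` {..Suc j}) x > 0"
    using ne bump_mono[OF \<delta>, of "a ` {..j}" "a ` {..Suc j}" x] bump_bounds(1)[of \<delta> "a ` {..j}" x] by force
  then have "infdist x (a ` {..Suc j}) / \<delta> < 1" by (simp add: bump_def del: atMost_Suc)
  ultimately show ?thesis using \<delta> Suc by simp
qed

text \<open>The error bound is the same for all of \<open>bl_class\<close>, so finitely many
  integrals of \<open>bump_step\<close> control the whole supremum.\<close>

lemma bl_class_approx:
  fixes N :: "'e::metric_space measure"
  assumes \<phi>: "\<phi> \<in> bl_class" and N: "N \<in> borel_prob_measures" and \<delta>: "\<delta> > 0"
  shows "\<bar>(\<integral>x. \<phi> x \<partial>N) - (\<Sum>i\<le>m. \<phi> (a i) * (\<integral>x. bump_step \<delta> a i x \<partial>N))\<bar>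
    \<le> \<delta> + (1 - (\<integral>x. bump \<delta> (a ` {..m}) x \<partial>N))"
proof -
  interpret prob_space N using borel_prob_measuresD(1)[OF N] .
  have i\<phi>: "integrable N \<phi>"
    using \<phi> by (intro integrable_borel_prob_measures[OF N bl_class_measurable[OF \<phi>], of 1]) (auto simp: bl_class_def)
  have istep: "integrable N (bump_step \<delta> a i)" for i
    using bump_step_nonneg[OF \<delta>] bump_step_le_1[OF \<delta>]
    by (intro integrable_borel_prob_measures[OF N borel_measurable_continuous_onI[OF continuous_on_bump_step[OF \<delta>]], where B=1])
      (simp add: abs_of_nonneg[OF bump_step_nonneg[OF \<delta>]])
  have ibump: "integrable N (bump \<delta> (a ` {..m}))"
    using bump_bounds(2)[OF \<delta>]
    by (intro integrable_borel_prob_measures[OF N bump_measurable[OF \<delta>], of _ 1]) (simp add: abs_of_nonneg[OF bump_bounds(1)])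
  have pw: "\<bar>\<phi> x - (\<Sum>i\<le>m. \<phi> (a i) * bump_step \<delta> a i x)\<bar> \<le> \<delta> + (1 - bump \<delta> (a ` {..m}) x)" for x
  proof -
    let ?s = "\<lambda>i. bump_step \<delta> a i x" and ?M = "bump \<delta> (a ` {..m}) x"
    have lip: "1-lipschitz_on UNIV \<phi>" and b: "\<And>x. \<bar>\<phi> x\<bar> \<le> 1" using \<phi> by (simp_all add: bl_class_def)
    have M: "0 \<le> ?M" "?M \<le> 1" using bump_bounds(1) bump_bounds(2)[OF \<delta>] by auto
    have "\<phi> x - (\<Sum>i\<le>m. \<phi> (a i) * ?s i) = (\<Sum>i\<le>m. (\<phi> x - \<phi> (a i)) * ?s i) + (1 - ?M) * \<phi> x"
      by (simp add: left_diff_distrib sum_subtractf sum_distrib_left[symmetric] sum_bump_step algebra_simps)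
    also have "\<bar>\<dots>\<bar> \<le> (\<Sum>i\<le>m. \<bar>(\<phi> x - \<phi> (a i)) * ?s i\<bar>) + \<bar>(1 - ?M) * \<phi> x\<bar>"
      by (rule order_trans[OF abs_triangle_ineq add_right_mono[OF sum_abs]])
    also have "(\<Sum>i\<le>m. \<bar>(\<phi> x - \<phi> (a i)) * ?s i\<bar>) \<le> (\<Sum>i\<le>m. \<delta> * ?s i)"
    proof (rule sum_mono)
      fix i
      show "\<bar>(\<phi> x - \<phi> (a i)) * ?s i\<bar> \<le> \<delta> * ?s i"
      proof (cases "?s i = 0")
        case False
        have "\<bar>\<phi> x - \<phi> (a i)\<bar> \<le> \<delta>"
          using bump_step_support[OF \<delta> False] lipschitz_onD[OF lip, of x "a i"] by (simp add: dist_real_def)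
        show ?thesis
          using mult_right_mono[OF \<open>\<bar>\<phi> x - \<phi> (a i)\<bar> \<le> \<delta>\<close> bump_step_nonneg[OF \<delta>]]
          by (simp add: abs_mult abs_of_nonneg[OF bump_step_nonneg[OF \<delta>]])
      qed simp
    qed
    also have "(\<Sum>i\<le>m. \<delta> * ?s i) = \<delta> * ?M" by (simp add: sum_distrib_left[symmetric] sum_bump_step)
    also have "\<delta> * ?M \<le> \<delta> * 1" using M \<delta> by (intro mult_left_mono) auto
    also have "\<bar>(1 - ?M) * \<phi> x\<bar> \<le> (1 - ?M) * 1"
      using M mult_left_mono[OF b, of "1 - ?M" x] by (simp add: abs_mult)
    finally show ?thesis by simp
  qed
  have isum: "integrable N (\<lambda>x. \<phi> x - (\<Sum>i\<le>m. \<phi> (a i) * bump_step \<delta> a i x))"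
    by (intro Bochner_Integration.integrable_diff i\<phi> Bochner_Integration.integrable_sum integrable_mult_right istep)
  have "\<bar>\<integral>x. \<phi> x - (\<Sum>i\<le>m. \<phi> (a i) * bump_step \<delta> a i x) \<partial>N\<bar> \<le> (\<integral>x. \<bar>\<phi> x - (\<Sum>i\<le>m. \<phi> (a i) * bump_step \<delta> a i x)\<bar> \<partial>N)"
    by (rule integral_abs_bound)
  also have "\<dots> \<le> (\<integral>x. \<delta> + (1 - bump \<delta> (a ` {..m}) x) \<partial>N)"
    using pw isum ibump by (intro integral_mono integrable_abs) auto
  also have "\<dots> = \<delta> + (1 - (\<integral>x. bump \<delta> (a ` {..m}) x \<partial>N))" using ibump by (simp add: prob_space)
  also have "(\<integral>x. \<phi> x - (\<Sum>i\<le>m. \<phi> (a i) * bump_step \<delta> a i x) \<partial>N) = (\<integral>x. \<phi> x \<partial>N) - (\<Sum>i\<le>m. \<phi> (a i) * (\<integral>x. bump_step \<delta> a i x \<partial>N))"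
    using i\<phi> istep by simp
  finally show ?thesis .
qed

lemma openin_narrow:
  fixes \<phi> :: "'e::topological_space \<Rightarrow> real"
  assumes "continuous_on UNIV \<phi>" "bounded (range \<phi>)" "open U"
  shows "openin narrow_topology {N \<in> borel_prob_measures. (\<integral>u. \<phi> u \<partial>N) \<in> U}"
  unfolding narrow_topology_def by (rule topology_generated_by_Basis) (use assms in blast)

text \<open>Sequences would not do here, since first countability of the narrow topology is not
  known yet. The neighbourhood prescribes the integrals of finitely many partition
  functions.\<close>

lemma bl_ball_narrow_nbhd:
  fixes N :: "'e::{metric_space, second_countable_topology} measure"
  assumes N: "N \<in> borel_prob_measures" and e: "e > 0"
  shows "\<exists>V. openin narrow_topology V \<and> N \<in> V \<and> (\<forall>N'\<in>V. bl_dist N N' < e)"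
proof -
  obtain a :: "nat \<Rightarrow> 'e" where a: "\<And>x e. e > 0 \<Longrightarrow> \<exists>i. dist x (a i) < e"
    using ex_dense_sequence by blast
  \<comment> \<open>Error budget: 2 \<open>\<delta>\<close> for N, 3 \<open>\<delta>\<close> for
    \<open>N'\<close>, one \<open>\<delta>\<close> for the change of the weights; 6 / 7 of e is
    strictly below e.\<close>
  define \<delta> where "\<delta> = e / 7"
  have \<delta>: "\<delta> > 0" using e by (simp add: \<delta>_def)
  have "\<forall>\<^sub>F m in sequentially. 1 - \<delta> < (\<integral>x. bump \<delta> (a ` {..m}) x \<partial>N)"
    using \<delta> by (intro order_tendstoD(1)[OF bump_integral_tendsto[OF N \<delta> a]]) auto
  then obtain m where m: "1 - \<delta> < (\<integral>x. bump \<delta> (a ` {..m}) x \<partial>N)" by (auto simp: eventually_sequentially)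
  define s where "s N i = (\<integral>x. bump_step \<delta> a i x \<partial>N)" for N i
  define W where "W i = {N' \<in> borel_prob_measures. s N' i \<in> ball (s N i) (\<delta> / real (Suc m))}" for i
  define V where "V = (\<Inter>i\<le>m. W i)"
  have bs: "bounded (range (bump_step \<delta> a i))" for i
    using bump_step_le_1[OF \<delta>] by (intro boundedI[of _ 1]) (auto simp: abs_of_nonneg[OF bump_step_nonneg[OF \<delta>]])
  have sum_s: "(\<Sum>i\<le>m. s N' i) = (\<integral>x. bump \<delta> (a ` {..m}) x \<partial>N')" if "N' \<in> borel_prob_measures" for N'
  proof -
    have "integrable N' (bump_step \<delta> a i)" for i
      using bump_step_nonneg[OF \<delta>] bump_step_le_1[OF \<delta>]
      by (intro integrable_borel_prob_measures[OF that borel_measurable_continuous_onI[OF continuous_on_bump_step[OF \<delta>]], where B=1])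
        (simp add: abs_of_nonneg[OF bump_step_nonneg[OF \<delta>]])
    then have "(\<Sum>i\<le>m. s N' i) = (\<integral>x. (\<Sum>i\<le>m. bump_step \<delta> a i x) \<partial>N')" by (simp add: s_def)
    then show ?thesis by (simp add: sum_bump_step)
  qed
  have "openin narrow_topology (W i)" for i
    unfolding W_def s_def by (rule openin_narrow[OF continuous_on_bump_step[OF \<delta>] bs open_ball])
  then have "openin narrow_topology V"
    unfolding V_def by (intro openin_Inter) auto
  moreover have "N \<in> V" using N \<delta> by (auto simp: V_def W_def)
  moreover have "bl_dist N N' < e" if "N' \<in> V" for N'
  proof -
    have N': "N' \<in> borel_prob_measures" using that by (auto simp: V_def W_def)
    have step: "\<bar>s N i - s N' i\<bar> \<le> \<delta> / real (Suc m)" if "i \<le> m" for i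
      using \<open>N' \<in> V\<close> that by (auto simp: V_def W_def dist_real_def intro: less_imp_le)
    have sum_step: "(\<Sum>i\<le>m. \<bar>s N i - s N' i\<bar>) \<le> \<delta>"
    proof -
      have "(\<Sum>i\<le>m. \<bar>s N i - s N' i\<bar>) \<le> (\<Sum>i\<le>m. \<delta> / real (Suc m))" by (rule sum_mono) (use step in auto)
      then show ?thesis by simp
    qed
    have "\<bar>(\<Sum>i\<le>m. s N i) - (\<Sum>i\<le>m. s N' i)\<bar> \<le> \<delta>"
      using order_trans[OF sum_abs sum_step] by (simp add: sum_subtractf)
    then have m': "1 - 2 * \<delta> \<le> (\<integral>x. bump \<delta> (a ` {..m}) x \<partial>N')"
      using m unfolding sum_s[OF N] sum_s[OF N'] by linarith
    have "bl_dist N N' \<le> 6 * \<delta>"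
    proof (rule bl_dist_least[OF N N'])
      fix \<phi> :: "'e \<Rightarrow> real" assume \<phi>: "\<phi> \<in> bl_class"
      then have b: "\<bar>\<phi> x\<bar> \<le> 1" for x by (simp add: bl_class_def)
      have "\<bar>(\<Sum>i\<le>m. \<phi> (a i) * s N i) - (\<Sum>i\<le>m. \<phi> (a i) * s N' i)\<bar> = \<bar>\<Sum>i\<le>m. \<phi> (a i) * (s N i - s N' i)\<bar>"
        by (simp add: sum_subtractf right_diff_distrib)
      also have "\<dots> \<le> (\<Sum>i\<le>m. \<bar>\<phi> (a i) * (s N i - s N' i)\<bar>)" by (rule sum_abs)
      also have "\<dots> \<le> (\<Sum>i\<le>m. \<bar>s N i - s N' i\<bar>)"
        using mult_right_mono[OF b, of "\<bar>s N _ - s N' _\<bar>"] by (intro sum_mono) (simp add: abs_mult)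
      finally have "\<bar>(\<Sum>i\<le>m. \<phi> (a i) * s N i) - (\<Sum>i\<le>m. \<phi> (a i) * s N' i)\<bar> \<le> \<delta>" using sum_step by linarith
      then show "\<bar>(\<integral>x. \<phi> x \<partial>N) - (\<integral>x. \<phi> x \<partial>N')\<bar> \<le> 6 * \<delta>"
        using bl_class_approx[OF \<phi> N \<delta>, where a=a and m=m] bl_class_approx[OF \<phi> N' \<delta>, where a=a and m=m] m m'
        unfolding s_def by linarith
    qed
    also have "\<dots> < e" using e by (simp add: \<delta>_def)
    finally show ?thesis .
  qed
  ultimately show ?thesis by blast
qed

lemma mtopology_bl_dist:
  "Metric_space.mtopology borel_prob_measures bl_dist
    = (narrow_topology :: 'e::{metric_space, second_countable_topology} measure topology)"
proof -
  interpret bl: Metric_space "borel_prob_measures :: 'e measure set" bl_dist by (rule Metric_space_bl_dist)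
  have "openin bl.mtopology U \<longleftrightarrow> openin narrow_topology U" for U :: "'e measure set"
  proof
    assume U: "openin bl.mtopology U"
    show "openin narrow_topology U"
    proof (subst openin_subopen, intro ballI)
      fix N assume N: "N \<in> U"
      then obtain e where e: "e > 0" "bl.mball N e \<subseteq> U" and NP: "N \<in> borel_prob_measures"
        using U unfolding bl.openin_mtopology by blast
      obtain V where V: "openin narrow_topology V" "N \<in> V" "\<forall>N'\<in>V. bl_dist N N' < e"
        using bl_ball_narrow_nbhd[OF NP e(1)] by blast
      have "V \<subseteq> borel_prob_measures" using openin_subset[OF V(1)] by (simp add: topspace_narrow_topology)
      then have "V \<subseteq> U" using V(3) e(2) NP by (meson bl.in_mball subset_iff)
      then show "\<exists>V. openin narrow_topology V \<and> N \<in> V \<and> V \<subseteq> U" using V by blast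
    qed
  next
    assume U: "openin narrow_topology U"
    then have sub: "U \<subseteq> borel_prob_measures" using openin_subset topspace_narrow_topology by metis
    \<comment> \<open>In this direction sequences suffice, because closedness for a distance is
      sequential.\<close>
    have cl: "closedin narrow_topology (borel_prob_measures - U)"
      using U by (metis openin_closedin_eq topspace_narrow_topology)
    have "closedin bl.mtopology (borel_prob_measures - U)"
      unfolding bl.metric_closedin_iff_sequentially_closed
    proof (intro conjI allI impI)
      fix \<sigma> :: "nat \<Rightarrow> 'e measure" and L
      assume "range \<sigma> \<subseteq> borel_prob_measures - U \<and> limitin bl.mtopology \<sigma> L sequentially"
      then have \<sigma>: "range \<sigma> \<subseteq> borel_prob_measures - U" and lim: "limitin bl.mtopology \<sigma> L sequentially" by auto
      then have "limitin narrow_topology \<sigma> L sequentially"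
        unfolding bl.limitin_metric_dist_null by (intro bl_dist_tendsto_imp_narrow) auto
      then show "L \<in> borel_prob_measures - U"
        by (rule limitin_closedin[OF _ cl]) (use \<sigma> in \<open>auto intro: always_eventually\<close>)
    qed auto
    then show "openin bl.mtopology U"
      using sub by (simp add: openin_closedin_eq)
  qed
  then show ?thesis by (simp add: topology_eq)
qed

lemma complete_distance_bl_dist:
  "complete_distance (narrow_topology :: 'e::{complete_space, second_countable_topology} measure topology) bl_dist"
proof -
  interpret bl: Metric_space "borel_prob_measures :: 'e measure set" bl_dist by (rule Metric_space_bl_dist)
  have "bl.mcomplete"
    unfolding bl.mcomplete_def
  proof (intro allI impI)
    fix \<sigma> :: "nat \<Rightarrow> 'e measure" assume C: "bl.MCauchy \<sigma>"
    then have \<sigma>: "\<sigma> n \<in> borel_prob_measures" for n unfolding bl.MCauchy_def by blast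
    obtain a :: "nat \<Rightarrow> 'e" where a: "\<And>x e. e > 0 \<Longrightarrow> \<exists>i. dist x (a i) < e"
      using ex_dense_sequence by blast
    have tight: "\<exists>j. \<forall>n. 1 - \<epsilon> \<le> measure (\<sigma> n) (\<Union>i\<le>j. ball (a i) \<delta>)" if \<delta>: "\<delta> > 0" and \<epsilon>: "\<epsilon> > 0" for \<delta> \<epsilon>
    proof -
      \<comment> \<open>The constant of \<open>bl_dist_lipschitz\<close> for a bump, whose Lipschitz
        constant is \<open>1 / \<delta>\<close> and whose bound is 1. Past n0 all bump integrals
        stay within \<open>\<epsilon> / 2\<close> of the one at n0, and the finitely many earlier
        measures admit a common j.\<close>
      define D where "D = 1 / \<delta> + 1 + 1"
      have D: "D > 0" using \<delta> by (simp add: D_def add_pos_pos)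
      then have "\<epsilon> / (2 * D) > 0" using \<epsilon> by simp
      then obtain n0 where n0: "\<And>n. n \<ge> n0 \<Longrightarrow> bl_dist (\<sigma> n) (\<sigma> n0) < \<epsilon> / (2 * D)"
        using C unfolding bl.MCauchy_def by (metis order_refl)
      let ?I = "\<lambda>n j. \<integral>x. bump \<delta> (a ` {..j}) x \<partial>\<sigma> n"
      have "\<forall>\<^sub>F j in sequentially. 1 - \<epsilon> / 2 < ?I n j" for n
        using \<epsilon> by (intro order_tendstoD(1)[OF bump_integral_tendsto[OF \<sigma> \<delta> a]]) auto
      then have "\<forall>\<^sub>F j in sequentially. \<forall>n\<in>{..n0}. 1 - \<epsilon> / 2 < ?I n j"
        by (intro eventually_ball_finite) auto
      then obtain j where j: "\<And>n. n \<le> n0 \<Longrightarrow> 1 - \<epsilon> / 2 < ?I n j" by (auto simp: eventually_sequentially)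
      have "1 - \<epsilon> \<le> measure (\<sigma> n) (\<Union>i\<le>j. ball (a i) \<delta>)" for n
      proof -
        have "1 - \<epsilon> \<le> ?I n j"
        proof (cases "n \<le> n0")
          case True
          then show ?thesis using j[of n] \<epsilon> by linarith
        next
          case False
          have "\<bar>?I n j - ?I n0 j\<bar> \<le> D * bl_dist (\<sigma> n) (\<sigma> n0)"
            unfolding D_def using bump_bounds(2)[OF \<delta>]
            by (intro bl_dist_lipschitz \<sigma> bump_lipschitz[OF \<delta>]) (simp add: abs_of_nonneg[OF bump_bounds(1)])
          also have "\<dots> \<le> D * (\<epsilon> / (2 * D))" using D n0[of n] False by (intro mult_left_mono) auto
          also have "\<dots> = \<epsilon> / 2" using D by simp
          finally have "\<bar>?I n j - ?I n0 j\<bar> \<le> \<epsilon> / 2" .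
          then show ?thesis using j[of n0, OF order_refl] by linarith
        qed
        also have "?I n j \<le> measure (\<sigma> n) (\<Union>x\<in>a ` {..j}. ball x \<delta>)"
          by (rule bump_integral_le[OF \<sigma> \<delta>]) auto
        finally show ?thesis by simp
      qed
      then show ?thesis by blast
    qed
    have "\<exists>r L. strict_mono r \<and> limitin narrow_topology (\<lambda>n. \<sigma> (r n)) L sequentially"
      by (rule prokhorov[of \<sigma> a]) (fact \<sigma>, fact a, fact tight)
    then obtain r L where r: "strict_mono r" "limitin narrow_topology (\<lambda>n. \<sigma> (r n)) L sequentially"
      by blast
    then have "limitin bl.mtopology \<sigma> L sequentially"
      by (intro bl.MCauchy_convergent_subsequence[OF C r(1)]) (simp add: mtopology_bl_dist o_def)
    then show "\<exists>L. limitin bl.mtopology \<sigma> L sequentially" by blast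
  qed
  then show ?thesis
    using Metric_space_bl_dist mtopology_bl_dist by (auto simp: complete_distance_def topspace_narrow_topology)
qed

section \<open>Almost periodic functions with values in a metric space\<close>

context Metric_space
begin

definition ap :: "(real \<Rightarrow> 'a) \<Rightarrow> bool" where
  "ap u \<longleftrightarrow> continuous_map euclidean mtopology u \<and>
     (\<forall>\<epsilon>>0. \<exists>l>0. \<forall>a. \<exists>\<tau>\<in>{a..a + l}. \<forall>t. d (u (t + \<tau>)) (u t) \<le> \<epsilon>)"

lemma ap_in: "ap u \<Longrightarrow> u t \<in> M"
  using continuous_map_image_subset_topspace[of euclidean mtopology u] by (auto simp: ap_def)

lemma ap_period:
  assumes "ap u" "\<epsilon> > 0"
  obtains l \<tau> where "l > 0" "\<And>a. \<tau> a \<in> {a..a + l}" "\<And>a t. d (u (t + \<tau> a)) (u t) \<le> \<epsilon>"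
proof -
  obtain l where l: "l > 0" "\<forall>a. \<exists>\<tau>\<in>{a..a + l}. \<forall>t. d (u (t + \<tau>)) (u t) \<le> \<epsilon>"
    using assms unfolding ap_def by blast
  then obtain \<tau> where "\<forall>a. \<tau> a \<in> {a..a + l} \<and> (\<forall>t. d (u (t + \<tau> a)) (u t) \<le> \<epsilon>)" by metis
  then show thesis using that l(1) by blast
qed

lemma ap_tendsto:
  assumes "ap u" "r \<longlonglongrightarrow> t"
  shows "(\<lambda>n. d (u (r n)) (u t)) \<longlonglongrightarrow> 0"
proof -
  have "limitin mtopology (u \<circ> r) (u t) sequentially"
    using assms unfolding ap_def by (intro limit_continuous_map_within continuous_map_limit[of euclidean]) auto
  then show ?thesis unfolding limitin_metric_dist_null by (simp add: o_def)
qed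

lemma triangle4:
  "x \<in> M \<Longrightarrow> x' \<in> M \<Longrightarrow> y' \<in> M \<Longrightarrow> y \<in> M \<Longrightarrow> d x y \<le> d x x' + d x' y' + d y' y"
  using triangle[of x x' y] triangle[of x' y' y] by linarith

text \<open>Up to a small error every value is attained on [0, l], whose image is compact;
  completeness turns total boundedness into convergent subsequences.\<close>

lemma ap_relatively_compact:
  fixes t :: "nat \<Rightarrow> real"
  assumes u: "ap u" and complete: mcomplete
  shows "\<exists>r L. strict_mono r \<and> limitin mtopology (\<lambda>n. u (t (r n))) L sequentially"
proof -
  have "mtotally_bounded (range u)"
    unfolding mtotally_bounded_def
  proof (intro allI impI)
    fix \<epsilon> :: real assume "\<epsilon> > 0"
    then have e: "\<epsilon> / 2 > 0" by simp
    obtain l \<tau> where l: "l > 0" "\<And>a. \<tau> a \<in> {a..a + l}" "\<And>a t. d (u (t + \<tau> a)) (u t) \<le> \<epsilon> / 2"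
      using ap_period[OF u e] by blast
    have "compactin mtopology (u ` {0..l})"
      using u unfolding ap_def by (intro image_compactin[of euclidean]) auto
    then have "mtotally_bounded (u ` {0..l})" by (rule compactin_imp_mtotally_bounded)
    from this[unfolded mtotally_bounded_def, rule_format, OF e]
    obtain K where K: "finite K" "K \<subseteq> u ` {0..l}" "u ` {0..l} \<subseteq> (\<Union>x\<in>K. mball x (\<epsilon> / 2))"
      by (elim exE conjE)
    have "u t \<in> (\<Union>x\<in>K. mball x \<epsilon>)" for t
    proof -
      \<comment> \<open>The period is sought in [-t, -t + l], so that the shifted time falls into
        [0, l].\<close>
      have "t + \<tau> (- t) \<in> {0..l}" using l(2)[of "- t"] by auto
      then obtain x where x: "x \<in> K" "u (t + \<tau> (- t)) \<in> mball x (\<epsilon> / 2)" using K(3) by blast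
      then have "d x (u t) < \<epsilon>"
        using triangle[of x "u (t + \<tau> (- t))" "u t"] l(3)[of t "- t"] ap_in[OF u] by auto
      then show ?thesis using x ap_in[OF u] by auto
    qed
    then show "\<exists>K. finite K \<and> K \<subseteq> range u \<and> range u \<subseteq> (\<Union>x\<in>K. mball x \<epsilon>)"
      using K by (intro exI[of _ K]) auto
  qed
  then have "\<forall>\<sigma> :: nat \<Rightarrow> 'a. range \<sigma> \<subseteq> range u \<longrightarrow> (\<exists>r. strict_mono r \<and> MCauchy (\<sigma> \<circ> r))"
    unfolding mtotally_bounded_sequentially by blast
  from this[rule_format, of "\<lambda>n. u (t n)"]
  obtain r where r: "strict_mono r" "MCauchy ((\<lambda>n. u (t n)) \<circ> r)" by auto
  then show ?thesis using complete unfolding mcomplete_def by (auto simp: o_def)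
qed

text \<open>Two merging points are moved by the same almost period near [0, l], where both approach
  one point b and continuity at b decides.\<close>

lemma ap_uniformly_continuous:
  assumes u: "ap u" and e: "\<epsilon> > 0"
  shows "\<exists>\<delta>>0. \<forall>s t. \<bar>s - t\<bar> < \<delta> \<longrightarrow> d (u s) (u t) < \<epsilon>"
proof (rule ccontr)
  assume neg: "\<not> ?thesis"
  have "\<exists>s t. \<bar>s - t\<bar> < inverse (real (Suc n)) \<and> \<epsilon> \<le> d (u s) (u t)" for n
  proof (rule ccontr)
    assume "\<nexists>s t. \<bar>s - t\<bar> < inverse (real (Suc n)) \<and> \<epsilon> \<le> d (u s) (u t)"
    then have "\<forall>s t. \<bar>s - t\<bar> < inverse (real (Suc n)) \<longrightarrow> d (u s) (u t) < \<epsilon>" by (auto simp: not_le)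
    moreover have "inverse (real (Suc n)) > 0" by simp
    ultimately show False using neg by blast
  qed
  then obtain s t where st: "\<And>n. \<bar>s n - t n\<bar> < inverse (real (Suc n))" "\<And>n. \<epsilon> \<le> d (u (s n)) (u (t n))" by metis
  have "\<epsilon> / 4 > 0" using e by simp
  then obtain l \<tau> where l: "l > 0" "\<And>a. \<tau> a \<in> {a..a + l}" "\<And>a t. d (u (t + \<tau> a)) (u t) \<le> \<epsilon> / 4"
    using ap_period[OF u] by blast
  define \<sigma> where "\<sigma> n = s n + \<tau> (- s n)" for n
  have "\<sigma> n \<in> {0..l}" for n using l(2)[of "- s n"] by (auto simp: \<sigma>_def)
  then obtain b r where r: "strict_mono (r :: nat \<Rightarrow> nat)" "(\<sigma> \<circ> r) \<longlonglongrightarrow> b"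
    using compact_Icc[of 0 l] unfolding compact_def by metis
  have "(\<lambda>n. t n - s n) \<longlonglongrightarrow> 0"
    by (rule Lim_null_comparison[OF _ LIMSEQ_inverse_real_of_nat])
      (use st(1) in \<open>auto simp: abs_minus_commute intro!: always_eventually less_imp_le\<close>)
  from tendsto_add[OF r(2) LIMSEQ_subseq_LIMSEQ[OF this r(1)]]
  have t': "(\<lambda>n. \<sigma> (r n) + (t (r n) - s (r n))) \<longlonglongrightarrow> b" by (simp add: o_def)
  have "(\<lambda>n. d (u (\<sigma> (r n))) (u b) + d (u (\<sigma> (r n) + (t (r n) - s (r n)))) (u b)) \<longlonglongrightarrow> 0 + 0"
    using ap_tendsto[OF u r(2)] ap_tendsto[OF u t'] by (intro tendsto_add) (simp_all add: o_def)
  then have "\<forall>\<^sub>F n in sequentially. d (u (\<sigma> (r n))) (u b) + d (u (\<sigma> (r n) + (t (r n) - s (r n)))) (u b) < \<epsilon> / 2"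
    using e by (intro order_tendstoD(2)) auto
  then obtain n where n: "d (u (\<sigma> (r n))) (u b) + d (u (\<sigma> (r n) + (t (r n) - s (r n)))) (u b) < \<epsilon> / 2"
    by (auto simp: eventually_sequentially)
  let ?s = "s (r n)" and ?t = "t (r n)" and ?\<tau> = "\<tau> (- s (r n))"
  have "d (u ?s) (u ?t) \<le> d (u ?s) (u (?s + ?\<tau>)) + d (u (?s + ?\<tau>)) (u (?t + ?\<tau>)) + d (u (?t + ?\<tau>)) (u ?t)"
    by (rule triangle4) (rule ap_in[OF u])+
  also have "d (u (?s + ?\<tau>)) (u (?t + ?\<tau>)) \<le> d (u (?s + ?\<tau>)) (u b) + d (u b) (u (?t + ?\<tau>))"
    by (rule triangle) (rule ap_in[OF u])+
  finally have "d (u ?s) (u ?t) < \<epsilon>"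
    using n l(3)[of ?s "- ?s"] l(3)[of ?t "- ?s"] commute[of "u ?s" "u (?s + ?\<tau>)"] commute[of "u b" "u (?t + ?\<tau>)"]
    by (simp add: \<sigma>_def algebra_simps)
  then show False using st(2)[of "r n"] by simp
qed

text \<open>Subtracting almost periods brings the translations into [0, l] at a cost uniform in t;
  there they cluster, and uniform continuity compares the translates.\<close>

lemma ap_Bochner:
  assumes u: "ap u" and e: "\<epsilon> > 0"
  shows "\<exists>r :: nat \<Rightarrow> nat. strict_mono r \<and> (\<forall>i j t. d (u (t + s (r i))) (u (t + s (r j))) \<le> \<epsilon>)"
proof -
  have e3: "\<epsilon> / 3 > 0" using e by simp
  obtain l \<tau> where l: "l > 0" "\<And>a. \<tau> a \<in> {a..a + l}" "\<And>a t. d (u (t + \<tau> a)) (u t) \<le> \<epsilon> / 3"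
    using ap_period[OF u e3] by blast
  obtain \<delta> where \<delta>: "\<delta> > 0" "\<And>s t. \<bar>s - t\<bar> < \<delta> \<Longrightarrow> d (u s) (u t) < \<epsilon> / 3"
    using ap_uniformly_continuous[OF u e3] by blast
  \<comment> \<open>The period is taken in [s n - l, s n], which leaves a remainder in
    [0, l].\<close>
  define \<sigma> where "\<sigma> n = s n - \<tau> (s n - l)" for n
  have "\<sigma> n \<in> {0..l}" for n using l(2)[of "s n - l"] by (auto simp: \<sigma>_def)
  then obtain b r where r: "strict_mono (r :: nat \<Rightarrow> nat)" "(\<sigma> \<circ> r) \<longlonglongrightarrow> b"
    using compact_Icc[of 0 l] unfolding compact_def by metis
  have "\<forall>\<^sub>F n in sequentially. dist ((\<sigma> \<circ> r) n) b < \<delta> / 2" using tendstoD[OF r(2), of "\<delta> / 2"] \<delta>(1) by simp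
  then obtain n0 where n0: "\<And>n. n \<ge> n0 \<Longrightarrow> dist (\<sigma> (r n)) b < \<delta> / 2" by (auto simp: eventually_sequentially)
  have "d (u (t + s (r (n0 + i)))) (u (t + s (r (n0 + j)))) \<le> \<epsilon>" for i j t
  proof -
    let ?i = "r (n0 + i)" and ?j = "r (n0 + j)"
    have "\<bar>(t + \<sigma> ?i) - (t + \<sigma> ?j)\<bar> < \<delta>"
      using n0[of "n0 + i"] n0[of "n0 + j"] unfolding dist_real_def by linarith
    then have "d (u (t + \<sigma> ?i)) (u (t + \<sigma> ?j)) < \<epsilon> / 3" by (rule \<delta>(2))
    moreover have "d (u (t + s ?i)) (u (t + s ?j)) \<le> d (u (t + s ?i)) (u (t + \<sigma> ?i)) + d (u (t + \<sigma> ?i)) (u (t + \<sigma> ?j)) + d (u (t + \<sigma> ?j)) (u (t + s ?j))"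
      by (rule triangle4) (rule ap_in[OF u])+
    moreover have near: "d (u (t + s n)) (u (t + \<sigma> n)) \<le> \<epsilon> / 3" for n
      using l(3)[of "t + \<sigma> n" "s n - l"] by (simp add: \<sigma>_def)
    moreover have "d (u (t + \<sigma> ?j)) (u (t + s ?j)) = d (u (t + s ?j)) (u (t + \<sigma> ?j))" by (rule commute)
    ultimately show ?thesis using near[of ?i] near[of ?j] by linarith
  qed
  moreover have "strict_mono (\<lambda>i. r (n0 + i))" using r(1) by (simp add: strict_mono_def)
  ultimately show ?thesis by (intro exI[of _ "\<lambda>i. r (n0 + i)"]) auto
qed

definition uniformly_Cauchy_translates :: "(real \<Rightarrow> 'a) \<Rightarrow> (nat \<Rightarrow> real) \<Rightarrow> bool" where
  "uniformly_Cauchy_translates u s \<longleftrightarrow>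
     (\<forall>\<epsilon>>0. \<exists>N. \<forall>i\<ge>N. \<forall>j\<ge>N. \<forall>t. d (u (t + s i)) (u (t + s j)) \<le> \<epsilon>)"

lemma uniformly_Cauchy_translates_subseq:
  assumes "uniformly_Cauchy_translates u s" "strict_mono r"
  shows "uniformly_Cauchy_translates u (s \<circ> r)"
  unfolding uniformly_Cauchy_translates_def
proof (intro allI impI)
  fix \<epsilon> :: real assume "\<epsilon> > 0"
  then obtain N where "\<forall>i\<ge>N. \<forall>j\<ge>N. \<forall>t. d (u (t + s i)) (u (t + s j)) \<le> \<epsilon>"
    using assms(1) unfolding uniformly_Cauchy_translates_def by blast
  moreover have "N \<le> r i" if "N \<le> i" for i using seq_suble[OF assms(2), of i] that by linarith
  ultimately show "\<exists>N. \<forall>i\<ge>N. \<forall>j\<ge>N. \<forall>t. d (u (t + (s \<circ> r) i)) (u (t + (s \<circ> r) j)) \<le> \<epsilon>"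
    by (intro exI[of _ N]) auto
qed

text \<open>A diagonal over pairs of a function and an accuracy 1 / (m + 1), coded by
  \<open>prod_encode\<close>, gives one subsequence for all functions.\<close>

lemma ap_Bochner_family:
  fixes u :: "nat \<Rightarrow> real \<Rightarrow> 'a"
  assumes u: "\<And>k. ap (u k)"
  shows "\<exists>r :: nat \<Rightarrow> nat. strict_mono r \<and> (\<forall>k. uniformly_Cauchy_translates (u k) (s \<circ> r))"
proof -
  define P where "P c r \<longleftrightarrow> (case prod_decode c of (k, m) \<Rightarrow>
    \<exists>N. \<forall>i\<ge>N. \<forall>j\<ge>N. \<forall>t. d (u k (t + s (r i))) (u k (t + s (r j))) \<le> inverse (real (Suc m)))"
    for c and r :: "nat \<Rightarrow> nat"
  have "\<exists>r. strict_mono r \<and> (\<forall>c. P c r)"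
  proof (rule diagonal_subsequence)
    fix c and r :: "nat \<Rightarrow> nat"
    obtain k m where c: "prod_decode c = (k, m)" by fastforce
    obtain q :: "nat \<Rightarrow> nat" where "strict_mono q" "\<forall>i j t. d (u k (t + (s \<circ> r) (q i))) (u k (t + (s \<circ> r) (q j))) \<le> inverse (real (Suc m))"
      using ap_Bochner[OF u, of "inverse (real (Suc m))" k "s \<circ> r"] by auto
    then show "\<exists>q. strict_mono q \<and> P c (r \<circ> q)" unfolding P_def c by (intro exI[of _ q]) auto
  next
    fix c and r q :: "nat \<Rightarrow> nat" assume q: "strict_mono q" and "P c r"
    then obtain N where "case prod_decode c of (k, m) \<Rightarrow>
        \<forall>i\<ge>N. \<forall>j\<ge>N. \<forall>t. d (u k (t + s (r i))) (u k (t + s (r j))) \<le> inverse (real (Suc m))"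
      unfolding P_def by (auto split: prod.splits)
    moreover have "N \<le> q i" if "N \<le> i" for i using seq_suble[OF q, of i] that by linarith
    ultimately show "P c (r \<circ> q)" unfolding P_def by (auto split: prod.splits intro!: exI[of _ N])
  next
    fix c n and r :: "nat \<Rightarrow> nat" assume P: "P c (r \<circ> (+) n)"
    obtain k m where c: "prod_decode c = (k, m)" by fastforce
    from P obtain N where N: "\<forall>i\<ge>N. \<forall>j\<ge>N. \<forall>t.
        d (u k (t + s (r (n + i)))) (u k (t + s (r (n + j)))) \<le> inverse (real (Suc m))"
      unfolding P_def c by auto
    have "d (u k (t + s (r i))) (u k (t + s (r j))) \<le> inverse (real (Suc m))"
      if "N + n \<le> i" "N + n \<le> j" for i j t
      using N[rule_format, of "i - n" "j - n" t] that by simp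
    then show "P c r" unfolding P_def c by auto
  qed
  then obtain r where r: "strict_mono r" "\<And>c. P c r" by blast
  have "uniformly_Cauchy_translates (u k) (s \<circ> r)" for k
    unfolding uniformly_Cauchy_translates_def
  proof (intro allI impI)
    fix \<epsilon> :: real assume "\<epsilon> > 0"
    then obtain m where m: "inverse (real (Suc m)) < \<epsilon>" using reals_Archimedean by blast
    have "P (prod_encode (k, m)) r" by (rule r(2))
    then obtain N where "\<forall>i\<ge>N. \<forall>j\<ge>N. \<forall>t. d (u k (t + s (r i))) (u k (t + s (r j))) \<le> inverse (real (Suc m))"
      unfolding P_def by auto
    then show "\<exists>N. \<forall>i\<ge>N. \<forall>j\<ge>N. \<forall>t. d (u k (t + (s \<circ> r) i)) (u k (t + (s \<circ> r) j)) \<le> \<epsilon>"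
      using order_trans[OF _ less_imp_le[OF m]] by (intro exI[of _ N]) simp
  qed
  then show ?thesis using r(1) by blast
qed

text \<open>Each new translation is the midpoint, up to the earlier ones, of an interval free of
  \<open>\<epsilon>\<close>-periods that is longer than twice the size of all earlier translations.\<close>

lemma separated_translates:
  assumes "\<nexists>l. l > 0 \<and> (\<forall>a. \<exists>\<tau>\<in>{a..a + l}. \<forall>t. d (u (t + \<tau>)) (u t) \<le> \<epsilon>)"
  shows "\<exists>s :: nat \<Rightarrow> real. \<forall>i j. i < j \<longrightarrow> (\<exists>t. \<epsilon> < d (u (t + s j)) (u (t + s i)))"
proof -
  have far: "\<exists>a. \<forall>\<tau>\<in>{a..a + l}. \<exists>t. \<epsilon> < d (u (t + \<tau>)) (u t)" if "l > 0" for l :: real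
    using assms that by (meson not_less)
  \<comment> \<open>\<open>fst (f n)\<close> bounds all translations \<open>snd (f i)\<close> with i
    up to n; carrying it along makes a choice that depends on the whole past depend on the last step
    only.\<close>
  have "\<exists>f :: nat \<Rightarrow> real \<times> real. \<forall>n. \<bar>snd (f n)\<bar> \<le> fst (f n) \<and>
      (fst (f n) \<le> fst (f (Suc n)) \<and> (\<forall>x. \<bar>x\<bar> \<le> fst (f n) \<longrightarrow> (\<exists>t. \<epsilon> < d (u (t + (snd (f (Suc n)) - x))) (u t))))"
  proof (rule dependent_nat_choice)
    show "\<exists>x :: real \<times> real. \<bar>snd x\<bar> \<le> fst x" by (rule exI[of _ "(0, 0)"]) simp
    fix p :: "real \<times> real" and n :: nat assume p: "\<bar>snd p\<bar> \<le> fst p"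
    define b where "b = fst p"
    have "2 * b + 1 > 0" using p by (simp add: b_def)
    then obtain a where a: "\<forall>\<tau>\<in>{a..a + (2 * b + 1)}. \<exists>t. \<epsilon> < d (u (t + \<tau>)) (u t)" using far by blast
    have "\<exists>t. \<epsilon> < d (u (t + (a + b - x))) (u t)" if "\<bar>x\<bar> \<le> b" for x
      using that by (intro bspec[OF a]) auto
    then show "\<exists>q. \<bar>snd q\<bar> \<le> fst q \<and> (fst p \<le> fst q \<and> (\<forall>x. \<bar>x\<bar> \<le> fst p \<longrightarrow> (\<exists>t. \<epsilon> < d (u (t + (snd q - x))) (u t))))"
      by (intro exI[of _ "(max b \<bar>a + b\<bar>, a + b)"]) (simp add: b_def)
  qed
  then obtain f :: "nat \<Rightarrow> real \<times> real" where f: "\<And>n. \<bar>snd (f n)\<bar> \<le> fst (f n)" "\<And>n. fst (f n) \<le> fst (f (Suc n))"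
    "\<And>n x. \<bar>x\<bar> \<le> fst (f n) \<Longrightarrow> \<exists>t. \<epsilon> < d (u (t + (snd (f (Suc n)) - x))) (u t)" by blast
  have "\<exists>t. \<epsilon> < d (u (t + snd (f j))) (u (t + snd (f i)))" if "i < j" for i j
  proof -
    obtain n where n: "j = Suc n" "i \<le> n" using \<open>i < j\<close> by (cases j) auto
    have "fst (f i) \<le> fst (f n)" using lift_Suc_mono_le[of "\<lambda>n. fst (f n)", OF f(2) n(2)] .
    then have "\<bar>snd (f i)\<bar> \<le> fst (f n)" using f(1)[of i] by linarith
    from f(3)[OF this] obtain t where "\<epsilon> < d (u (t + (snd (f (Suc n)) - snd (f i)))) (u t)" by blast
    then show ?thesis by (intro exI[of _ "t - snd (f i)"]) (simp add: n algebra_simps)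
  qed
  then show ?thesis by (intro exI[of _ "\<lambda>n. snd (f n)"]) auto
qed

end

section \<open>Almost periodic functions with parameter\<close>

locale ap_parameter =
  Metric_space "UNIV :: 'y::metric_space set" d for d +
  fixes f :: "real \<Rightarrow> 'x::{metric_space, second_countable_topology} \<Rightarrow> 'y"
  assumes top: "mtopology = euclidean" and complete: "mcomplete"
    and f: "continuous_on UNIV (\<lambda>(t, x). f t x)"
    and periods: "\<And>K \<epsilon>. compact K \<Longrightarrow> \<epsilon> > 0 \<Longrightarrow> \<exists>l>0. \<forall>a. \<exists>\<tau>\<in>{a..a + l}. \<forall>t. \<forall>x\<in>K. d (f (t + \<tau>) x) (f t x) \<le> \<epsilon>"
begin

lemma tendsto_iff_d: "(X \<longlongrightarrow> L) F \<longleftrightarrow> ((\<lambda>n. d (X n) L) \<longlongrightarrow> 0) F"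
  using limitin_metric_dist_null[of X L F] unfolding top by (simp add: limitin_canonical_iff)

lemma f_tendsto:
  assumes "a \<longlonglongrightarrow> t" "y \<longlonglongrightarrow> x"
  shows "(\<lambda>n. f (a n) (y n)) \<longlonglongrightarrow> f t x"
  using continuous_on_tendsto_compose[OF f tendsto_Pair[OF assms]] by simp

lemma ap_section: "ap (\<lambda>t. f t x)"
  unfolding ap_def
proof (intro conjI allI impI)
  have "continuous_on UNIV (\<lambda>t. (\<lambda>(t, x). f t x) (t, x))"
    by (rule continuous_on_compose2[OF f]) (auto intro!: continuous_intros)
  then show "continuous_map euclidean mtopology (\<lambda>t. f t x)"
    by (simp add: top)
  fix \<epsilon> :: real assume "\<epsilon> > 0"
  then show "\<exists>l>0. \<forall>a. \<exists>\<tau>\<in>{a..a + l}. \<forall>t. d (f (t + \<tau>) x) (f t x) \<le> \<epsilon>"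
    using periods[of "{x}" \<epsilon>] by simp
qed

text \<open>The translations \<open>a j\<close> may be unbounded. An almost period common to the
  compact set of the parameters carries them into [0, l], where they cluster and joint continuity of
  f applies.\<close>

lemma equicontinuous:
  assumes t: "t \<longlonglongrightarrow> t'" and y: "y \<longlonglongrightarrow> x"
  shows "(\<lambda>j. d (f (a j + t j) (y j)) (f (a j + t') x)) \<longlonglongrightarrow> 0"
proof (rule ccontr)
  assume "\<not> ?thesis"
  then obtain e where e: "e > 0" and "\<not> (\<forall>\<^sub>F j in sequentially. dist (d (f (a j + t j) (y j)) (f (a j + t') x)) 0 < e)"
    unfolding tendsto_iff by blast
  then obtain r where r: "strict_mono (r :: nat \<Rightarrow> nat)"
    and "\<forall>j. \<not> dist (d (f (a (r j) + t (r j)) (y (r j))) (f (a (r j) + t') x)) 0 < e"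
    using not_eventually_sequentiallyD by blast
  then have far: "e \<le> d (f (a (r j) + t (r j)) (y (r j))) (f (a (r j) + t') x)" for j
    by (simp add: not_less)
  define K where "K = insert x (range y)"
  have K: "compact K" unfolding K_def by (rule compact_insert_range_tendsto[OF y])
  have "e / 4 > 0" using e by simp
  from periods[OF K this] obtain l where l: "\<forall>a. \<exists>\<tau>\<in>{a..a + l}. \<forall>t. \<forall>x\<in>K. d (f (t + \<tau>) x) (f t x) \<le> e / 4" by blast
  then obtain \<tau> where \<tau>: "\<And>a. \<tau> a \<in> {a..a + l}" "\<And>a t x. x \<in> K \<Longrightarrow> d (f (t + \<tau> a) x) (f t x) \<le> e / 4" by metis
  define b where "b j = a (r j) + \<tau> (- a (r j))" for j
  have "b j \<in> {0..l}" for j using \<tau>(1)[of "- a (r j)"] by (auto simp: b_def)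
  then obtain c q where q: "strict_mono (q :: nat \<Rightarrow> nat)" "(b \<circ> q) \<longlonglongrightarrow> c"
    using compact_Icc[of 0 l] unfolding compact_def by metis
  have tq: "(\<lambda>j. t (r (q j))) \<longlonglongrightarrow> t'" and yq: "(\<lambda>j. y (r (q j))) \<longlonglongrightarrow> x"
    using LIMSEQ_subseq_LIMSEQ[OF t strict_mono_o[OF r q(1)]] LIMSEQ_subseq_LIMSEQ[OF y strict_mono_o[OF r q(1)]]
    by (simp_all add: o_def)
  have bq: "(\<lambda>j. b (q j)) \<longlonglongrightarrow> c" using q(2) by (simp add: o_def)
  have 1: "(\<lambda>j. d (f (b (q j) + t (r (q j))) (y (r (q j)))) (f (c + t') x)) \<longlonglongrightarrow> 0"
    unfolding tendsto_iff_d[symmetric] by (intro f_tendsto tendsto_add bq tq yq)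
  have 2: "(\<lambda>j. d (f (b (q j) + t') x) (f (c + t') x)) \<longlonglongrightarrow> 0"
    unfolding tendsto_iff_d[symmetric] by (intro f_tendsto tendsto_add bq tendsto_const)
  have "\<forall>\<^sub>F j in sequentially. d (f (b (q j) + t (r (q j))) (y (r (q j)))) (f (c + t') x) + d (f (b (q j) + t') x) (f (c + t') x) < e / 2"
    using tendsto_add[OF 1 2] e by (intro order_tendstoD(2)) auto
  then obtain j where j: "d (f (b (q j) + t (r (q j))) (y (r (q j)))) (f (c + t') x) + d (f (b (q j) + t') x) (f (c + t') x) < e / 2"
    by (auto simp: eventually_sequentially)
  let ?a = "a (r (q j))" and ?t = "t (r (q j))" and ?y = "y (r (q j))" and ?\<tau> = "\<tau> (- a (r (q j)))"
  have "d (f (?a + ?t) ?y) (f (?a + t') x) \<le> d (f (?a + ?t) ?y) (f (?a + ?t + ?\<tau>) ?y)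
      + d (f (?a + ?t + ?\<tau>) ?y) (f (?a + t' + ?\<tau>) x) + d (f (?a + t' + ?\<tau>) x) (f (?a + t') x)"
    by (rule triangle4) auto
  moreover have "d (f (?a + ?t) ?y) (f (?a + ?t + ?\<tau>) ?y) \<le> e / 4"
    using \<tau>(2)[of ?y "?a + ?t" "- ?a"] by (simp add: K_def commute)
  moreover have "d (f (?a + t' + ?\<tau>) x) (f (?a + t') x) \<le> e / 4"
    using \<tau>(2)[of x "?a + t'" "- ?a"] by (simp add: K_def)
  moreover have "d (f (?a + ?t + ?\<tau>) ?y) (f (?a + t' + ?\<tau>) x) < e / 2"
  proof -
    have e1: "?a + ?t + ?\<tau> = b (q j) + ?t" and e2: "?a + t' + ?\<tau> = b (q j) + t'" by (simp_all add: b_def)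
    have "d (f (b (q j) + ?t) ?y) (f (b (q j) + t') x) \<le> d (f (b (q j) + ?t) ?y) (f (c + t') x) + d (f (c + t') x) (f (b (q j) + t') x)"
      by (rule triangle) auto
    then show ?thesis
      unfolding e1 e2 using j commute[of "f (c + t') x" "f (b (q j) + t') x"] by linarith
  qed
  ultimately show False using far[of "q j"] by simp
qed

lemma equicontinuous_at:
  assumes e: "e > 0"
  shows "\<exists>\<delta>>0. \<forall>z. dist z (t, x) < \<delta> \<longrightarrow> (\<forall>a. d (f (a + fst z) (snd z)) (f (a + t) x) < e)"
proof (rule ccontr)
  assume neg: "\<not> ?thesis"
  have "\<exists>z a. dist z (t, x) < inverse (real (Suc n)) \<and> e \<le> d (f (a + fst z) (snd z)) (f (a + t) x)" for n
  proof (rule ccontr)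
    assume "\<not> ?thesis"
    then have "\<forall>z. dist z (t, x) < inverse (real (Suc n)) \<longrightarrow> (\<forall>a. d (f (a + fst z) (snd z)) (f (a + t) x) < e)"
      by (meson not_le)
    moreover have "inverse (real (Suc n)) > 0" by simp
    ultimately show False using neg by blast
  qed
  then obtain z a where za: "\<And>n. dist (z n) (t, x) < inverse (real (Suc n))"
    "\<And>n. e \<le> d (f (a n + fst (z n)) (snd (z n))) (f (a n + t) x)" by metis
  have "(\<lambda>n. dist (z n) (t, x)) \<longlonglongrightarrow> 0"
    by (rule tendsto_sandwich[OF _ _ tendsto_const LIMSEQ_inverse_real_of_nat])
      (use za(1) in \<open>auto intro!: always_eventually less_imp_le\<close>)
  then have z: "z \<longlonglongrightarrow> (t, x)" by (rule tendsto_dist_iff[THEN iffD2])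
  have "(\<lambda>n. d (f (a n + fst (z n)) (snd (z n))) (f (a n + t) x)) \<longlonglongrightarrow> 0"
    using equicontinuous[OF tendsto_fst[OF z] tendsto_snd[OF z], of a] by simp
  then have "\<forall>\<^sub>F n in sequentially. d (f (a n + fst (z n)) (snd (z n))) (f (a n + t) x) < e"
    using e by (intro order_tendstoD(2)) auto
  then show False using za(2) by (auto simp: eventually_sequentially not_less[symmetric])
qed

text \<open>Arzela--Ascoli. The space of pairs \<open>(t, x)\<close> need not be locally compact, so a diagonal sequence
  converging on a countable dense set is used, and equicontinuity does the rest.\<close>

lemma translates_compact:
  fixes a :: "nat \<Rightarrow> real"
  shows "\<exists>r F. strict_mono r \<and> (\<forall>z. ((\<lambda>(n, v). case v of (t, x) \<Rightarrow> f (a (r n) + t) x) \<longlongrightarrow> (case z of (t, x) \<Rightarrow> F t x)) (sequentially \<times>\<^sub>F nhds z))"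
proof -
  obtain z :: "nat \<Rightarrow> real \<times> 'x" where z: "\<And>v e. e > 0 \<Longrightarrow> \<exists>i. dist v (z i) < e"
    using ex_dense_sequence by blast
  have "\<exists>r. strict_mono r \<and> (\<forall>i. convergent (\<lambda>n. f (a (r n) + fst (z i)) (snd (z i))))"
  proof (rule diagonal_subsequence)
    fix i and s :: "nat \<Rightarrow> nat"
    from ap_relatively_compact[OF ap_section[of "snd (z i)"] complete, where t="\<lambda>n. a (s n) + fst (z i)"]
    show "\<exists>r. strict_mono r \<and> convergent (\<lambda>n. f (a ((s \<circ> r) n) + fst (z i)) (snd (z i)))"
      by (auto simp: top convergent_def)
  next
    fix i and s r :: "nat \<Rightarrow> nat" assume "strict_mono r" "convergent (\<lambda>n. f (a (s n) + fst (z i)) (snd (z i)))"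
    then show "convergent (\<lambda>n. f (a ((s \<circ> r) n) + fst (z i)) (snd (z i)))"
      using convergent_subseq_convergent[of "\<lambda>n. f (a (s n) + fst (z i)) (snd (z i))" r] by (simp add: o_def)
  next
    fix i k and s :: "nat \<Rightarrow> nat" assume "convergent (\<lambda>n. f (a ((s \<circ> (+) k) n) + fst (z i)) (snd (z i)))"
    then show "convergent (\<lambda>n. f (a (s n) + fst (z i)) (snd (z i)))"
      using convergent_ignore_initial_segment[of "\<lambda>n. f (a (s n) + fst (z i)) (snd (z i))" k] by (simp add: o_def add.commute)
  qed
  then obtain r where r: "strict_mono r" and conv: "\<And>i. convergent (\<lambda>n. f (a (r n) + fst (z i)) (snd (z i)))" by blast
  have "\<exists>L. (\<lambda>n. f (a (r n) + t) x) \<longlonglongrightarrow> L" for t x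
  proof -
    have "MCauchy (\<lambda>n. f (a (r n) + t) x)"
      unfolding MCauchy_def
    proof (intro conjI allI impI)
      fix e :: real assume "e > 0"
      then have e: "e / 4 > 0" by simp
      obtain \<delta> where \<delta>: "\<delta> > 0" "\<And>w b. dist w (t, x) < \<delta> \<Longrightarrow> d (f (b + fst w) (snd w)) (f (b + t) x) < e / 4"
        using equicontinuous_at[OF e, of t x] by blast
      obtain i where "dist (t, x) (z i) < \<delta>" using z[OF \<delta>(1)] by blast
      then have near: "d (f (b + fst (z i)) (snd (z i))) (f (b + t) x) < e / 4" for b
        using \<delta>(2)[of "z i" b] by (simp add: dist_commute)
      obtain L where "(\<lambda>n. f (a (r n) + fst (z i)) (snd (z i))) \<longlonglongrightarrow> L" using conv[of i] by (auto simp: convergent_def)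
      then have "\<forall>\<^sub>F n in sequentially. d (f (a (r n) + fst (z i)) (snd (z i))) L < e / 4"
        unfolding tendsto_iff_d using e by (intro order_tendstoD(2)) auto
      then obtain N where N: "\<And>n. n \<ge> N \<Longrightarrow> d (f (a (r n) + fst (z i)) (snd (z i))) L < e / 4" by (auto simp: eventually_sequentially)
      have "d (f (a (r n) + t) x) (f (a (r n') + t) x) < e" if "N \<le> n" "N \<le> n'" for n n'
      proof -
        have c: "d (f (a (r n) + t) x) L < e / 2" if "N \<le> n" for n
          using triangle[of "f (a (r n) + t) x" "f (a (r n) + fst (z i)) (snd (z i))" L] N[OF that] near[of "a (r n)"]
            commute[of "f (a (r n) + t) x" "f (a (r n) + fst (z i)) (snd (z i))"] by simp
        show ?thesis
          using triangle[of "f (a (r n) + t) x" L "f (a (r n') + t) x"] c[OF that(1)] c[OF that(2)]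
            commute[of L "f (a (r n') + t) x"] by simp
      qed
      then show "\<exists>N. \<forall>n n'. N \<le> n \<longrightarrow> N \<le> n' \<longrightarrow> d (f (a (r n) + t) x) (f (a (r n') + t) x) < e" by blast
    qed simp
    then show ?thesis using complete unfolding mcomplete_def top by auto
  qed
  then obtain F where F: "\<And>t x. (\<lambda>n. f (a (r n) + t) x) \<longlonglongrightarrow> F t x" by metis
  have "((\<lambda>(n, v). case v of (t, x) \<Rightarrow> f (a (r n) + t) x) \<longlongrightarrow> (case z of (t, x) \<Rightarrow> F t x)) (sequentially \<times>\<^sub>F nhds z)" for z
  proof (rule continuous_convergenceI)
    obtain t x where tx: "z = (t, x)" by fastforce
    fix n :: "nat \<Rightarrow> nat" and v assume n: "filterlim n at_top sequentially" and v: "v \<longlonglongrightarrow> z"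
    have 1: "(\<lambda>j. d (f (a (r (n j)) + fst (v j)) (snd (v j))) (f (a (r (n j)) + t) x)) \<longlonglongrightarrow> 0"
      using tendsto_fst[OF v] tendsto_snd[OF v] by (intro equicontinuous) (simp_all add: tx)
    have 2: "(\<lambda>j. d (f (a (r (n j)) + t) x) (F t x)) \<longlonglongrightarrow> 0"
      unfolding tendsto_iff_d[symmetric] using filterlim_compose[OF F n] .
    have "(\<lambda>j. d (f (a (r (n j)) + fst (v j)) (snd (v j))) (F t x)) \<longlonglongrightarrow> 0"
      by (rule tendsto_sandwich[OF _ _ tendsto_const tendsto_add_zero[OF 1 2]])
        (auto intro!: always_eventually triangle)
    then have "(\<lambda>j. f (a (r (n j)) + fst (v j)) (snd (v j))) \<longlonglongrightarrow> F t x" by (simp only: tendsto_iff_d)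
    then show "\<exists>q :: nat \<Rightarrow> nat. strict_mono q \<and>
        (\<lambda>j. case v (q j) of (t, x) \<Rightarrow> f (a (r (n (q j))) + t) x) \<longlonglongrightarrow> (case z of (t, x) \<Rightarrow> F t x)"
      by (intro exI[of _ id]) (simp add: tx case_prod_unfold strict_mono_def)
  qed
  then show ?thesis using r by blast
qed

end

text \<open>By contradiction: without relatively dense periods there are translations whose law
  functions differ pairwise by more than \<open>\<epsilon>\<close> at some time. On a subsequence
  for which the laws of X and countably many sections of f are uniformly Cauchy, consecutive
  translates \<open>p n\<close> and \<open>q n\<close> of these bad times share a limit law and a
  limit function, so the image laws have the same limit.\<close>

theorem almost_periodic_in_distr_compose:
  fixes X :: "real \<Rightarrow> 'w \<Rightarrow> 'x::{metric_space, second_countable_topology}"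
    and f :: "real \<Rightarrow> 'x \<Rightarrow> 'y::{complete_space, second_countable_topology}"
  assumes M: "prob_space M" and X: "continuous_process M X"
    and f: "continuous_on UNIV (\<lambda>(t, x). f t x)"
    and AP: "almost_periodic_in_distr M X" "almost_periodic_unif_compact f"
  shows "almost_periodic_in_distr M (\<lambda>t \<omega>. f t (X t \<omega>))"
proof -
  let ?\<phi> = "path_law M X" and ?\<psi> = "path_law M (\<lambda>t \<omega>. f t (X t \<omega>))"
  have \<psi>: "continuous_map euclidean narrow_topology ?\<psi>"
    by (rule continuous_map_path_law[OF M continuous_process_compose[OF X f]])
  obtain dX where dX: "complete_distance narrow_topology dX" and
    \<phi>_ap: "\<forall>\<epsilon>>0. \<exists>l>0. \<forall>a. \<exists>\<tau>\<in>{a..a + l}. \<forall>t. dX (?\<phi> (t + \<tau>)) (?\<phi> t) \<le> \<epsilon>"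
    and \<phi>_cont: "continuous_map euclidean narrow_topology ?\<phi>"
    using AP(1) unfolding almost_periodic_in_distr_def almost_periodic_def by blast
  have mX: "Metric_space borel_prob_measures dX" "Metric_space.mtopology borel_prob_measures dX = narrow_topology"
    "Metric_space.mcomplete borel_prob_measures dX"
    using dX by (auto simp: complete_distance_def topspace_narrow_topology)
  interpret L: Metric_space "borel_prob_measures :: 'x Ck measure set" dX by (rule mX)
  have \<phi>: "L.ap ?\<phi>" using \<phi>_ap \<phi>_cont by (simp add: L.ap_def mX)
  obtain dY where dY: "complete_distance euclidean dY" and
    f_ap: "\<forall>K. compact K \<longrightarrow> (\<forall>\<epsilon>>0. \<exists>l>0. \<forall>a. \<exists>\<tau>\<in>{a..a + l}. \<forall>t. \<forall>x\<in>K. dY (f (t + \<tau>) x) (f t x) \<le> \<epsilon>)"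
    using AP(2) unfolding almost_periodic_unif_compact_def by (elim exE conjE)
  interpret P: ap_parameter dY f
    using dY f f_ap[rule_format] by (intro ap_parameter.intro ap_parameter_axioms.intro) (simp_all add: complete_distance_def)
  interpret B: Metric_space "borel_prob_measures :: 'y Ck measure set" bl_dist by (rule Metric_space_bl_dist)
  have "\<exists>l>0. \<forall>a. \<exists>\<tau>\<in>{a..a + l}. \<forall>t. bl_dist (?\<psi> (t + \<tau>)) (?\<psi> t) \<le> \<epsilon>" if \<epsilon>: "\<epsilon> > 0" for \<epsilon>
  proof (rule ccontr)
    assume "\<nexists>l. l > 0 \<and> (\<forall>a. \<exists>\<tau>\<in>{a..a + l}. \<forall>t. bl_dist (?\<psi> (t + \<tau>)) (?\<psi> t) \<le> \<epsilon>)"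
    from B.separated_translates[OF this]
    obtain s :: "nat \<Rightarrow> real" where s: "\<And>i j. i < j \<Longrightarrow> \<exists>t. \<epsilon> < bl_dist (?\<psi> (t + s j)) (?\<psi> (t + s i))"
      by blast
    \<comment> \<open>Bochner's criterion is applied to the sections at a dense sequence; continuity
      of the limit functions extends their equality to every x.\<close>
    obtain z :: "nat \<Rightarrow> 'x" where z: "\<And>x e. e > 0 \<Longrightarrow> \<exists>i. dist x (z i) < e"
      using ex_dense_sequence by blast
    obtain r1 where r1: "strict_mono r1" "L.uniformly_Cauchy_translates ?\<phi> (s \<circ> r1)"
      using L.ap_Bochner_family[of "\<lambda>_. ?\<phi>" s] \<phi> by blast
    obtain r2 where r2: "strict_mono r2" "\<And>k. P.uniformly_Cauchy_translates (\<lambda>t. f t (z k)) (s \<circ> r1 \<circ> r2)"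
      using P.ap_Bochner_family[of "\<lambda>k t. f t (z k)" "s \<circ> r1"] P.ap_section by blast
    define S where "S = s \<circ> r1 \<circ> r2"
    have S_\<phi>: "L.uniformly_Cauchy_translates ?\<phi> S" unfolding S_def by (rule L.uniformly_Cauchy_translates_subseq[OF r1(2) r2(1)])
    have S_f: "P.uniformly_Cauchy_translates (\<lambda>t. f t (z k)) S" for k unfolding S_def by (rule r2(2))
    have "\<exists>t. \<epsilon> < bl_dist (?\<psi> (t + S (Suc n))) (?\<psi> (t + S n))" for n
      unfolding S_def o_def using strict_mono_o[OF r1(1) r2(1)] by (intro s) (simp add: strict_mono_def)
    then obtain t where t: "\<And>n. \<epsilon> < bl_dist (?\<psi> (t n + S (Suc n))) (?\<psi> (t n + S n))" by metis
    define p q where "p n = t n + S (Suc n)" and "q n = t n + S n" for n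
    have close_\<phi>: "(\<lambda>n. dX (?\<phi> (p n)) (?\<phi> (q n))) \<longlonglongrightarrow> 0"
    proof (rule LIMSEQ_I)
      fix e :: real assume "e > 0"
      then obtain N where N: "\<forall>i\<ge>N. \<forall>j\<ge>N. \<forall>t. dX (?\<phi> (t + S i)) (?\<phi> (t + S j)) \<le> e / 2"
        using S_\<phi> unfolding L.uniformly_Cauchy_translates_def by (meson half_gt_zero)
      have "dX (?\<phi> (p n)) (?\<phi> (q n)) \<le> e / 2" if "n \<ge> N" for n
        unfolding p_def q_def using N that by simp
      then show "\<exists>no. \<forall>n\<ge>no. norm (dX (?\<phi> (p n)) (?\<phi> (q n)) - 0) < e"
        using \<open>e > 0\<close> by (intro exI[of _ N]) force
    qed
    have close_f: "(\<lambda>n. dY (f (p n + u) (z k)) (f (q n + u) (z k))) \<longlonglongrightarrow> 0" for u k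
    proof (rule LIMSEQ_I)
      fix e :: real assume "e > 0"
      then obtain N where N: "\<forall>i\<ge>N. \<forall>j\<ge>N. \<forall>t. dY (f (t + S i) (z k)) (f (t + S j) (z k)) \<le> e / 2"
        using S_f[of k] unfolding P.uniformly_Cauchy_translates_def by (meson half_gt_zero)
      have "dY (f (p n + u) (z k)) (f (q n + u) (z k)) \<le> e / 2" if "n \<ge> N" for n
        using N[rule_format, of "Suc n" n "t n + u"] that by (simp add: p_def q_def algebra_simps)
      then show "\<exists>no. \<forall>n\<ge>no. norm (dY (f (p n + u) (z k)) (f (q n + u) (z k)) - 0) < e"
        using \<open>e > 0\<close> by (intro exI[of _ N]) force
    qed
    \<comment> \<open>Three nested extractions: the laws along q, then the translates of f along q
      and along p. The laws along p follow those along q by \<open>close_\<phi>\<close>.\<close>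
    obtain k1 N where k1: "strict_mono k1" "limitin L.mtopology (\<lambda>n. ?\<phi> (q (k1 n))) N sequentially"
      using L.ap_relatively_compact[OF \<phi> mX(3), of q] by blast
    obtain k2 F where k2: "strict_mono k2" and F: "\<And>v. ((\<lambda>(n, w). case w of (t, x) \<Rightarrow> f ((q \<circ> k1) (k2 n) + t) x) \<longlongrightarrow> (case v of (t, x) \<Rightarrow> F t x)) (sequentially \<times>\<^sub>F nhds v)"
      using P.translates_compact[of "q \<circ> k1"] by blast
    obtain k3 F' where k3: "strict_mono k3" and F': "\<And>v. ((\<lambda>(n, w). case w of (t, x) \<Rightarrow> f ((p \<circ> k1 \<circ> k2) (k3 n) + t) x) \<longlongrightarrow> (case v of (t, x) \<Rightarrow> F' t x)) (sequentially \<times>\<^sub>F nhds v)"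
      using P.translates_compact[of "p \<circ> k1 \<circ> k2"] by blast
    define k where "k = k1 \<circ> k2 \<circ> k3"
    have k: "strict_mono k" unfolding k_def by (intro strict_mono_o k1 k2 k3)
    have Fk: "((\<lambda>(n, w). case w of (t, x) \<Rightarrow> f (q (k n) + t) x) \<longlongrightarrow> (case v of (t, x) \<Rightarrow> F t x)) (sequentially \<times>\<^sub>F nhds v)" for v
      using continuous_convergenceD[OF F filterlim_compose[OF filterlim_subseq[OF k3] filterlim_fst] filterlim_snd]
      by (simp add: k_def case_prod_unfold)
    have Fk': "((\<lambda>(n, w). case w of (t, x) \<Rightarrow> f (p (k n) + t) x) \<longlongrightarrow> (case v of (t, x) \<Rightarrow> F' t x)) (sequentially \<times>\<^sub>F nhds v)" for v
      using F' by (simp add: k_def)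
    have F_cont: "continuous_on UNIV (\<lambda>(t, x). F t x)" by (rule continuous_convergence_imp_continuous[OF Fk])
    have F'_cont: "continuous_on UNIV (\<lambda>(t, x). F' t x)" by (rule continuous_convergence_imp_continuous[OF Fk'])
    have F_dense: "F' u (z i) = F u (z i)" for u i
    proof -
      have 1: "(\<lambda>n. f (p (k n) + u) (z i)) \<longlonglongrightarrow> F' u (z i)"
        using continuous_convergence_pointwise[OF Fk', of "(u, z i)"] by simp
      have 2: "(\<lambda>n. f (q (k n) + u) (z i)) \<longlonglongrightarrow> F u (z i)"
        using continuous_convergence_pointwise[OF Fk, of "(u, z i)"] by simp
      have 3: "(\<lambda>n. dY (f (p (k n) + u) (z i)) (f (q (k n) + u) (z i))) \<longlonglongrightarrow> 0"
        using LIMSEQ_subseq_LIMSEQ[OF close_f k] by (simp add: o_def)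
      have "(\<lambda>n. dY (f (p (k n) + u) (z i)) (F u (z i))) \<longlonglongrightarrow> 0"
        by (rule tendsto_sandwich[OF _ _ tendsto_const tendsto_add_zero[OF 3 2[unfolded P.tendsto_iff_d]]])
          (auto intro!: always_eventually P.triangle)
      then have "(\<lambda>n. f (p (k n) + u) (z i)) \<longlonglongrightarrow> F u (z i)" by (simp only: P.tendsto_iff_d)
      then show ?thesis using 1 LIMSEQ_unique by blast
    qed
    have F_eq: "F' = F"
    proof (intro ext)
      fix u x
      have "\<exists>i. dist x (z i) < inverse (real (Suc n))" for n by (rule z) simp
      then obtain i where i: "\<And>n. dist x (z (i n)) < inverse (real (Suc n))" by metis
      have "(\<lambda>n. dist (z (i n)) x) \<longlonglongrightarrow> 0"
        by (rule tendsto_sandwich[OF _ _ tendsto_const LIMSEQ_inverse_real_of_nat])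
          (use i in \<open>auto simp: dist_commute intro!: always_eventually less_imp_le\<close>)
      then have zi: "(\<lambda>n. z (i n)) \<longlonglongrightarrow> x" by (rule tendsto_dist_iff[THEN iffD2])
      from continuous_on_tendsto_compose[OF F_cont tendsto_Pair[OF tendsto_const[of u] zi]]
        continuous_on_tendsto_compose[OF F'_cont tendsto_Pair[OF tendsto_const[of u] zi]]
      have "(\<lambda>n. F u (z (i n))) \<longlonglongrightarrow> F u x" "(\<lambda>n. F u (z (i n))) \<longlonglongrightarrow> F' u x"
        by (simp_all add: F_dense)
      then show "F' u x = F u x" using LIMSEQ_unique by blast
    qed
    have \<phi>P: "?\<phi> t \<in> borel_prob_measures" for t by (rule path_law_borel_prob_measures[OF M X])
    have "limitin L.mtopology (\<lambda>n. ?\<phi> (q (k n))) N sequentially"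
      using limitin_subsequence[OF strict_mono_o[OF k2 k3] k1(2)] by (simp add: k_def o_def)
    note Nq = this
    have "limitin L.mtopology (\<lambda>n. ?\<phi> (p (k n))) N sequentially"
    proof -
      have NP: "N \<in> borel_prob_measures" and 1: "(\<lambda>n. dX (?\<phi> (q (k n))) N) \<longlonglongrightarrow> 0"
        using Nq unfolding L.limitin_metric_dist_null by auto
      have 2: "(\<lambda>n. dX (?\<phi> (p (k n))) (?\<phi> (q (k n)))) \<longlonglongrightarrow> 0"
        using LIMSEQ_subseq_LIMSEQ[OF close_\<phi> k] by (simp add: o_def)
      have "(\<lambda>n. dX (?\<phi> (p (k n))) N) \<longlonglongrightarrow> 0"
        by (rule tendsto_sandwich[OF _ _ tendsto_const tendsto_add_zero[OF 2 1]])
          (auto intro!: always_eventually L.triangle \<phi>P NP)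
      then show ?thesis unfolding L.limitin_metric_dist_null using \<phi>P NP by simp
    qed
    note Np = this
    define L where "L = distr N borel (compose_Ck F)"
    have lim: "limitin narrow_topology (\<lambda>n. ?\<psi> (a n)) L sequentially"
      if "limitin L.mtopology (\<lambda>n. ?\<phi> (a n)) N sequentially"
        and "\<And>v. ((\<lambda>(n, w). case w of (t, x) \<Rightarrow> f (a n + t) x) \<longlongrightarrow> (case v of (t, x) \<Rightarrow> F t x)) (sequentially \<times>\<^sub>F nhds v)" for a
      unfolding path_law_compose[OF X f] L_def
      by (rule limitin_narrow_distr[OF that(1)[unfolded mX(2)] \<phi>P measurable_compose_Ck[OF continuous_on_shift[OF f]]
          compose_Ck_continuous_convergence[OF continuous_on_shift[OF f] that(2)]])
    have null: "(\<lambda>n. bl_dist (?\<psi> (a n)) L) \<longlonglongrightarrow> 0"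
      if "limitin narrow_topology (\<lambda>n. ?\<psi> (a n)) L sequentially" for a
      using that unfolding mtopology_bl_dist[symmetric] B.limitin_metric_dist_null by blast
    have LP: "L \<in> borel_prob_measures" using lim[OF Nq Fk] unfolding limitin_narrow_iff by blast
    have \<psi>P: "?\<psi> t \<in> borel_prob_measures" for t
      by (rule path_law_borel_prob_measures[OF M continuous_process_compose[OF X f]])
    have 1: "(\<lambda>n. bl_dist (?\<psi> (p (k n))) L) \<longlonglongrightarrow> 0" by (rule null[OF lim[OF Np Fk'[unfolded F_eq]]])
    have 2: "(\<lambda>n. bl_dist L (?\<psi> (q (k n)))) \<longlonglongrightarrow> 0" using null[OF lim[OF Nq Fk]] by (simp add: B.commute)
    have "(\<lambda>n. bl_dist (?\<psi> (p (k n))) (?\<psi> (q (k n)))) \<longlonglongrightarrow> 0"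
      by (rule tendsto_sandwich[OF _ _ tendsto_const tendsto_add_zero[OF 1 2]])
        (auto intro!: always_eventually B.triangle \<psi>P LP)
    then have "\<forall>\<^sub>F n in sequentially. bl_dist (?\<psi> (p (k n))) (?\<psi> (q (k n))) < \<epsilon>"
      using \<epsilon> by (intro order_tendstoD(2)) auto
    then obtain n where "bl_dist (?\<psi> (p (k n))) (?\<psi> (q (k n))) < \<epsilon>" by (auto simp: eventually_sequentially)
    then show False using t[of "k n"] by (simp add: p_def q_def)
  qed
  then show ?thesis
    unfolding almost_periodic_in_distr_def almost_periodic_def using \<psi> complete_distance_bl_dist by blast
qed

theorem theorem3p8:
  fixes M :: "'w measure"
    and X :: "real \<Rightarrow> 'w \<Rightarrow> 'x::polish_space"
    and f :: "real \<Rightarrow> 'x \<Rightarrow> 'y::polish_space"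
    and X' :: "real \<Rightarrow> 'w \<Rightarrow> 'a::{banach, second_countable_topology}"
    and f' g h :: "real \<Rightarrow> 'a \<Rightarrow> 'b::{banach, second_countable_topology}"
    and \<mu> :: "real measure"
    and p :: real
  assumes "prob_space M"
  shows
    "(continuous_process M X \<and> continuous_on UNIV (\<lambda>(t, x). f t x) \<and>
      almost_periodic_in_distr M X \<and> almost_periodic_unif_compact f
      \<longrightarrow> almost_periodic_in_distr M (\<lambda>t \<omega>. f t (X t \<omega>)))
   \<and> (continuous_process M X \<and> continuous_on UNIV (\<lambda>(t, x). f t x) \<and>
      almost_automorphic_in_distr M X \<and> f \<in> AAcUc
      \<longrightarrow> almost_automorphic_in_distr M (\<lambda>t \<omega>. f t (X t \<omega>)))
   \<and> (continuous_process M X' \<and> continuous_on UNIV (\<lambda>(t, x). f' t x) \<and>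
      sets \<mu> = sets borel \<and> emeasure \<mu> UNIV = \<infinity> \<and>
      (\<forall>I. is_interval I \<and> bounded I \<longrightarrow> emeasure \<mu> I < \<infinity>) \<and>
      p \<ge> 0 \<and>
      (\<forall>t x. f' t x = g t x + h t x) \<and> g \<in> AAcUc \<and> h \<in> EUc \<mu> \<and>
      (\<forall>t. continuous_on UNIV (g t)) \<and>
      (\<forall>\<epsilon>>0. \<forall>K. compact K \<longrightarrow> (\<exists>\<eta>>0. \<forall>x\<in>K. \<forall>y\<in>K.
         norm (x - y) \<le> \<eta> \<longrightarrow> (\<forall>t. norm (f' t x - f' t y) \<le> \<epsilon>))) \<and>
      (p > 0 \<longrightarrow>
         (\<exists>C. \<forall>t x. norm (f' t x) + norm (g t x) \<le> C * (1 + norm x)) \<and>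
         (\<exists>L. \<forall>t. L-lipschitz_on UNIV (f' t))) \<and>
      pseudo_almost_automorphic_in_p_distr p M \<mu> X'
      \<longrightarrow> pseudo_almost_automorphic_in_p_distr p M \<mu> (\<lambda>t \<omega>. f' t (X' t \<omega>)))"
proof (intro conjI impI; elim conjE)
  assume "continuous_process M X" "continuous_on UNIV (\<lambda>(t, x). f t x)"
    "almost_periodic_in_distr M X" "almost_periodic_unif_compact f"
  then show "almost_periodic_in_distr M (\<lambda>t \<omega>. f t (X t \<omega>))"
    by (rule almost_periodic_in_distr_compose[OF assms])
next
  assume "continuous_process M X" "continuous_on UNIV (\<lambda>(t, x). f t x)"
    "almost_automorphic_in_distr M X" "f \<in> AAcUc"
  then show "almost_automorphic_in_distr M (\<lambda>t \<omega>. f t (X t \<omega>))"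
    by (rule almost_automorphic_in_distr_compose[OF assms])
next
  assume X: "continuous_process M X'" and f: "continuous_on UNIV (\<lambda>(t, x). f' t x)"
    and \<mu>: "sets \<mu> = sets borel" "emeasure \<mu> UNIV = \<infinity>" "\<forall>I. is_interval I \<and> bounded I \<longrightarrow> emeasure \<mu> I < \<infinity>"
    and p: "p \<ge> 0" and fgh: "\<forall>t x. f' t x = g t x + h t x"
    and g: "g \<in> AAcUc" "\<forall>t. continuous_on UNIV (g t)" and h: "h \<in> EUc \<mu>"
    and uc: "\<forall>\<epsilon>>0. \<forall>K. compact K \<longrightarrow> (\<exists>\<eta>>0. \<forall>x\<in>K. \<forall>y\<in>K.
         norm (x - y) \<le> \<eta> \<longrightarrow> (\<forall>t. norm (f' t x - f' t y) \<le> \<epsilon>))"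
    and growth: "p > 0 \<longrightarrow> (\<exists>C. \<forall>t x. norm (f' t x) + norm (g t x) \<le> C * (1 + norm x)) \<and>
         (\<exists>L. \<forall>t. L-lipschitz_on UNIV (f' t))"
    and PAA: "pseudo_almost_automorphic_in_p_distr p M \<mu> X'"
  have "averaging_measure \<mu>" using \<mu> by (simp add: averaging_measure_def)
  then show "pseudo_almost_automorphic_in_p_distr p M \<mu> (\<lambda>t \<omega>. f' t (X' t \<omega>))"
    using fgh g uc growth
    by (intro pseudo_almost_automorphic_in_p_distr_compose[OF assms _ p X f _ _ _ h _ _ _ PAA]) blast+
qed

end
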